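(* Let $\Omega\subset\mathbb{R}^2$ be a simply connected polygonal domain with triangulation $\mathcal{T}^h$, and let $\kappa:\Omega\to\mathbb{R}^+$ satisfy $\kappa_{\min}\le\kappa(x)\le\kappa_{\max}$ for all $x\in\Omega$, with constants $0<\kappa_{\min}\le\kappa_{\max}$. Denote by $\eta=\kappa_{\max}/\kappa_{\min}$ the contrast. With the matrices $H$, $D=D(\kappa)$ and $\widehat{A}$ defined in the context, $$\operatorname{cond}\bigl(H^{-1}D^{-1}H^{-T}\widehat{A}\bigr)\le 2\eta-1 .$$
   Context: $\Omega\subset\mathbb{R}^2$ is a bounded simply connected polygonal domain (the interior of a simple closed polygon) and $\mathcal{T}^h$ is a conforming triangulation of $\Omega$ by finitely many nondegenerate triangles (two distinct closed triangles meet in the empty set, a common vertex or a common full edge). $N_T$ is the number of triangles, $N_e$ the number of interior edges (edges not contained in $\partial\Omega$), and $\widetilde{N}_v$ the number of all vertices, including boundary ones. $|T|$ is the area and $x_T$ the barycenter of $T\in\mathcal{T}^h$. Crouzeix-Raviart space: $V^{CR}$ is the space of functions that are affine on each triangle, continuous at the midpoints of interior edges, and zero at the midpoints of boundary edges. Its basis $\{\phi_e^{CR}\}$ is indexed by interior edges $e$: $\phi_e^{CR}$ equals $1$ at the midpoint of $e$ and $0$ at the midpoints of all other edges. For $l=1,2$, $G_{CR,l}$ is the $N_T\times N_e$ matrix with entries $\sqrt{|T|}\,\partial_l\phi_e^{CR}(x_T)$ (row $T$, column $e$), and $G_{CR}=\begin{bmatrix}G_{CR,1}\\ G_{CR,2}\end{bmatrix}$,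 of size $2N_T\times N_e$. Conforming space: $\widetilde{V}^L$ is the space of continuous functions on $\overline\Omega$ that are affine on each triangle (no boundary condition), of dimension $\widetilde{N}_v$. Fix a basis $\psi_1,\dots,\psi_{\widetilde{N}_v-1}$ of the subspace $\{v\in\widetilde{V}^L:\int_\Omega v\,dx=0\}$. For $l=1,2$, $\widetilde{G}_{L,l}$ is the $N_T\times(\widetilde{N}_v-1)$ matrix with entries $\sqrt{|T|}\,\partial_l\psi_j(x_T)$ (row $T$, column $j$), and $\widetilde{C}_L=\begin{bmatrix}\widetilde{G}_{L,2}\\ -\widetilde{G}_{L,1}\end{bmatrix}$, of size $2N_T\times(\widetilde{N}_v-1)$ (the discrete curl, where $\overrightarrow{\mathrm{curl}}\,w=(\partial_2w,-\partial_1w)$). Coefficient: $\kappa$ is measurable; $\kappa_T$ is the average of $\kappa$ over $T$; $D_1=D_2=\mathrm{diag}(\kappa_T)_{T\in\mathcal{T}^h}$ and $D=D(\kappa)=\mathrm{diag}(D_1,D_2)$, of size $2N_T\times 2N_T$. The triangles are ordered in the same way in all matrices. Block matrices: $A_{CR}=G_{CR}^TDG_{CR}$, $\widetilde{A}_L=\widetilde{C}_L^TD\widetilde{C}_L$, $\widehat{A}=\begin{bmatrix}A_{CR}&0\\0&\widetilde{A}_L\end{bmatrix}$, $H=[G_{CR}\ \ \widetilde{C}_L]$. The matrix $H$ is square of size $2N_T\times2N_T$ and nonsingular, and $H^{-T}$ denotes $(H^T)^{-1}$. The preconditioner is $M=H^TDH$, so $M^{-1}=H^{-1}D^{-1}H^{-T}$;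 $M$ and $\widehat{A}$ are symmetric positive definite. $\operatorname{cond}(M^{-1}\widehat{A})$ is the spectral condition number of the preconditioned system as used for preconditioned conjugate gradients, i.e. the ratio of the largest to the smallest eigenvalue of $M^{-1}\widehat{A}$ (all its eigenvalues are real and positive). *)

theory Defs
  imports "HOL-Analysis.Analysis" "Jordan_Normal_Form.Spectral_Radius"
begin

section \<open>Domain and triangulation\<close>

text \<open>The polygonal path through a list of points.\<close>

fun polyline :: "'a::real_normed_vector list \<Rightarrow> real \<Rightarrow> 'a" where
  "polyline [] = linepath 0 0"
| "polyline [a] = linepath a a"
| "polyline [a, b] = linepath a b"
| "polyline (a # b # c # vs) = linepath a b +++ polyline (b # c # vs)"

text \<open>The interior of a simple closed polygon; such a set is automatically open, bounded and
  simply connected. The list \<open>vs\<close> runs once around the polygon, so its first and last entries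
  coincide.\<close>

definition polygonal_domain :: "(real^2) set \<Rightarrow> bool" where
  "polygonal_domain \<Omega> \<longleftrightarrow>
     (\<exists>vs. simple_path (polyline vs) \<and> pathfinish (polyline vs) = pathstart (polyline vs) \<and>
           \<Omega> = inside (path_image (polyline vs)))"

text \<open>Triangles are closed. Conformity is part of the library predicate \<^const>\<open>triangulation\<close>:
  any two members intersect in a common face, which for distinct triangles
  is empty, a common vertex or a common edge.\<close>

definition triangulation_of :: "(real^2) set set \<Rightarrow> (real^2) set \<Rightarrow> bool" where
  "triangulation_of \<T> \<Omega> \<longleftrightarrow>
     triangulation \<T> \<and> (\<forall>T\<in>\<T>. 2 simplex T) \<and> \<Union>\<T> = closure \<Omega>"

definition mesh_vertices :: "(real^2) set set \<Rightarrow> (real^2) set" where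
  "mesh_vertices \<T> = {v. \<exists>T\<in>\<T>. v extreme_point_of T}"

definition mesh_edges :: "(real^2) set set \<Rightarrow> (real^2) set set" where
  "mesh_edges \<T> = {e. \<exists>T\<in>\<T>. e edge_of T}"

definition boundary_edges :: "(real^2) set \<Rightarrow> (real^2) set set \<Rightarrow> (real^2) set set" where
  "boundary_edges \<Omega> \<T> = {e \<in> mesh_edges \<T>. e \<subseteq> frontier \<Omega>}"

definition interior_edges :: "(real^2) set \<Rightarrow> (real^2) set set \<Rightarrow> (real^2) set set" where
  "interior_edges \<Omega> \<T> = {e \<in> mesh_edges \<T>. \<not> e \<subseteq> frontier \<Omega>}"

text \<open>The mean of the vertices of a simplex: the midpoint of an edge, the barycenter of a
  triangle.\<close>

definition barycenter :: "(real^2) set \<Rightarrow> real^2" where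
  "barycenter S = (\<Sum>v | v extreme_point_of S. v) /\<^sub>R real (card {v. v extreme_point_of S})"


section \<open>Finite element spaces\<close>

definition affine_fun_on :: "(real^2) set \<Rightarrow> (real^2 \<Rightarrow> real) \<Rightarrow> bool" where
  "affine_fun_on S f \<longleftrightarrow> (\<exists>a b. \<forall>x\<in>S. f x = inner a x + b)"

text \<open>A Crouzeix--Raviart function is in general discontinuous across edges, so on the edges it
  has no canonical values away from the midpoints: it is required to be affine on the interior of
  each triangle only. Continuity at a midpoint within \<open>closure \<Omega>\<close> says that the value there is the
  trace from every adjacent triangle; for a boundary edge this makes the vanishing value the
  one-sided trace.\<close>

definition CR_space :: "(real^2) set \<Rightarrow> (real^2) set set \<Rightarrow> (real^2 \<Rightarrow> real) set" where
  "CR_space \<Omega> \<T> = {f.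
     (\<forall>T\<in>\<T>. affine_fun_on (interior T) f) \<and>
     (\<forall>e\<in>mesh_edges \<T>. continuous (at (barycenter e) within closure \<Omega>) f) \<and>
     (\<forall>e\<in>boundary_edges \<Omega> \<T>. f (barycenter e) = 0)}"

definition CR_basis_function ::
  "(real^2) set \<Rightarrow> (real^2) set set \<Rightarrow> (real^2) set \<Rightarrow> (real^2 \<Rightarrow> real) \<Rightarrow> bool" where
  "CR_basis_function \<Omega> \<T> e f \<longleftrightarrow>
     f \<in> CR_space \<Omega> \<T> \<and> f (barycenter e) = 1 \<and>
     (\<forall>e'\<in>mesh_edges \<T> - {e}. f (barycenter e') = 0)"

definition P1_space :: "(real^2) set \<Rightarrow> (real^2) set set \<Rightarrow> (real^2 \<Rightarrow> real) set" where
  "P1_space \<Omega> \<T> = {f. continuous_on (closure \<Omega>) f \<and> (\<forall>T\<in>\<T>. affine_fun_on T f)}"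

definition P1_mean_zero_space :: "(real^2) set \<Rightarrow> (real^2) set set \<Rightarrow> (real^2 \<Rightarrow> real) set" where
  "P1_mean_zero_space \<Omega> \<T> = {f \<in> P1_space \<Omega> \<T>. set_lebesgue_integral lebesgue \<Omega> f = 0}"

text \<open>A list of functions is a basis of the space \<open>V\<close> of functions on \<open>S\<close>. Functions are total
  in HOL, so all identities are restricted to \<open>S\<close>.\<close>

definition is_function_basis ::
  "(real^2) set \<Rightarrow> (real^2 \<Rightarrow> real) set \<Rightarrow> (real^2 \<Rightarrow> real) list \<Rightarrow> bool" where
  "is_function_basis S V fs \<longleftrightarrow>
     set fs \<subseteq> V \<and>
     (\<forall>c. (\<forall>x\<in>S. (\<Sum>j<length fs. c j * (fs ! j) x) = 0) \<longrightarrow> (\<forall>j<length fs. c j = 0)) \<and>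
     (\<forall>f\<in>V. \<exists>c. \<forall>x\<in>S. f x = (\<Sum>j<length fs. c j * (fs ! j) x))"


section \<open>Matrices\<close>

definition partial_deriv :: "2 \<Rightarrow> (real^2 \<Rightarrow> real) \<Rightarrow> real^2 \<Rightarrow> real" where
  "partial_deriv l f x = deriv (\<lambda>t. f (x + t *\<^sub>R axis l 1)) 0"

definition area :: "(real^2) set \<Rightarrow> real" where
  "area T = measure lebesgue T"

text \<open>The average of \<open>\<kappa>\<close> over the closed triangle \<open>T\<close>. As \<open>\<kappa>\<close> is given on \<open>\<Omega>\<close> only, the integral
  is taken over the interior of \<open>T\<close>; the boundary of \<open>T\<close> is a null set.\<close>

definition triangle_average :: "(real^2 \<Rightarrow> real) \<Rightarrow> (real^2) set \<Rightarrow> real" where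
  "triangle_average \<kappa> T = set_lebesgue_integral lebesgue (interior T) \<kappa> / area T"

definition scaled_deriv_mat ::
  "(real^2) set list \<Rightarrow> (real^2 \<Rightarrow> real) list \<Rightarrow> 2 \<Rightarrow> real mat" where
  "scaled_deriv_mat ts fs l = Matrix.mat (length ts) (length fs)
     (\<lambda>(i, j). sqrt (area (ts ! i)) * partial_deriv l (fs ! j) (barycenter (ts ! i)))"

definition grad_mat :: "(real^2) set list \<Rightarrow> (real^2 \<Rightarrow> real) list \<Rightarrow> real mat" where
  "grad_mat ts fs = scaled_deriv_mat ts fs 1 @\<^sub>r scaled_deriv_mat ts fs 2"

definition curl_mat :: "(real^2) set list \<Rightarrow> (real^2 \<Rightarrow> real) list \<Rightarrow> real mat" where
  "curl_mat ts fs = scaled_deriv_mat ts fs 2 @\<^sub>r (- scaled_deriv_mat ts fs 1)"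

definition coeff_mat :: "(real^2) set list \<Rightarrow> (real^2 \<Rightarrow> real) \<Rightarrow> real mat" where
  "coeff_mat ts \<kappa> =
     (let D1 = mat_diag (length ts) (\<lambda>i. triangle_average \<kappa> (ts ! i))
      in diag_block_mat [D1, D1])"

definition append_cols :: "'a::zero mat \<Rightarrow> 'a mat \<Rightarrow> 'a mat" where
  "append_cols A B = four_block_mat A B (0\<^sub>m 0 (dim_col A)) (0\<^sub>m 0 (dim_col B))"

definition H_mat ::
  "(real^2) set list \<Rightarrow> (real^2 \<Rightarrow> real) list \<Rightarrow> (real^2 \<Rightarrow> real) list \<Rightarrow> real mat" where
  "H_mat ts \<phi>s \<psi>s = append_cols (grad_mat ts \<phi>s) (curl_mat ts \<psi>s)"

definition A_hat ::
  "(real^2) set list \<Rightarrow> (real^2 \<Rightarrow> real) list \<Rightarrow> (real^2 \<Rightarrow> real) list \<Rightarrow> (real^2 \<Rightarrow> real)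
    \<Rightarrow> real mat" where
  "A_hat ts \<phi>s \<psi>s \<kappa> =
     (let G = grad_mat ts \<phi>s; C = curl_mat ts \<psi>s; D = coeff_mat ts \<kappa>
      in diag_block_mat [transpose_mat G * D * G, transpose_mat C * D * C])"

text \<open>The inverse of a nonsingular square matrix, unspecified otherwise.\<close>

definition inv_mat :: "'a::field mat \<Rightarrow> 'a mat" where
  "inv_mat A = the (mat_inverse A)"

text \<open>Ratio of the largest to the smallest eigenvalue, for matrices with real positive spectrum.\<close>

definition spectral_cond :: "real mat \<Rightarrow> real" where
  "spectral_cond A = Max (spectrum A) / Min (spectrum A)"

end

theory Submission
  imports Defs
begin

text \<open>Let \<open>z = (x, y)\<close> be an eigenvector of the preconditioned matrix for the eigenvalue \<open>r\<close>,
  and put \<open>a = G x\<close>, \<open>b = C y\<close>, where \<open>G\<close> and \<open>C\<close> are the two blocks of \<open>H\<close>. Pairing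
  \<open>Ah z = r H\<^sup>T D H z\<close> with \<open>z\<close> gives \<open>|a|\<^sup>2 + |b|\<^sup>2 = r |a + b|\<^sup>2\<close> in the norm weighted by the diagonal
  of \<open>D\<close>. Discrete gradients and discrete curls are orthogonal in the unweighted inner product, so
  the unweighted squared norm of both \<open>a + b\<close> and \<open>a - b\<close> is the sum of those of \<open>a\<close> and \<open>b\<close>. Passing
  from the weighted norm to the unweighted one and back costs at most the contrast \<open>\<eta>\<close>; hence
  \<open>|a|\<^sup>2 + |b|\<^sup>2 \<le> \<eta> |a \<plusminus> b|\<^sup>2\<close> in the weighted norm. The plus sign says \<open>r \<le> \<eta>\<close>. The minus sign and
  the parallelogram law give \<open>|a + b|\<^sup>2 \<le> (2 - 1/\<eta>) (|a|\<^sup>2 + |b|\<^sup>2)\<close>, that is \<open>r \<ge> \<eta> / (2 \<eta> - 1)\<close>. The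
  quotient of the two bounds is \<open>2 \<eta> - 1\<close>. This is the content of \<open>weighted_orthogonal_bounds\<close> and
  \<open>orthogonal_blocks_spectral_cond\<close>; that there is a real eigenvalue at all is
  \<open>symmetric_pencil_real_eigenvalue\<close>.

  It remains to see that \<open>H\<close> is square and nonsingular, which is the discrete Helmholtz decomposition
  of piecewise constant vector fields. Instead of counting vertices and edges with Euler's formula,
  the proof shows that the blocks are orthogonal (\<open>CR_gradient_orthogonal_curl\<close>) and injective
  (\<open>CR_gradient_injective\<close>, \<open>P1_gradient_injective\<close>), and that no nonzero field is orthogonal to both
  ranges (\<open>discrete_Helmholtz_complete\<close>); this forces the right number of columns. The common tool is
  \<open>CR_basis_pairing\<close>: the inner product of a piecewise constant field with the gradient of the basis
  function of an edge is, up to a factor, the jump of its normal component across that edge.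

  A field orthogonal to all gradients therefore has continuous normal components, and rotated by a
  right angle it has continuous tangential components. Simple connectedness enters at exactly one
  point: such a rotated field has a potential (\<open>curl_free_potential\<close>), which makes the field itself a
  discrete curl. The increments of the potential along edges are expanded over a finite basis over
  the rationals, so that they may be taken to be integers. Then the local potentials \<open>p\<close> agree up to
  integers where triangles meet, \<open>exp (2 \<pi> \<i> p)\<close> is a well-defined continuous function without zeros
  on the closed domain, and a continuous logarithm of it is the global potential.\<close>

section \<open>Topology of polygonal domains\<close>

text \<open>A linear isomorphism carries the components of a complement to components and keeps them
  bounded. The inverse map does the same, so that one inclusion, proved for all isomorphisms, gives
  both.\<close>

lemma inside_linear_image:
  fixes f :: "'a::euclidean_space \<Rightarrow> 'b::euclidean_space"
  assumes f: "linear f" "bij f"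
  shows "inside (f ` S) = f ` inside S"
proof -
  have inj: "inj f" and surj: "surj f" using f(2) by (auto simp: bij_def)
  obtain g where g: "linear g" "g \<circ> f = id"
    using linear_injective_left_inverse[OF f(1) inj] by auto
  have fg: "f \<circ> g = id"
    using surj g(2) by (metis (no_types, lifting) comp_apply eq_id_iff surj_def)
  have sub: "h ` inside S \<subseteq> inside (h ` S)"
    if h: "linear h" "bij h" and k: "linear k" "k \<circ> h = id" "h \<circ> k = id"
    for h :: "'c::euclidean_space \<Rightarrow> 'd::euclidean_space" and k S
  proof
    fix y assume "y \<in> h ` inside S"
    then obtain x where x: "x \<in> inside S" "y = h x" by auto
    have img: "- (h ` S) = h ` (- S)"
      using bij_image_Compl_eq[OF h(2)] by simp
    have homeo: "homeomorphism (- S) (- (h ` S)) h k"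
      unfolding homeomorphism_def img
      using h(1) k by (auto simp: image_image linear_continuous_on linear_conv_bounded_linear pointfree_idE)
    have xin: "x \<notin> S" "bounded (connected_component_set (- S) x)"
      using x(1) unfolding inside_def by auto
    have "k ` connected_component_set (- (h ` S)) y \<subseteq> connected_component_set (- S) x"
    proof (rule connected_component_maximal)
      have ynotin: "y \<in> - (h ` S)" using xin x(2) h(2) by (auto simp: bij_def inj_def)
      show "x \<in> k ` connected_component_set (- (h ` S)) y"
        using ynotin x(2) k(2) by (metis (no_types, lifting) comp_apply connected_component_refl id_apply image_eqI mem_Collect_eq)
      show "connected (k ` connected_component_set (- (h ` S)) y)"
        by (rule connected_continuous_image) (auto simp: k(1) linear_continuous_on linear_conv_bounded_linear[symmetric])
      show "k ` connected_component_set (- (h ` S)) y \<subseteq> - S"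
        using homeo connected_component_subset unfolding homeomorphism_def by blast
    qed
    then have "bounded (h ` k ` connected_component_set (- (h ` S)) y)"
      using xin(2) h(1) bounded_subset bounded_linear_image by (metis linear_conv_bounded_linear)
    then have "bounded (connected_component_set (- (h ` S)) y)"
      using k(3) by (simp add: image_comp)
    then show "y \<in> inside (h ` S)"
      using xin x(2) h(2) unfolding inside_def by (auto simp: bij_def inj_def)
  qed
  have bg: "bij g" using g fg by (metis o_bij)
  show ?thesis
  proof
    show "f ` inside S \<subseteq> inside (f ` S)" using sub[OF f g fg] .
    have "g ` f ` S = S" using g(2) by (simp add: image_comp)
    then have "f ` g ` inside (f ` S) \<subseteq> f ` inside S"
      using image_mono[OF sub[OF g(1) bg f(1) fg g(2), of "f ` S"], of f] by simp
    then show "inside (f ` S) \<subseteq> f ` inside S" using fg by (simp add: image_comp)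
  qed
qed

definition plane_to_complex :: "real^2 \<Rightarrow> complex" where
  "plane_to_complex x = Complex (vec_nth x 1) (vec_nth x 2)"

lemma linear_plane_to_complex: "linear plane_to_complex"
  by (rule linearI) (auto simp: plane_to_complex_def complex_eq_iff)

lemma bij_plane_to_complex: "bij plane_to_complex"
proof (rule o_bij)
  let ?g = "\<lambda>z. (\<chi> i. if i = 1 then Re z else Im z) :: real^2"
  show "?g \<circ> plane_to_complex = id"
    by (rule ext) (simp add: plane_to_complex_def Finite_Cartesian_Product.vec_eq_iff forall_2)
  show "plane_to_complex \<circ> ?g = id"
    by (auto simp: plane_to_complex_def fun_eq_iff complex_eq_iff)
qed

text \<open>The Jordan curve theorem in the complex plane, moved to \<open>\<real>\<^sup>2\<close> by a linear isomorphism. Every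
  point of the polygon is a limit of points outside, which is why the closure has no further interior
  points. The Borsuk property says that every continuous function without zeros on the closed domain
  has a continuous logarithm; for compact plane sets it is equivalent to connectedness of the
  complement, and here the complement is the outside of the polygon.\<close>

lemma polygonal_domain_topology:
  assumes "polygonal_domain \<Omega>"
  shows polygonal_domain_open: "open \<Omega>"
    and polygonal_domain_bounded: "bounded \<Omega>"
    and polygonal_domain_nonempty: "\<Omega> \<noteq> {}"
    and polygonal_domain_connected: "connected \<Omega>"
    and polygonal_domain_regular: "interior (closure \<Omega>) = \<Omega>"
    and polygonal_domain_Borsukian: "Borsukian (closure \<Omega>)"
proof -
  let ?f = plane_to_complex
  obtain vs where vs: "simple_path (polyline vs)" "pathfinish (polyline vs) = pathstart (polyline vs)"
    and \<Omega>: "\<Omega> = inside (path_image (polyline vs))"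
    using assms unfolding polygonal_domain_def by auto
  have inj: "inj ?f" and surj: "surj ?f" using bij_plane_to_complex by (auto simp: bij_def)
  define c where "c = ?f \<circ> polyline vs"
  have img: "inside (path_image c) = ?f ` \<Omega>"
    unfolding c_def \<Omega>
    using inside_linear_image[OF linear_plane_to_complex bij_plane_to_complex]
      path_image_linear_image[OF linear_plane_to_complex] by simp
  have "simple_path c" "pathfinish c = pathstart c"
    unfolding c_def using vs simple_path_linear_image_eq[OF linear_plane_to_complex inj]
    by (auto simp: pathstart_def pathfinish_def)
  note J = Jordan_inside_outside[OF this]
  show "open \<Omega>"
    unfolding \<Omega> by (rule open_inside) (simp add: closed_simple_path_image vs)
  show "bounded \<Omega>"
    unfolding \<Omega> by (rule bounded_inside) (simp add: bounded_simple_path_image vs)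
  show "\<Omega> \<noteq> {}" using J img by auto
  have homeo: "\<Omega> homeomorphic ?f ` \<Omega>"
    using linear_homeomorphic_image[OF linear_plane_to_complex inj] .
  show "connected \<Omega>" using J homeomorphic_connectedness[OF homeo] by (simp add: img)
  have cl: "closure (?f ` \<Omega>) = ?f ` closure \<Omega>"
    using closure_injective_linear_image[OF linear_plane_to_complex inj] by simp
  have cmpl: "- closure (inside (path_image c)) = outside (path_image c)"
    using J by (simp add: closure_Un_frontier outside_inside Un_commute)
  have "compact (closure (inside (path_image c)))" using J by simp
  then have "Borsukian (closure (inside (path_image c)))"
    using J cmpl by (simp add: Borsukian_separation_compact)
  then show "Borsukian (closure \<Omega>)"
    unfolding img cl using Borsukian_injective_linear_image[OF linear_plane_to_complex inj] by simp
  have "- interior (closure (inside (path_image c))) = closure (outside (path_image c))"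
    by (simp add: cmpl[symmetric] closure_complement)
  also have "\<dots> = outside (path_image c) \<union> path_image c"
    using J by (simp add: closure_Un_frontier)
  also have "\<dots> = - inside (path_image c)" by (simp add: union_with_outside[symmetric] Un_commute)
  finally have "interior (?f ` closure \<Omega>) = ?f ` \<Omega>" unfolding img cl by blast
  then have "?f ` interior (closure \<Omega>) = ?f ` \<Omega>"
    using interior_bijective_linear_image[OF linear_plane_to_complex bij_plane_to_complex] by simp
  then show "interior (closure \<Omega>) = \<Omega>" using inj by (simp add: inj_image_eq_iff)
qed

section \<open>Triangles in the plane\<close>

definition cross2 :: "real^2 \<Rightarrow> real^2 \<Rightarrow> real" where
  "cross2 x y = vec_nth x 1 * vec_nth y 2 - vec_nth x 2 * vec_nth y 1"

lemma cross2_simps [simp]: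
  "cross2 x x = 0" "cross2 0 y = 0" "cross2 x 0 = 0"
  "cross2 x (r *\<^sub>R y) = r * cross2 x y" "cross2 (r *\<^sub>R x) y = r * cross2 x y"
  by (auto simp: cross2_def algebra_simps)

lemma cross2_add_right: "cross2 x (y + z) = cross2 x y + cross2 x z"
  and cross2_diff_right: "cross2 x (y - z) = cross2 x y - cross2 x z"
  and cross2_commute: "cross2 y x = - cross2 x y"
  by (auto simp: cross2_def algebra_simps)

lemma plane_vector_eqI: "vec_nth x 1 = vec_nth y 1 \<Longrightarrow> vec_nth x 2 = vec_nth y 2 \<Longrightarrow> x = (y :: real^2)"
  unfolding Finite_Cartesian_Product.vec_eq_iff forall_2 by blast

lemma inner_plane: "inner x (y :: real^2) = vec_nth x 1 * vec_nth y 1 + vec_nth x 2 * vec_nth y 2"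
  by (simp add: inner_vec_def sum_2)

lemma cross2_nonzero_inner_unique:
  assumes "cross2 v w \<noteq> 0" "inner g v = inner h v" "inner g w = inner h w"
  shows "g = h"
proof -
  have "cross2 v w * vec_nth (g - h) 1 = inner (g - h) v * vec_nth w 2 - inner (g - h) w * vec_nth v 2"
    and "cross2 v w * vec_nth (g - h) 2 = inner (g - h) w * vec_nth v 1 - inner (g - h) v * vec_nth w 1"
    unfolding cross2_def inner_plane by (simp_all add: algebra_simps)
  then show ?thesis
    using assms by (auto intro!: plane_vector_eqI simp: inner_diff_left)
qed

text \<open>The vertices are listed in a chosen order but without a chosen orientation: the sign of the
  cross product tells on which side of the line through \<open>a\<close> and \<open>b\<close> the vertex \<open>c\<close> lies.\<close>

definition triangle_with :: "real^2 \<Rightarrow> real^2 \<Rightarrow> real^2 \<Rightarrow> (real^2) set \<Rightarrow> bool" where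
  "triangle_with a b c T \<longleftrightarrow> cross2 (b - a) (c - a) \<noteq> 0 \<and> T = convex hull {a, b, c}"

lemma triangle_with_rotate: "triangle_with a b c T \<Longrightarrow> triangle_with b c a T"
  and triangle_with_swap: "triangle_with a b c T \<Longrightarrow> triangle_with b a c T"
  unfolding triangle_with_def cross2_def by (auto simp: insert_commute algebra_simps)

lemma cross2_eq_0_iff_collinear: "cross2 (b - a) (c - a) = 0 \<longleftrightarrow> collinear {a, b, c}"
proof -
  have eq: "collinear {a, b, c} \<longleftrightarrow> collinear {0, b - a, c - a}"
    using collinear_3[of b a c] by (simp add: insert_commute)
  show ?thesis
  proof
    assume z: "cross2 (b - a) (c - a) = 0"
    show "collinear {a, b, c}"
    proof (cases "b = a")
      case False
      let ?v = "b - a" and ?w = "c - a"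
      have pos: "inner ?v ?v \<noteq> 0" using False by simp
      have real_id: "(p * p + q * q) * r = (p * r + q * s) * p \<and> (p * p + q * q) * s = (p * r + q * s) * q"
        if "p * s - q * r = 0" for p q r s :: real
      proof -
        have "(p * p + q * q) * r - (p * r + q * s) * p = - q * (p * s - q * r)"
          "(p * p + q * q) * s - (p * r + q * s) * q = p * (p * s - q * r)"
          by (simp_all add: algebra_simps)
        then show ?thesis using that by simp
      qed
      have "inner ?v ?v *\<^sub>R ?w = inner ?v ?w *\<^sub>R ?v"
        using real_id[OF z[unfolded cross2_def]]
        by (intro plane_vector_eqI) (simp_all only: inner_plane vector_scaleR_component real_scaleR_def)
      note par = this
      have "?w = (1 / inner ?v ?v) *\<^sub>R (inner ?v ?v *\<^sub>R ?w)" using pos by simp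
      also have "\<dots> = (1 / inner ?v ?v) *\<^sub>R (inner ?v ?w *\<^sub>R ?v)" by (simp only: par)
      finally have "?w = (inner ?v ?w / inner ?v ?v) *\<^sub>R ?v" by simp
      then show ?thesis unfolding eq collinear_lemma by blast
    qed simp
  next
    assume "collinear {a, b, c}"
    then show "cross2 (b - a) (c - a) = 0"
      unfolding eq collinear_lemma by auto
  qed
qed

lemma triangle_with_distinct:
  assumes "triangle_with a b c T" shows "a \<noteq> b" "b \<noteq> c" "a \<noteq> c"
  using assms unfolding triangle_with_def by auto

lemma triangle_with_affine_independent:
  assumes "triangle_with a b c T" shows "\<not> affine_dependent {a, b, c}"
proof -
  have "\<not> collinear {a, b, c}"
    using assms cross2_eq_0_iff_collinear unfolding triangle_with_def by blast
  then show ?thesis using collinear_3_eq_affine_dependent by blast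
qed

lemma simplex_imp_triangle_with:
  assumes "2 simplex T" obtains a b c where "triangle_with a b c T"
proof -
  obtain C where C: "\<not> affine_dependent C" "card C = 3" "T = convex hull C"
    using assms unfolding simplex_def by auto
  then obtain a b c where abc: "C = {a, b, c}" "a \<noteq> b" "b \<noteq> c" "a \<noteq> c"
    by (metis card_3_iff)
  then have "\<not> collinear {a, b, c}" using C collinear_3_eq_affine_dependent by blast
  then show ?thesis
    using that C abc cross2_eq_0_iff_collinear unfolding triangle_with_def by blast
qed

text \<open>The barycentric coordinate belonging to \<open>c\<close>: it is \<open>1\<close> at \<open>c\<close> and vanishes on the line through
  \<open>a\<close> and \<open>b\<close>. Those of \<open>a\<close> and \<open>b\<close> arise by cyclic permutation.\<close>

definition bary_coord :: "real^2 \<Rightarrow> real^2 \<Rightarrow> real^2 \<Rightarrow> real^2 \<Rightarrow> real" where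
  "bary_coord a b c x = cross2 (b - a) (x - a) / cross2 (b - a) (c - a)"

lemma continuous_on_cross2 [continuous_intros]:
  "continuous_on S f \<Longrightarrow> continuous_on S g \<Longrightarrow> continuous_on S (\<lambda>x. cross2 (f x) (g x))"
  unfolding cross2_def by (intro continuous_intros)

lemma bary_coord_combination:
  assumes "cross2 (b - a) (c - a) \<noteq> 0" "u + v + w = 1" "x = u *\<^sub>R a + v *\<^sub>R b + w *\<^sub>R c"
  shows "bary_coord b c a x = u" "bary_coord c a b x = v" "bary_coord a b c x = w"
proof -
  have u: "u = 1 - v - w" using assms(2) by simp
  have "cross2 (c - b) (x - b) = u * cross2 (b - a) (c - a)"
    "cross2 (a - c) (x - c) = v * cross2 (b - a) (c - a)"
    "cross2 (b - a) (x - a) = w * cross2 (b - a) (c - a)"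
    unfolding assms(3) cross2_def u by (simp_all add: algebra_simps)
  moreover have "cross2 (c - b) (a - b) = cross2 (b - a) (c - a)"
    "cross2 (a - c) (b - c) = cross2 (b - a) (c - a)"
    unfolding cross2_def by (simp_all add: algebra_simps)
  ultimately show "bary_coord b c a x = u" "bary_coord c a b x = v" "bary_coord a b c x = w"
    using assms(1) unfolding bary_coord_def by auto
qed

lemma bary_coord_expand:
  assumes "cross2 (b - a) (c - a) \<noteq> 0"
  shows "bary_coord b c a x + bary_coord c a b x + bary_coord a b c x = 1"
    and "x = bary_coord b c a x *\<^sub>R a + bary_coord c a b x *\<^sub>R b + bary_coord a b c x *\<^sub>R c"
proof -
  let ?D = "cross2 (b - a) (c - a)"
  have D: "cross2 (c - b) (a - b) = ?D" "cross2 (a - c) (b - c) = ?D"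
    unfolding cross2_def by (simp_all add: algebra_simps)
  have "cross2 (c - b) (x - b) + cross2 (a - c) (x - c) + cross2 (b - a) (x - a) = ?D"
    unfolding cross2_def by (simp add: algebra_simps)
  then show "bary_coord b c a x + bary_coord c a b x + bary_coord a b c x = 1"
    using assms unfolding bary_coord_def D by (simp add: add_divide_distrib[symmetric])
  have "?D *\<^sub>R x = cross2 (c - b) (x - b) *\<^sub>R a + cross2 (a - c) (x - c) *\<^sub>R b + cross2 (b - a) (x - a) *\<^sub>R c"
    unfolding cross2_def by (intro plane_vector_eqI) (simp_all add: algebra_simps)
  then have "(1 / ?D) *\<^sub>R ?D *\<^sub>R x = (1 / ?D) *\<^sub>R (cross2 (c - b) (x - b) *\<^sub>R a + cross2 (a - c) (x - c) *\<^sub>R b + cross2 (b - a) (x - a) *\<^sub>R c)"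
    by simp
  then show "x = bary_coord b c a x *\<^sub>R a + bary_coord c a b x *\<^sub>R b + bary_coord a b c x *\<^sub>R c"
    using assms unfolding bary_coord_def D by (simp add: scaleR_add_right)
qed

lemma triangle_with_mem_iff:
  assumes "triangle_with a b c T"
  shows "x \<in> T \<longleftrightarrow> bary_coord b c a x \<ge> 0 \<and> bary_coord c a b x \<ge> 0 \<and> bary_coord a b c x \<ge> 0"
proof -
  have nz: "cross2 (b - a) (c - a) \<noteq> 0" and T: "T = convex hull {a, b, c}"
    using assms unfolding triangle_with_def by auto
  show ?thesis
  proof
    assume "x \<in> T"
    then show "bary_coord b c a x \<ge> 0 \<and> bary_coord c a b x \<ge> 0 \<and> bary_coord a b c x \<ge> 0"
      unfolding T convex_hull_3 using bary_coord_combination[OF nz] by auto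
  next
    assume "bary_coord b c a x \<ge> 0 \<and> bary_coord c a b x \<ge> 0 \<and> bary_coord a b c x \<ge> 0"
    then show "x \<in> T"
      unfolding T convex_hull_3 using bary_coord_expand[OF nz, of x] by blast
  qed
qed

lemma triangle_with_interior_iff:
  assumes "triangle_with a b c T"
  shows "x \<in> interior T \<longleftrightarrow> bary_coord b c a x > 0 \<and> bary_coord c a b x > 0 \<and> bary_coord a b c x > 0"
proof -
  have nz: "cross2 (b - a) (c - a) \<noteq> 0" and T: "T = convex hull {a, b, c}"
    using assms unfolding triangle_with_def by auto
  have int: "interior T = {v. \<exists>x y z. 0 < x \<and> 0 < y \<and> 0 < z \<and> x + y + z = 1 \<and> x *\<^sub>R a + y *\<^sub>R b + z *\<^sub>R c = v}"
    unfolding T using nz cross2_eq_0_iff_collinear by (intro interior_convex_hull_3_minimal) auto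
  show ?thesis
  proof
    assume "x \<in> interior T"
    then show "bary_coord b c a x > 0 \<and> bary_coord c a b x > 0 \<and> bary_coord a b c x > 0"
      unfolding int using bary_coord_combination[OF nz] by auto
  next
    assume "bary_coord b c a x > 0 \<and> bary_coord c a b x > 0 \<and> bary_coord a b c x > 0"
    then show "x \<in> interior T"
      unfolding int using bary_coord_expand[OF nz, of x] by (metis (mono_tags, lifting) mem_Collect_eq)
  qed
qed

lemma triangle_with_face:
  assumes "triangle_with a b c T"
  shows "F face_of T \<longleftrightarrow> (\<exists>K\<subseteq>{a, b, c}. F = convex hull K)"
  using face_of_convex_hull_affine_independent[OF triangle_with_affine_independent[OF assms]] assms
  unfolding triangle_with_def by blast

lemma triangle_with_extreme_point:
  assumes "triangle_with a b c T"
  shows "v extreme_point_of T \<longleftrightarrow> v \<in> {a, b, c}"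
  using extreme_point_of_convex_hull_affine_independent[OF triangle_with_affine_independent[OF assms]] assms
  unfolding triangle_with_def by blast

lemma aff_dim_proper_segment: "a \<noteq> b \<Longrightarrow> aff_dim (closed_segment a b) = 1"
  by (simp add: segment_convex_hull aff_dim_convex_hull aff_dim_2)

lemma triangle_with_edge:
  assumes "triangle_with a b c T" shows "closed_segment a b edge_of T"
  unfolding edge_of_def triangle_with_face[OF assms] segment_convex_hull
  using aff_dim_proper_segment[OF triangle_with_distinct(1)[OF assms]]
  by (auto simp: segment_convex_hull intro!: exI[of _ "{a, b}"])

lemma edge_of_triangle:
  assumes T: "triangle_with a b c T"
  shows "e edge_of T \<longleftrightarrow> e \<in> {closed_segment a b, closed_segment b c, closed_segment c a}"
proof
  assume e: "e edge_of T"
  then obtain K where K: "K \<subseteq> {a, b, c}" "e = convex hull K" "aff_dim e = 1"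
    unfolding edge_of_def triangle_with_face[OF T] by auto
  have "\<not> affine_dependent K"
    using K(1) triangle_with_affine_independent[OF T] affine_dependent_subset by blast
  then have "card K = 2"
    using K aff_dim_affine_independent[of K] by (simp add: aff_dim_convex_hull)
  then obtain x y where "K = {x, y}" "x \<noteq> y" by (metis card_2_iff)
  then show "e \<in> {closed_segment a b, closed_segment b c, closed_segment c a}"
    using K(1,2) by (auto simp: segment_convex_hull insert_commute)
next
  assume "e \<in> {closed_segment a b, closed_segment b c, closed_segment c a}"
  then show "e edge_of T"
    using triangle_with_edge[OF T] triangle_with_edge[OF triangle_with_rotate[OF T]]
      triangle_with_edge[OF triangle_with_rotate[OF triangle_with_rotate[OF T]]] by auto
qed

text \<open>Normal form for a triangle with a distinguished edge; naming the edge \<open>ab\<close> spares the case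
  distinction over the three edges.\<close>

lemma edge_of_triangle_obtain:
  assumes "triangle_with a' b' c' T" "e edge_of T"
  obtains a b c where "triangle_with a b c T" "e = closed_segment a b"
  using assms(2) that assms(1) triangle_with_rotate[OF assms(1)]
    triangle_with_rotate[OF triangle_with_rotate[OF assms(1)]]
  unfolding edge_of_triangle[OF assms(1)] by auto

lemma triangle_with_segment:
  assumes "triangle_with a b c T" "closed_segment a b = closed_segment x y"
  shows "triangle_with x y c T"
proof -
  have "{a, b} = {x, y}" using assms(2) by (simp add: closed_segment_eq)
  then show ?thesis using assms(1) triangle_with_swap[OF assms(1)] by (auto simp: doubleton_eq_iff)
qed

lemma barycenter_segment:
  assumes "a \<noteq> b" shows "barycenter (closed_segment a b) = midpoint a b"
proof -
  have "{v. v extreme_point_of closed_segment a b} = {a, b}"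
    using assms by (auto simp: extreme_point_of_segment)
  then show ?thesis using assms unfolding barycenter_def midpoint_def by simp
qed

lemma barycenter_triangle:
  assumes T: "triangle_with a b c T"
  shows "barycenter T = (1/3) *\<^sub>R a + (1/3) *\<^sub>R b + (1/3) *\<^sub>R c"
proof -
  have "{v. v extreme_point_of T} = {a, b, c}"
    using triangle_with_extreme_point[OF T] by blast
  then show ?thesis using triangle_with_distinct[OF T] unfolding barycenter_def
    by (simp add: scaleR_add_right add.assoc)
qed

lemma bary_coord_barycenter:
  assumes T: "triangle_with a b c T"
  shows "bary_coord a b c (barycenter T) = 1/3"
  using bary_coord_combination(3)[of b a c "1/3" "1/3" "1/3"] T barycenter_triangle[OF T]
  unfolding triangle_with_def by auto

lemma barycenter_in_interior:
  assumes T: "triangle_with a b c T" shows "barycenter T \<in> interior T"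
  using triangle_with_interior_iff[OF T] bary_coord_barycenter[OF T]
    bary_coord_barycenter[OF triangle_with_rotate[OF T]]
    bary_coord_barycenter[OF triangle_with_rotate[OF triangle_with_rotate[OF T]]] by simp

lemma area_triangle:
  assumes "triangle_with a b c T" shows "area T = \<bar>cross2 (b - a) (c - a)\<bar> / 2"
proof -
  have "area T = measure lborel (convex hull {a, b, c})"
  proof -
    have "closed (convex hull {a, b, c})"
      by (intro compact_imp_closed finite_imp_compact_convex_hull) simp
    then have "convex hull {a, b, c} \<in> sets lborel" by simp
    then show ?thesis
      using assms unfolding area_def triangle_with_def by (simp only: measure_completion)
  qed
  moreover have "(vec_nth c 1 - vec_nth a 1) * (vec_nth b 2 - vec_nth a 2)
      - (vec_nth b 1 - vec_nth a 1) * (vec_nth c 2 - vec_nth a 2) = - cross2 (b - a) (c - a)"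
    by (simp add: cross2_def)
  ultimately show ?thesis
    by (simp only: content_triangle abs_minus_cancel)
qed

section \<open>How triangles meet along edges\<close>

locale triangulated_polygon =
  fixes \<Omega> :: "(real^2) set" and \<T> :: "(real^2) set set"
  assumes domain: "polygonal_domain \<Omega>" and mesh: "triangulation_of \<T> \<Omega>"
begin

lemma finite_mesh: "finite \<T>"
  and mesh_Int_face: "S \<in> \<T> \<Longrightarrow> T \<in> \<T> \<Longrightarrow> S \<inter> T face_of S"
  and mesh_simplex: "T \<in> \<T> \<Longrightarrow> 2 simplex T"
  and mesh_Union: "\<Union>\<T> = closure \<Omega>"
  using mesh unfolding triangulation_of_def triangulation_def by auto

lemma mesh_triangle:
  assumes "T \<in> \<T>" obtains a b c where "triangle_with a b c T"
  using simplex_imp_triangle_with[OF mesh_simplex[OF assms]] by blast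

lemma mesh_edge:
  assumes "T \<in> \<T>" "e edge_of T" obtains a b c where "triangle_with a b c T" "e = closed_segment a b"
  using mesh_triangle[OF assms(1)] edge_of_triangle_obtain[OF _ assms(2)] by metis

lemma mesh_subset: "T \<in> \<T> \<Longrightarrow> T \<subseteq> closure \<Omega>"
  using mesh_Union by blast

lemma mesh_interior_subset: "T \<in> \<T> \<Longrightarrow> interior T \<subseteq> \<Omega>"
  using interior_mono[OF mesh_subset] polygonal_domain_regular[OF domain] by blast

lemma mesh_closed: "T \<in> \<T> \<Longrightarrow> closed T"
  and mesh_convex: "T \<in> \<T> \<Longrightarrow> convex T"
  by (elim mesh_triangle,
      simp add: triangle_with_def compact_imp_closed finite_imp_compact_convex_hull convex_convex_hull)+

text \<open>The intersection of two mesh triangles is a face of each, and the only face of a triangle that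
  meets its interior is the triangle itself.\<close>

lemma mesh_interior_unique:
  assumes "S \<in> \<T>" "T \<in> \<T>" "x \<in> interior S" "x \<in> T"
  shows "S = T"
proof -
  have xS: "x \<in> S" using assms(3) interior_subset by blast
  have "S \<inter> T = S"
    using face_of_disjoint_interior[OF mesh_Int_face[OF assms(1,2)]] assms(3,4) xS by blast
  then have "S \<subseteq> T" by blast
  then have "x \<in> interior T" using assms(3) interior_mono by blast
  moreover have "S face_of T" using mesh_Int_face[OF assms(2,1)] \<open>S \<inter> T = S\<close> by (simp add: Int_commute)
  ultimately show ?thesis using face_of_disjoint_interior xS by blast
qed

lemma bary_coord_shift:
  "bary_coord a b c (midpoint a b + t *\<^sub>R v) = t * cross2 (b - a) v / cross2 (b - a) (c - a)"
proof -
  have mid: "midpoint a b + t *\<^sub>R v - a = (1/2) *\<^sub>R (b - a) + t *\<^sub>R v"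
    by (intro plane_vector_eqI) (simp_all add: midpoint_def field_simps)
  show ?thesis unfolding bary_coord_def mid cross2_add_right by simp
qed

text \<open>At the midpoint of \<open>ab\<close> the coordinates of \<open>a\<close> and \<open>b\<close> are \<open>1/2\<close> and stay positive nearby, so
  only the sign of the third coordinate along \<open>v\<close> matters.\<close>

lemma midpoint_shift_in_interior:
  assumes T: "triangle_with a b c T" and pos: "cross2 (b - a) v / cross2 (b - a) (c - a) > 0"
  shows "eventually (\<lambda>t. midpoint a b + t *\<^sub>R v \<in> interior T) (at_right 0)"
proof -
  have nz: "cross2 (b - a) (c - a) \<noteq> 0" using T unfolding triangle_with_def by simp
  have mid: "bary_coord b c a (midpoint a b) = 1/2" "bary_coord c a b (midpoint a b) = 1/2"
    using bary_coord_combination[OF nz, of "1/2" "1/2" 0 "midpoint a b"]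
    by (simp_all add: midpoint_def scaleR_add_right)
  have cont: "((\<lambda>t. bary_coord p q r (midpoint a b + t *\<^sub>R v)) \<longlongrightarrow> bary_coord p q r (midpoint a b)) (at_right 0)"
    for p q r
    unfolding bary_coord_def cross2_def divide_inverse
    by (rule tendsto_eq_intros refl | simp)+
  have "eventually (\<lambda>t. bary_coord b c a (midpoint a b + t *\<^sub>R v) > 0) (at_right 0)"
    "eventually (\<lambda>t. bary_coord c a b (midpoint a b + t *\<^sub>R v) > 0) (at_right 0)"
    using order_tendstoD(1)[OF cont, of 0 b c a] order_tendstoD(1)[OF cont, of 0 c a b] mid by simp_all
  moreover have "eventually (\<lambda>t::real. t > 0) (at_right 0)"
    by (simp add: eventually_at_filter)
  ultimately show ?thesis
  proof eventually_elim
    case (elim t)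
    then show ?case
      using pos unfolding triangle_with_interior_iff[OF T] bary_coord_shift
      by (simp add: mult_pos_pos flip: times_divide_eq_right)
  qed
qed

text \<open>Two triangles on the same side of a common edge share interior points near its midpoint.\<close>

lemma same_side_unique:
  assumes S: "S \<in> \<T>" "triangle_with a b c S" and T: "T \<in> \<T>" "triangle_with a b d T"
    and same: "cross2 (b - a) (c - a) * cross2 (b - a) (d - a) > 0"
  shows "S = T"
proof -
  have "cross2 (b - a) (c - a) \<noteq> 0" using same by auto
  then have "eventually (\<lambda>t. midpoint a b + t *\<^sub>R (c - a) \<in> interior S) (at_right 0)"
    using midpoint_shift_in_interior[OF S(2), of "c - a"] by simp
  moreover have "cross2 (b - a) (c - a) / cross2 (b - a) (d - a) > 0"
    using same by (simp add: zero_less_divide_iff zero_less_mult_iff)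
  then have "eventually (\<lambda>t. midpoint a b + t *\<^sub>R (c - a) \<in> interior T) (at_right 0)"
    using midpoint_shift_in_interior[OF T(2), of "c - a"] by simp
  ultimately have "eventually (\<lambda>t. midpoint a b + t *\<^sub>R (c - a) \<in> interior S \<inter> interior T) (at_right 0)"
    by eventually_elim simp
  then obtain x where "x \<in> interior S" "x \<in> interior T"
    using eventually_happens'[OF trivial_limit_at_right_real] by blast
  then show ?thesis using mesh_interior_unique S(1) T(1) interior_subset by blast
qed

lemma opposite_side:
  assumes S: "S \<in> \<T>" "triangle_with a b c S" and T: "T \<in> \<T>" "triangle_with a b d T" and "S \<noteq> T"
  shows "cross2 (b - a) (c - a) * cross2 (b - a) (d - a) < 0"
  using same_side_unique[OF S T] assms unfolding triangle_with_def
  by (meson linorder_neqE_linordered_idom mult_eq_0_iff)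

text \<open>The two triangles lie on opposite sides of the edge, so together they cover a neighbourhood of
  its midpoint. That midpoint is then interior to the closed domain, hence not on its frontier.\<close>

lemma shared_edge_interior:
  assumes "S \<in> \<T>" "T \<in> \<T>" "S \<noteq> T" "e edge_of S" "e edge_of T"
  shows "e \<in> interior_edges \<Omega> \<T>"
proof -
  obtain a b c where S: "triangle_with a b c S" and e: "e = closed_segment a b"
    using mesh_edge[OF assms(1,4)] by metis
  obtain a' b' d where "triangle_with a' b' d T" "e = closed_segment a' b'"
    using mesh_edge[OF assms(2,5)] by metis
  then have T: "triangle_with a b d T" using triangle_with_segment e by metis
  note opp = opposite_side[OF assms(1) S assms(2) T assms(3)]
  let ?m = "midpoint a b"
  define U where "U = {x. bary_coord b c a x > 0 \<and> bary_coord c a b x > 0 \<and>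
    bary_coord b d a x > 0 \<and> bary_coord d a b x > 0}"
  have "open U"
    unfolding U_def bary_coord_def divide_inverse
    by (intro open_Collect_conj open_Collect_less continuous_intros)
  have nz: "cross2 (b - a) (c - a) \<noteq> 0" "cross2 (b - a) (d - a) \<noteq> 0" using opp by auto
  have "?m \<in> U"
    unfolding U_def using bary_coord_combination[OF nz(1), of "1/2" "1/2" 0 ?m]
      bary_coord_combination[OF nz(2), of "1/2" "1/2" 0 ?m]
    by (simp add: midpoint_def scaleR_add_right)
  moreover have "U \<subseteq> closure \<Omega>"
  proof
    fix x assume x: "x \<in> U"
    have "bary_coord a b c x \<ge> 0 \<or> bary_coord a b d x \<ge> 0"
      using opp unfolding bary_coord_def zero_le_divide_iff mult_less_0_iff by auto
    then have "x \<in> S \<or> x \<in> T"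
      using x unfolding U_def triangle_with_mem_iff[OF S] triangle_with_mem_iff[OF T] by auto
    then show "x \<in> closure \<Omega>" using assms(1,2) mesh_subset by blast
  qed
  ultimately have "?m \<in> \<Omega>"
    using interior_maximal[OF _ \<open>open U\<close>] polygonal_domain_regular[OF domain] by blast
  then have "?m \<notin> frontier \<Omega>"
    using frontier_disjoint_eq polygonal_domain_open[OF domain] by blast
  moreover have "?m \<in> e" unfolding e by simp
  ultimately show ?thesis
    using assms(1,4) unfolding interior_edges_def mesh_edges_def by blast
qed

text \<open>Some relative interior point \<open>y\<close> of the edge lies in the open domain, so points close to \<open>y\<close> on the
  far side of the edge are covered as well, by a triangle \<open>T\<close> that contains \<open>y\<close> because there are only
  finitely many closed triangles. The common face of \<open>S\<close> and \<open>T\<close> contains a relative interior point of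
  the edge, hence the whole edge, and it is not all of \<open>S\<close>.\<close>

lemma neighbour_exists:
  assumes S: "S \<in> \<T>" "triangle_with a b c S" and int: "closed_segment a b \<in> interior_edges \<Omega> \<T>"
  obtains T d where "T \<in> \<T>" "triangle_with a b d T" "T \<noteq> S"
proof -
  let ?e = "closed_segment a b"
  have ab: "a \<noteq> b" using triangle_with_distinct[OF S(2)] by simp
  have nz: "cross2 (b - a) (c - a) \<noteq> 0" using S(2) unfolding triangle_with_def by simp
  have eS: "?e \<subseteq> S"
    using triangle_with_edge[OF S(2)] unfolding edge_of_def using face_of_imp_subset by blast
  have "?e \<inter> \<Omega> \<noteq> {}"
  proof -
    obtain x where x: "x \<in> ?e" "x \<notin> frontier \<Omega>" using int unfolding interior_edges_def by blast
    then have "x \<in> closure \<Omega>" using eS mesh_subset[OF S(1)] by blast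
    then show ?thesis using x by (auto simp: closure_Un_frontier)
  qed
  then have "\<Omega> \<inter> closure (open_segment a b) \<noteq> {}"
    using ab by (simp add: Int_commute)
  then have "\<Omega> \<inter> open_segment a b \<noteq> {}"
    using open_Int_closure_eq_empty polygonal_domain_open[OF domain] by blast
  then obtain y where y: "y \<in> \<Omega>" "y \<in> open_segment a b" by blast
  \<comment> \<open>removing the triangles that avoid \<open>y\<close> leaves a neighbourhood of \<open>y\<close>\<close>
  define K where "K = \<Union>{T \<in> \<T>. y \<notin> T}"
  have "closed K" unfolding K_def using finite_mesh mesh_closed by auto
  then have "open (\<Omega> - K)" using polygonal_domain_open[OF domain] by (simp add: open_Diff)
  moreover have "y \<in> \<Omega> - K" using y unfolding K_def by blast
  moreover have "((\<lambda>t. y - t *\<^sub>R (c - a)) \<longlongrightarrow> y) (at_right 0)"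
    by (rule tendsto_eq_intros refl | simp)+
  ultimately have "eventually (\<lambda>t. y - t *\<^sub>R (c - a) \<in> \<Omega> - K) (at_right 0)"
    using topological_tendstoD by blast
  moreover have "eventually (\<lambda>t::real. t > 0) (at_right 0)"
    by (simp add: eventually_at_filter)
  ultimately have "eventually (\<lambda>t. t > 0 \<and> y - t *\<^sub>R (c - a) \<in> \<Omega> - K) (at_right 0)"
    by eventually_elim simp
  then obtain t where t: "t > 0" "y - t *\<^sub>R (c - a) \<in> \<Omega> - K"
    using eventually_happens'[OF trivial_limit_at_right_real] by blast
  then obtain T where T: "T \<in> \<T>" "y - t *\<^sub>R (c - a) \<in> T"
    using mesh_Union closure_subset by blast
  then have yT: "y \<in> T" using t(2) unfolding K_def by blast
  have "bary_coord a b c (y - t *\<^sub>R (c - a)) < 0"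
  proof -
    obtain u where yu: "y = (1 - u) *\<^sub>R a + u *\<^sub>R b" using y(2) by (auto simp: in_segment)
    have "cross2 (b - a) (y - t *\<^sub>R (c - a) - a) = - t * cross2 (b - a) (c - a)"
      unfolding cross2_def yu by (simp add: algebra_simps)
    then show ?thesis unfolding bary_coord_def using nz t(1) by simp
  qed
  then have "T \<noteq> S" using T(2) triangle_with_mem_iff[OF S(2)] by force
  define F where "F = S \<inter> T"
  have FS: "F face_of S" unfolding F_def using mesh_Int_face S(1) T(1) by blast
  have FT: "F face_of T" unfolding F_def using mesh_Int_face[OF T(1) S(1)] by (simp add: Int_commute)
  have "y \<in> F" using yT y(2) eS open_closed_segment unfolding F_def by blast
  moreover have "a \<in> S" "b \<in> S" using eS by auto
  ultimately have abF: "a \<in> F" "b \<in> F" using FS y(2) unfolding face_of_def by blast+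
  have "F \<noteq> S"
  proof
    assume "F = S"
    then have "S \<subseteq> T" unfolding F_def by blast
    moreover have "barycenter S \<in> interior S" using barycenter_in_interior[OF S(2)] .
    ultimately show False
      using mesh_interior_unique[OF S(1) T(1)] \<open>T \<noteq> S\<close> interior_subset by blast
  qed
  obtain V where V: "V \<subseteq> {a, b, c}" "F = convex hull V" using FS triangle_with_face[OF S(2)] by blast
  have "a extreme_point_of S" "b extreme_point_of S" using triangle_with_extreme_point[OF S(2)] by auto
  then have "a extreme_point_of F" "b extreme_point_of F"
    using extreme_point_of_face[OF FS] abF by auto
  then have "a \<in> V" "b \<in> V" using extreme_point_of_convex_hull V(2) by blast+
  moreover have "V \<noteq> {a, b, c}" using V(2) \<open>F \<noteq> S\<close> S(2) unfolding triangle_with_def by blast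
  ultimately have "V = {a, b}" using V(1) by blast
  then have "?e edge_of T"
    using FT V(2) aff_dim_proper_segment[OF ab] unfolding edge_of_def by (simp add: segment_convex_hull)
  then obtain a' b' d where "triangle_with a' b' d T" "?e = closed_segment a' b'"
    using mesh_edge[OF T(1)] by metis
  then show ?thesis using that T(1) \<open>T \<noteq> S\<close> triangle_with_segment by metis
qed

lemma interior_edge_two_triangles:
  assumes "e \<in> interior_edges \<Omega> \<T>"
  obtains a b c d S T where "e = closed_segment a b" "S \<in> \<T>" "T \<in> \<T>"
    "triangle_with a b c S" "triangle_with a b d T"
    "cross2 (b - a) (c - a) > 0" "cross2 (b - a) (d - a) < 0"
    "\<And>R. R \<in> \<T> \<Longrightarrow> e edge_of R \<Longrightarrow> R = S \<or> R = T"
proof -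
  obtain S where S: "S \<in> \<T>" "e edge_of S"
    using assms unfolding interior_edges_def mesh_edges_def by blast
  obtain a0 b0 c where 0: "triangle_with a0 b0 c S" "e = closed_segment a0 b0"
    using mesh_edge[OF S] by metis
  obtain a b where 1: "triangle_with a b c S" "e = closed_segment a b" "cross2 (b - a) (c - a) > 0"
  proof (cases "cross2 (b0 - a0) (c - a0) > 0")
    case True then show ?thesis using that 0 by blast
  next
    case False
    have "cross2 (a0 - b0) (c - b0) = - cross2 (b0 - a0) (c - a0)" unfolding cross2_def by (simp add: algebra_simps)
    moreover have "cross2 (b0 - a0) (c - a0) \<noteq> 0" using 0(1) unfolding triangle_with_def by simp
    ultimately have "cross2 (a0 - b0) (c - b0) > 0" using False by linarith
    then show ?thesis using that[OF triangle_with_swap[OF 0(1)]] 0(2) closed_segment_commute by blast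
  qed
  obtain T d where T: "T \<in> \<T>" "triangle_with a b d T" "T \<noteq> S"
    using neighbour_exists[OF S(1) 1(1)] assms 1(2) by blast
  have neg: "cross2 (b - a) (d - a) < 0"
    using opposite_side[OF S(1) 1(1) T(1,2)] T(3) 1(3) by (simp add: mult_less_0_iff)
  have "R = S \<or> R = T" if R: "R \<in> \<T>" "e edge_of R" for R
  proof -
    obtain a' b' d' where "triangle_with a' b' d' R" "e = closed_segment a' b'"
      using mesh_edge[OF R] by metis
    then have R': "triangle_with a b d' R" using triangle_with_segment 1(2) by metis
    then have "cross2 (b - a) (d' - a) \<noteq> 0" unfolding triangle_with_def by simp
    then consider "cross2 (b - a) (d' - a) > 0" | "cross2 (b - a) (d' - a) < 0" by linarith
    then show ?thesis
    proof cases
      case 1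
      then show ?thesis
        using same_side_unique[OF R(1) R' S(1) \<open>triangle_with a b c S\<close>] \<open>cross2 (b - a) (c - a) > 0\<close> by simp
    next
      case 2
      then show ?thesis using same_side_unique[OF R(1) R' T(1,2)] neg mult_neg_neg by blast
    qed
  qed
  then show ?thesis using that[OF 1(2) S(1) T(1) 1(1) T(2) 1(3) neg] by blast
qed

end

section \<open>Potentials of curl-free fields\<close>

lemma common_denominator:
  fixes Q :: "rat set"
  assumes "finite Q" shows "\<exists>N::int. N > 0 \<and> (\<forall>q\<in>Q. of_int N * q \<in> \<int>)"
  using assms
proof induction
  case empty
  show ?case by (intro exI[of _ 1]) simp
next
  case (insert q Q)
  then obtain N :: int where N: "N > 0" "\<forall>q\<in>Q. of_int N * q \<in> \<int>" by blast
  obtain a b where q: "q = Rat.Fract a b" "b > 0" using Rat_cases[of q] by metis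
  have "of_int (N * b) * r \<in> \<int>" if "r \<in> insert q Q" for r
  proof (cases "r = q")
    case True
    have "of_int b * q = of_int a" using q by (simp add: Fract_of_int_quotient)
    then have "of_int (N * b) * q = of_int (N * a)" by (simp add: mult.assoc)
    then show ?thesis using True by (metis Ints_of_int)
  next
    case False
    then have "of_int N * r \<in> \<int>" using N that by blast
    then have "of_int b * (of_int N * r) \<in> \<int>" using Ints_mult[OF Ints_of_int[of b]] by blast
    moreover have "of_int (N * b) * r = of_int b * (of_int N * r)" by simp
    ultimately show ?thesis by (simp only:)
  qed
  then show ?case using N(1) q(2) by (intro exI[of _ "N * b"]) auto
qed

lemma vector_space_rat_real: "Vector_Spaces.vector_space (\<lambda>(q::rat) (x::real). of_rat q * x)"
  unfolding Vector_Spaces.vector_space_def by (simp add: distrib_left distrib_right of_rat_add of_rat_mult)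

text \<open>Linearly independent reals over the rationals that span \<open>X\<close>, divided by a common denominator
  of all coordinates. What matters is that the coordinates are additive as far as sums stay in \<open>X\<close>:
  each of them turns a real edge cochain that is closed on triangles into an integer one.\<close>

lemma integer_coordinates:
  fixes X :: "real set"
  assumes "finite X"
  shows "\<exists>(B :: real set) (c :: real \<Rightarrow> real \<Rightarrow> int). finite B \<and>
    (\<forall>x\<in>X. x = (\<Sum>\<beta>\<in>B. of_int (c \<beta> x) * \<beta>)) \<and>
    (\<forall>\<beta>\<in>B. \<forall>x\<in>X. \<forall>y\<in>X. x + y \<in> X \<longrightarrow> c \<beta> (x + y) = c \<beta> x + c \<beta> y)"
proof -
  interpret Q: Vector_Spaces.vector_space "\<lambda>(q::rat) (x::real). of_rat q * x"
    by (rule vector_space_rat_real)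
  obtain A where A: "A \<subseteq> X" "Q.independent A" "X \<subseteq> Q.span A"
    using Q.maximal_independent_subset by blast
  have finA: "finite A" using A(1) assms finite_subset by blast
  let ?r = "Q.representation A"
  obtain N :: int where N: "N > 0" "\<And>q. q \<in> (\<lambda>y. ?r (fst y) (snd y)) ` (X \<times> A) \<Longrightarrow> of_int N * q \<in> \<int>"
    using common_denominator[of "(\<lambda>y. ?r (fst y) (snd y)) ` (X \<times> A)"] assms finA by blast
  have int: "of_int \<lfloor>of_int N * ?r x b\<rfloor> = of_int N * ?r x b" if "x \<in> X" "b \<in> A" for x b
  proof -
    have "?r x b \<in> (\<lambda>y. ?r (fst y) (snd y)) ` (X \<times> A)"
      by (rule image_eqI[of _ _ "(x, b)"]) (use that in auto)
    then obtain i where "of_int N * ?r x b = of_int i" using N(2) Ints_cases by blast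
    then show ?thesis by simp
  qed
  define B where "B = (\<lambda>b. b / of_int N) ` A"
  define c where "c = (\<lambda>\<beta> x. \<lfloor>of_int N * ?r x (of_int N * \<beta>)\<rfloor>)"
  show ?thesis
  proof (intro exI[of _ B] exI[of _ c] conjI ballI impI)
    show "finite B" unfolding B_def using finA by simp
  next
    fix x assume x: "x \<in> X"
    have inj: "inj_on (\<lambda>b::real. b / of_int N) A" using N(1) by (auto simp: inj_on_def)
    have "(\<Sum>\<beta>\<in>B. of_int (c \<beta> x) * \<beta>) = (\<Sum>b\<in>A. of_int \<lfloor>of_int N * ?r x b\<rfloor> * (b / of_int N))"
      unfolding B_def c_def using N(1) by (subst sum.reindex[OF inj]) simp
    also have "\<dots> = (\<Sum>b\<in>A. of_rat (?r x b) * b)"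
    proof (rule sum.cong[OF refl])
      fix b assume "b \<in> A"
      have "(of_int \<lfloor>of_int N * ?r x b\<rfloor> :: real) = of_rat (of_int \<lfloor>of_int N * ?r x b\<rfloor>)" by simp
      also have "\<dots> = of_int N * of_rat (?r x b)"
        unfolding int[OF x \<open>b \<in> A\<close>] by (simp add: of_rat_mult)
      finally show "of_int \<lfloor>of_int N * ?r x b\<rfloor> * (b / of_int N) = of_rat (?r x b) * b"
        using N(1) by simp
    qed
    also have "\<dots> = x" using Q.sum_representation_eq[OF A(2) _ finA] A(3) x by blast
    finally show "x = (\<Sum>\<beta>\<in>B. of_int (c \<beta> x) * \<beta>)" by simp
  next
    fix \<beta> x y assume *: "\<beta> \<in> B" "x \<in> X" "y \<in> X" "x + y \<in> X"
    then obtain b where b: "b \<in> A" "of_int N * \<beta> = b" unfolding B_def using N(1) by auto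
    have "?r (x + y) b = ?r x b + ?r y b"
    proof -
      have "x \<in> Q.span A" "y \<in> Q.span A" using A(3) * by auto
      then show ?thesis using Q.representation_add[OF A(2), of y x] by simp
    qed
    then have "of_int N * ?r (x + y) b = of_int N * ?r x b + of_int N * ?r y b"
      by (simp add: distrib_left)
    then have "rat_of_int \<lfloor>of_int N * ?r (x + y) b\<rfloor> = of_int (\<lfloor>of_int N * ?r x b\<rfloor> + \<lfloor>of_int N * ?r y b\<rfloor>)"
      using int[OF *(2) b(1)] int[OF *(3) b(1)] int[OF *(4) b(1)] unfolding of_int_add by linarith
    then show "c \<beta> (x + y) = c \<beta> x + c \<beta> y"
      unfolding c_def b(2) of_int_eq_iff .
  qed
qed

lemma inner_system_solvable:
  assumes "cross2 v w \<noteq> 0" obtains g where "inner g v = r" "inner g w = s"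
proof
  let ?D = "cross2 v w"
  let ?g = "(\<chi> i. if i = 1 then (r * vec_nth w 2 - s * vec_nth v 2) / ?D
      else (s * vec_nth v 1 - r * vec_nth w 1) / ?D) :: real^2"
  have D: "vec_nth v 1 * vec_nth w 2 - vec_nth v 2 * vec_nth w 1 \<noteq> 0" using assms unfolding cross2_def .
  show "inner ?g v = r" "inner ?g w = s"
    using D unfolding inner_plane cross2_def by (simp_all add: divide_simps) (simp_all add: algebra_simps)
qed

lemma continuous_Ints_constant:
  fixes f :: "'a::topological_space \<Rightarrow> real"
  assumes "connected S" "continuous_on S f" "f ` S \<subseteq> \<int>"
  shows "f constant_on S"
proof (rule continuous_discrete_range_constant[OF assms(1,2)])
  fix x assume x: "x \<in> S"
  have "1 \<le> norm (f y - f x)" if "y \<in> S" "f y \<noteq> f x" for y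
  proof -
    have "f y \<in> \<int>" "f x \<in> \<int>" using assms(3) x that(1) by auto
    then obtain i j where "f y = of_int i" "f x = of_int j" by (elim Ints_cases)
    then have "norm (f y - f x) = of_int \<bar>i - j\<bar>" "1 \<le> \<bar>i - j\<bar>" using that(2) by auto
    then show ?thesis by linarith
  qed
  then show "\<exists>e>0. \<forall>y. y \<in> S \<and> f y \<noteq> f x \<longrightarrow> e \<le> norm (f y - f x)"
    by (intro exI[of _ 1]) auto
qed

lemma triangle_vertices_edge:
  assumes T: "triangle_with a b c T" and "v \<in> {a, b, c}" "w \<in> {a, b, c}" "v \<noteq> w"
  shows "closed_segment v w edge_of T"
  using assms(2-) unfolding edge_of_triangle[OF T] by (auto simp: closed_segment_commute)

context triangulated_polygon
begin

text \<open>The triangles meet in the convex hull of common vertices. At these the difference of the two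
  affine functions is an integer, and by the edge condition it is the same one at all of them; an
  affine function is constant on the convex hull of points where it takes equal values.\<close>

lemma affine_pieces_integer_overlap:
  fixes g :: "(real^2) set \<Rightarrow> real^2" and h :: "(real^2) set \<Rightarrow> real"
  defines "p \<equiv> \<lambda>T x. inner (g T) x + h T"
  assumes vertex: "\<And>T v. T \<in> \<T> \<Longrightarrow> v extreme_point_of T \<Longrightarrow> p T v \<in> \<int>"
    and edge: "\<And>S T a b. \<lbrakk>S \<in> \<T>; T \<in> \<T>; S \<noteq> T; closed_segment a b edge_of S; closed_segment a b edge_of T\<rbrakk>
      \<Longrightarrow> p S b - p S a = p T b - p T a"
    and ST: "S \<in> \<T>" "T \<in> \<T>" and x: "x \<in> S" "x \<in> T"
  shows "p S x - p T x \<in> \<int>"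
proof (cases "S = T")
  case False
  define F where "F = S \<inter> T"
  have FS: "F face_of S" unfolding F_def using mesh_Int_face ST by blast
  have FT: "F face_of T" unfolding F_def using mesh_Int_face[OF ST(2,1)] by (simp add: Int_commute)
  obtain a b c where S: "triangle_with a b c S" using mesh_triangle[OF ST(1)] .
  obtain a' b' c' where T: "triangle_with a' b' c' T" using mesh_triangle[OF ST(2)] .
  obtain V where V: "V \<subseteq> {a, b, c}" "F = convex hull V" using FS triangle_with_face[OF S] by blast
  have vert: "v extreme_point_of S" "v extreme_point_of T" if "v \<in> V" for v
  proof -
    have "v extreme_point_of F"
      using extreme_point_of_convex_hull_affine_independent[of V v] that V
        affine_dependent_subset[OF _ V(1)] triangle_with_affine_independent[OF S] by blast
    then show "v extreme_point_of S" "v extreme_point_of T"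
      using extreme_point_of_face[OF FS] extreme_point_of_face[OF FT] by blast+
  qed
  define d where "d = (\<lambda>x. p S x - p T x)"
  have "x \<in> convex hull V" using x V(2) unfolding F_def by blast
  then obtain v where v: "v \<in> V" by fastforce
  have eq: "d w = d v" if w: "w \<in> V" for w
  proof (cases "w = v")
    case False
    have "closed_segment v w edge_of S" "closed_segment v w edge_of T"
      using triangle_vertices_edge[OF S] triangle_vertices_edge[OF T] False
        vert[OF v] vert[OF w] triangle_with_extreme_point[OF S] triangle_with_extreme_point[OF T] by metis+
    then show ?thesis using edge[OF ST \<open>S \<noteq> T\<close>, of v w] unfolding d_def by simp
  qed simp
  have "convex {x. d x = d v}"
  proof -
    have "{x. d x = d v} = {x. inner (g S - g T) x = inner (g S - g T) v}"
      unfolding d_def p_def by (auto simp: inner_diff_left)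
    then show ?thesis by (simp add: convex_hyperplane)
  qed
  then have "convex hull V \<subseteq> {x. d x = d v}" using eq by (intro hull_minimal) auto
  then have "d x = d v" using \<open>x \<in> convex hull V\<close> by blast
  moreover have "d v \<in> \<int>" unfolding d_def by (rule Ints_diff[OF vertex[OF ST(1) vert(1)[OF v]] vertex[OF ST(2) vert(2)[OF v]]])
  ultimately show ?thesis unfolding d_def by simp
qed simp

text \<open>The pieces may disagree by integers, but \<open>exp (2 \<pi> \<i> p)\<close> does not see this. Its continuous
  logarithm on the closed domain differs from each piece by a continuous integer-valued function on a
  connected triangle, that is by a constant. Working on the closed domain and not on its interior
  matters, because triangles may meet only in a boundary vertex.\<close>

lemma integer_potential:
  fixes g :: "(real^2) set \<Rightarrow> real^2" and h :: "(real^2) set \<Rightarrow> real"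
  assumes vertex: "\<And>T v. T \<in> \<T> \<Longrightarrow> v extreme_point_of T \<Longrightarrow> inner (g T) v + h T \<in> \<int>"
    and edge: "\<And>S T a b. \<lbrakk>S \<in> \<T>; T \<in> \<T>; S \<noteq> T; closed_segment a b edge_of S; closed_segment a b edge_of T\<rbrakk>
      \<Longrightarrow> inner (g S) (b - a) = inner (g T) (b - a)"
  obtains q where "continuous_on (closure \<Omega>) q" "\<And>T. T \<in> \<T> \<Longrightarrow> \<exists>k. \<forall>x\<in>T. q x = inner (g T) x + k"
proof -
  define p where "p = (\<lambda>T x. inner (g T) x + h T)"
  have overlap: "p S x - p T x \<in> \<int>" if "S \<in> \<T>" "T \<in> \<T>" "x \<in> S" "x \<in> T" for S T x
    unfolding p_def
  proof (rule affine_pieces_integer_overlap[OF _ _ that])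
    fix T v assume "T \<in> \<T>" "v extreme_point_of T"
    then show "inner (g T) v + h T \<in> \<int>" by (rule vertex)
  next
    fix S T a b
    assume "S \<in> \<T>" "T \<in> \<T>" "S \<noteq> T" "closed_segment a b edge_of S" "closed_segment a b edge_of T"
    from edge[OF this] show "inner (g S) b + h S - (inner (g S) a + h S) = inner (g T) b + h T - (inner (g T) a + h T)"
      by (simp add: inner_diff_right)
  qed
  \<comment> \<open>the choice of a triangle containing \<open>x\<close> is immaterial by the next fact\<close>
  define E where "E = (\<lambda>T x. exp (complex_of_real (2 * pi * p T x) * \<i>))"
  define G where "G = (\<lambda>x. E (SOME T. T \<in> \<T> \<and> x \<in> T) x)"
  have G: "G x = E T x" if T: "T \<in> \<T>" "x \<in> T" for T x
  proof -
    let ?S = "SOME T. T \<in> \<T> \<and> x \<in> T"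
    have "?S \<in> \<T> \<and> x \<in> ?S" by (rule someI[of _ T]) (use T in simp)
    then have "p ?S x - p T x \<in> \<int>" using overlap T by blast
    then obtain n where n: "p ?S x - p T x = of_int n" by (rule Ints_cases)
    then have "p ?S x = p T x + of_int n" by simp
    then have "complex_of_real (2 * pi * p ?S x) * \<i> = complex_of_real (2 * pi * p T x) * \<i> + (of_int (2 * n) * pi) * \<i>"
      by (simp add: algebra_simps)
    then show ?thesis unfolding G_def E_def exp_eq by blast
  qed
  have "continuous_on (\<Union>T\<in>\<T>. T) G"
  proof (rule continuous_on_closed_Union)
    fix T assume T: "T \<in> \<T>"
    have "continuous_on T (E T)" unfolding E_def p_def by (intro continuous_intros)
    then show "continuous_on T G" by (rule continuous_on_eq) (use G[OF T] in auto)
  qed (use finite_mesh mesh_closed in auto)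
  then have "continuous_on (closure \<Omega>) G" using mesh_Union by simp
  moreover have "G \<in> closure \<Omega> \<rightarrow> - {0}" unfolding G_def E_def by simp
  ultimately have "\<exists>L. continuous_on (closure \<Omega>) L \<and> (\<forall>x\<in>closure \<Omega>. G x = exp (L x))"
    using polygonal_domain_Borsukian[OF domain, unfolded Borsukian_continuous_logarithm] by blast
  then obtain L where L: "continuous_on (closure \<Omega>) L" "\<And>x. x \<in> closure \<Omega> \<Longrightarrow> G x = exp (L x)" by blast
  define q where "q = (\<lambda>x. Im (L x) / (2 * pi))"
  have qc: "continuous_on (closure \<Omega>) q" unfolding q_def using L(1) by (intro continuous_intros) auto
  have "\<exists>k. \<forall>x\<in>T. q x = inner (g T) x + k" if T: "T \<in> \<T>" for T
  proof -
    have "(\<lambda>x. q x - p T x) constant_on T"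
    proof (rule continuous_Ints_constant)
      show "connected T" using mesh_convex[OF T] convex_connected by blast
      show "continuous_on T (\<lambda>x. q x - p T x)"
        unfolding p_def by (intro continuous_intros continuous_on_subset[OF qc mesh_subset[OF T]])
      show "(\<lambda>x. q x - p T x) ` T \<subseteq> \<int>"
      proof clarify
        fix x assume x: "x \<in> T"
        have "exp (L x) = E T x" using L(2) G[OF T x] mesh_subset[OF T] x by force
        then obtain n :: int where "L x = complex_of_real (2 * pi * p T x) * \<i> + (of_int (2 * n) * pi) * \<i>"
          unfolding E_def exp_eq by blast
        then have "Im (L x) = 2 * pi * p T x + 2 * of_int n * pi" by simp
        then have "q x - p T x = of_int n" unfolding q_def by (simp add: field_simps)
        then show "q x - p T x \<in> \<int>" by simp
      qed
    qed
    then obtain k where "\<And>x. x \<in> T \<Longrightarrow> q x - p T x = k" unfolding constant_on_def by blast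
    then have "\<forall>x\<in>T. q x = inner (g T) x + (h T + k)" unfolding p_def by (auto simp: algebra_simps)
    then show ?thesis by blast
  qed
  then show ?thesis using that qc by blast
qed
text \<open>A potential exists on each triangle; what has to be excluded are nonzero periods around closed
  chains of edges. Expanding the edge increments \<open>u \<cdot> (w - v)\<close> over a basis \<open>B\<close> with integer coordinates
  splits the field into finitely many fields with integer increments, each of which has a potential
  by \<open>integer_potential\<close>; the potentials recombine with the elements of \<open>B\<close> as weights.\<close>

lemma curl_free_potential:
  fixes u :: "(real^2) set \<Rightarrow> real^2"
  assumes tangential: "\<And>S T a b. \<lbrakk>S \<in> \<T>; T \<in> \<T>; S \<noteq> T; closed_segment a b edge_of S; closed_segment a b edge_of T\<rbrakk>
      \<Longrightarrow> inner (u S) (b - a) = inner (u T) (b - a)"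
  obtains q where "continuous_on (closure \<Omega>) q" "\<And>T. T \<in> \<T> \<Longrightarrow> \<exists>k. \<forall>x\<in>T. q x = inner (u T) x + k"
proof -
  have "\<forall>T\<in>\<T>. \<exists>a b c. triangle_with a b c T" using mesh_triangle by blast
  then obtain a b c where abc: "\<And>T. T \<in> \<T> \<Longrightarrow> triangle_with (a T) (b T) (c T) T" by metis
  define V where "V = (\<lambda>T :: (real^2) set. {v. v extreme_point_of T})"
  have V: "V T = {a T, b T, c T}" if "T \<in> \<T>" for T
    unfolding V_def using triangle_with_extreme_point[OF abc[OF that]] by blast
  define X where "X = (\<Union>T\<in>\<T>. (\<lambda>(v, w). inner (u T) (w - v)) ` (V T \<times> V T))"
  have "finite X" unfolding X_def using finite_mesh V by auto
  obtain B z where B: "finite B" and coord: "\<forall>x\<in>X. x = (\<Sum>\<beta>\<in>B. of_int (z \<beta> x) * \<beta>)"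
    and additive: "\<forall>\<beta>\<in>B. \<forall>x\<in>X. \<forall>y\<in>X. x + y \<in> X \<longrightarrow> z \<beta> (x + y) = z \<beta> x + z \<beta> y"
    using integer_coordinates[OF \<open>finite X\<close>] by blast
  have X: "inner (u T) (w - v) \<in> X" if "T \<in> \<T>" "v \<in> V T" "w \<in> V T" for T v w
    unfolding X_def using that by force
  have "\<forall>\<beta> T. T \<in> \<T> \<longrightarrow> (\<exists>g. inner g (b T - a T) = of_int (z \<beta> (inner (u T) (b T - a T))) \<and>
      inner g (c T - a T) = of_int (z \<beta> (inner (u T) (c T - a T))))"
  proof (intro allI impI)
    fix \<beta> T assume "T \<in> \<T>"
    then have "cross2 (b T - a T) (c T - a T) \<noteq> 0" using abc unfolding triangle_with_def by blast
    from inner_system_solvable[OF this]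
    show "\<exists>g. inner g (b T - a T) = of_int (z \<beta> (inner (u T) (b T - a T))) \<and>
      inner g (c T - a T) = of_int (z \<beta> (inner (u T) (c T - a T)))" by blast
  qed
  then obtain g where g: "\<And>\<beta> T. T \<in> \<T> \<Longrightarrow> inner (g \<beta> T) (b T - a T) = of_int (z \<beta> (inner (u T) (b T - a T)))"
    "\<And>\<beta> T. T \<in> \<T> \<Longrightarrow> inner (g \<beta> T) (c T - a T) = of_int (z \<beta> (inner (u T) (c T - a T)))"
    by metis
  have base: "inner (g \<beta> T) (v - a T) = of_int (z \<beta> (inner (u T) (v - a T)))"
    if "\<beta> \<in> B" "T \<in> \<T>" "v \<in> V T" for \<beta> T v
  proof -
    \<comment> \<open>additivity applied to \<open>0 + 0\<close> settles the base vertex itself\<close>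
    have "0 \<in> X" using X[OF that(2), of "a T" "a T"] V[OF that(2)] by simp
    then have "z \<beta> 0 = 0" using additive[rule_format, OF that(1), of 0 0] by simp
    then show ?thesis using that V[OF that(2)] g[OF that(2)] by auto
  qed
  have diff: "inner (g \<beta> T) (w - v) = of_int (z \<beta> (inner (u T) (w - v)))"
    if "\<beta> \<in> B" "T \<in> \<T>" "v \<in> V T" "w \<in> V T" for \<beta> T v w
  proof -
    have aV: "a T \<in> V T" using V that by simp
    have "inner (u T) (w - v) + inner (u T) (v - a T) = inner (u T) (w - a T)"
      by (simp add: inner_diff_right)
    then have "z \<beta> (inner (u T) (w - a T)) = z \<beta> (inner (u T) (w - v)) + z \<beta> (inner (u T) (v - a T))"
      using additive[rule_format, OF that(1) X[OF that(2-4)] X[OF that(2) aV that(3)]] X[OF that(2) aV that(4)] by simp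
    then show ?thesis
      using base[OF that(1,2,3)] base[OF that(1,2,4)] by (simp add: inner_diff_right)
  qed
  have "\<exists>q. continuous_on (closure \<Omega>) q \<and> (\<forall>T\<in>\<T>. \<exists>k. \<forall>x\<in>T. q x = inner (g \<beta> T) x + k)"
    if \<beta>: "\<beta> \<in> B" for \<beta>
  proof -
    have 1: "inner (g \<beta> T) v + - inner (g \<beta> T) (a T) \<in> \<int>" if "T \<in> \<T>" "v extreme_point_of T" for T v
      using base[OF \<beta> that(1), of v] that unfolding V_def by (simp add: inner_diff_right)
    have 2: "inner (g \<beta> S) (y - x) = inner (g \<beta> T) (y - x)"
      if "S \<in> \<T>" "T \<in> \<T>" "S \<noteq> T" "closed_segment x y edge_of S" "closed_segment x y edge_of T" for S T x y
    proof -
      have "x \<in> V R \<and> y \<in> V R" if "closed_segment x y edge_of R" for R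
      proof -
        have "closed_segment x y face_of R" using that unfolding edge_of_def by blast
        moreover have "x extreme_point_of closed_segment x y" "y extreme_point_of closed_segment x y"
          by (simp_all add: extreme_point_of_segment)
        ultimately show ?thesis unfolding V_def using extreme_point_of_face by blast
      qed
      then show ?thesis
        using diff[OF \<beta> that(1), of x y] diff[OF \<beta> that(2), of x y] tangential[OF that] that(4,5) by simp
    qed
    show ?thesis
    proof (rule integer_potential[of "g \<beta>" "\<lambda>T. - inner (g \<beta> T) (a T)"])
      show "\<And>T v. T \<in> \<T> \<Longrightarrow> v extreme_point_of T \<Longrightarrow> inner (g \<beta> T) v + - inner (g \<beta> T) (a T) \<in> \<int>"
        by (rule 1)
    next
      fix S T x y
      assume "S \<in> \<T>" "T \<in> \<T>" "S \<noteq> T" "closed_segment x y edge_of S" "closed_segment x y edge_of T"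
      then show "inner (g \<beta> S) (y - x) = inner (g \<beta> T) (y - x)" by (rule 2)
    next
      fix q assume "continuous_on (closure \<Omega>) q" "\<And>T. T \<in> \<T> \<Longrightarrow> \<exists>k. \<forall>x\<in>T. q x = inner (g \<beta> T) x + k"
      then show ?thesis by blast
    qed
  qed
  then obtain q where q: "\<And>\<beta>. \<beta> \<in> B \<Longrightarrow> continuous_on (closure \<Omega>) (q \<beta>)"
    "\<And>\<beta> T. \<beta> \<in> B \<Longrightarrow> T \<in> \<T> \<Longrightarrow> \<exists>k. \<forall>x\<in>T. q \<beta> x = inner (g \<beta> T) x + k" by metis
  define Q where "Q = (\<lambda>x. \<Sum>\<beta>\<in>B. \<beta> * q \<beta> x)"
  show ?thesis
  proof
    show "continuous_on (closure \<Omega>) Q" unfolding Q_def using q(1) by (intro continuous_intros) auto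
  next
    fix T assume T: "T \<in> \<T>"
    obtain k where k: "\<And>\<beta> x. \<beta> \<in> B \<Longrightarrow> x \<in> T \<Longrightarrow> q \<beta> x = inner (g \<beta> T) x + k \<beta>"
      using q(2)[OF _ T] by metis
    have comb: "inner (\<Sum>\<beta>\<in>B. \<beta> *\<^sub>R g \<beta> T) (w - a T) = inner (u T) (w - a T)" if w: "w \<in> V T" for w
    proof -
      have "inner (\<Sum>\<beta>\<in>B. \<beta> *\<^sub>R g \<beta> T) (w - a T) = (\<Sum>\<beta>\<in>B. of_int (z \<beta> (inner (u T) (w - a T))) * \<beta>)"
        unfolding inner_sum_left by (rule sum.cong) (simp_all add: base[OF _ T w])
      also have "\<dots> = inner (u T) (w - a T)"
        by (rule coord[rule_format, symmetric], rule X[OF T _ w]) (simp add: V[OF T])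
      finally show ?thesis .
    qed
    have uT: "(\<Sum>\<beta>\<in>B. \<beta> *\<^sub>R g \<beta> T) = u T"
      using abc[OF T] comb[of "b T"] comb[of "c T"] V[OF T] unfolding triangle_with_def
      by (intro cross2_nonzero_inner_unique[of "b T - a T" "c T - a T"]) auto
    have "Q x = inner (u T) x + (\<Sum>\<beta>\<in>B. \<beta> * k \<beta>)" if "x \<in> T" for x
      unfolding Q_def using k[OF _ that]
      by (simp add: inner_sum_left distrib_left sum.distrib flip: uT)
    then show "\<exists>k. \<forall>x\<in>T. Q x = inner (u T) x + k" by blast
  qed
qed

end

section \<open>Spectral bound for orthogonal blocks\<close>

text \<open>For orthogonal \<open>a\<close> and \<open>b\<close> the unweighted squared norm of \<open>a \<plusminus> b\<close> is the sum of those of \<open>a\<close>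
  and \<open>b\<close>, and \<open>Q\<close> lies between \<open>kmin\<close> and \<open>kmax\<close> times it. The second bound is the first one for
  \<open>a - b\<close>, turned around by the parallelogram law.\<close>

lemma weighted_orthogonal_bounds:
  fixes a b d :: "nat \<Rightarrow> real"
  assumes d: "\<And>i. i \<in> I \<Longrightarrow> kmin \<le> d i \<and> d i \<le> kmax" and pos: "0 < kmin" "kmin \<le> kmax"
    and orth: "(\<Sum>i\<in>I. a i * b i) = 0"
  defines "Q \<equiv> \<lambda>v. \<Sum>i\<in>I. d i * (v i)\<^sup>2"
  shows "Q a + Q b \<le> (kmax / kmin) * Q (\<lambda>i. a i + b i)"
    and "Q (\<lambda>i. a i + b i) \<le> (2 - kmin / kmax) * (Q a + Q b)"
proof -
  define N where "N = (\<lambda>v::nat \<Rightarrow> real. \<Sum>i\<in>I. (v i)\<^sup>2)"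
  have kmax: "kmax > 0" using pos by linarith
  have Q_N: "kmin * N v \<le> Q v" "Q v \<le> kmax * N v" for v
    unfolding Q_def N_def sum_distrib_left
    using d by (auto intro!: sum_mono mult_right_mono)
  have plus: "N (\<lambda>i. a i + b i) = N a + N b"
    using orth unfolding N_def by (simp add: power2_sum sum.distrib mult.assoc flip: sum_distrib_left)
  have minus: "N (\<lambda>i. a i - b i) = N a + N b"
    using orth unfolding N_def by (simp add: power2_diff sum.distrib sum_subtractf mult.assoc flip: sum_distrib_left)
  have bound: "kmin * (Q a + Q b) \<le> kmax * Q v" if "N v = N a + N b" for v
  proof -
    have "kmin * (Q a + Q b) \<le> kmin * (kmax * N v)"
      using Q_N(2)[of a] Q_N(2)[of b] pos(1) that by (intro mult_left_mono) (auto simp: distrib_left)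
    also have "\<dots> = kmax * (kmin * N v)" by simp
    also have "\<dots> \<le> kmax * Q v" using Q_N(1)[of v] kmax by (intro mult_left_mono) auto
    finally show ?thesis .
  qed
  show "Q a + Q b \<le> (kmax / kmin) * Q (\<lambda>i. a i + b i)"
    using bound[OF plus] pos(1) by (simp add: field_simps)
  have "Q (\<lambda>i. a i + b i) + Q (\<lambda>i. a i - b i) = 2 * (Q a + Q b)"
    unfolding Q_def sum.distrib[symmetric] sum_distrib_left
    by (rule sum.cong[OF refl]) (simp add: power2_sum power2_diff algebra_simps)
  moreover have "(kmin / kmax) * (Q a + Q b) \<le> Q (\<lambda>i. a i - b i)"
    using bound[OF minus] kmax by (simp add: field_simps)
  ultimately show "Q (\<lambda>i. a i + b i) \<le> (2 - kmin / kmax) * (Q a + Q b)"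
    by (simp add: left_diff_distrib)
qed

text \<open>Padding with zero rows gives a singular square matrix with the same kernel.\<close>

lemma wide_matrix_kernel:
  fixes A :: "real mat"
  assumes A: "A \<in> carrier_mat n m" and "n < m"
  obtains v where "v \<in> carrier_vec m" "v \<noteq> 0\<^sub>v m" "A *\<^sub>v v = 0\<^sub>v n"
proof -
  define B where "B = A @\<^sub>r 0\<^sub>m (m - n) m"
  have B: "B \<in> carrier_mat m m"
    using carrier_append_rows[OF A, of "0\<^sub>m (m - n) m" "m - n"] assms(2) unfolding B_def by simp
  let ?e = "unit_vec m (m - 1)"
  have last: "B $$ (m - 1, i) = 0" if "i < m" for i
    using assms that unfolding B_def append_rows_def by auto
  have "transpose_mat B *\<^sub>v ?e = 0\<^sub>v m"
  proof (rule eq_vecI)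
    fix i assume "i < dim_vec (0\<^sub>v m :: real vec)"
    then have i: "i < m" by simp
    have "vec_index (transpose_mat B *\<^sub>v ?e) i = scalar_prod (row (transpose_mat B) i) ?e"
      using B i by simp
    also have "\<dots> = vec_index (row (transpose_mat B) i) (m - 1)"
      using assms(2) by (intro scalar_prod_right_unit) simp
    also have "\<dots> = 0" using B i assms(2) last[OF i] by simp
    finally show "vec_index (transpose_mat B *\<^sub>v ?e) i = vec_index (0\<^sub>v m) i" using i by simp
  qed (use B in simp)
  then have "det (transpose_mat B) = 0"
  proof -
    have "?e \<in> carrier_vec m" "?e \<noteq> 0\<^sub>v m" using assms(2) by simp_all
    moreover have "transpose_mat B \<in> carrier_mat m m" using B by simp
    ultimately show ?thesis
      using \<open>transpose_mat B *\<^sub>v ?e = 0\<^sub>v m\<close> det_0_iff_vec_prod_zero_field by blast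
  qed
  then have "det B = 0" using det_transpose[OF B] by simp
  then obtain v where v: "v \<in> carrier_vec m" "v \<noteq> 0\<^sub>v m" "B *\<^sub>v v = 0\<^sub>v m"
    using det_0_iff_vec_prod_zero_field[OF B] by blast
  have "(A *\<^sub>v v) @\<^sub>v (0\<^sub>m (m - n) m *\<^sub>v v) = B *\<^sub>v v"
    unfolding B_def by (rule mat_mult_append[OF A zero_carrier_mat v(1), symmetric])
  also have "\<dots> = 0\<^sub>v n @\<^sub>v 0\<^sub>v (m - n)"
    unfolding v(3) using assms(2) by (intro eq_vecI) auto
  finally have "A *\<^sub>v v = 0\<^sub>v n"
    using append_vec_eq[OF mult_mat_vec_carrier[OF A v(1)] zero_carrier_vec] by blast
  then show ?thesis using that v by blast
qed

lemma inv_mat_of_trivial_kernel: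
  fixes A :: "real mat"
  assumes A: "A \<in> carrier_mat n n" and ker: "\<And>v. v \<in> carrier_vec n \<Longrightarrow> A *\<^sub>v v = 0\<^sub>v n \<Longrightarrow> v = 0\<^sub>v n"
  shows "inv_mat A \<in> carrier_mat n n" "A * inv_mat A = 1\<^sub>m n" "inv_mat A * A = 1\<^sub>m n"
proof -
  have "det A \<noteq> 0" using det_0_iff_vec_prod_zero_field[OF A] ker by blast
  then have "A \<in> Units (ring_mat TYPE(real) n ())" by (rule det_non_zero_imp_unit[OF A])
  then obtain B where B: "mat_inverse A = Some B" using mat_inverse(1)[OF A] by fastforce
  then have "inv_mat A = B" unfolding inv_mat_def by simp
  then show "inv_mat A \<in> carrier_mat n n" "A * inv_mat A = 1\<^sub>m n" "inv_mat A * A = 1\<^sub>m n"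
    using mat_inverse(2)[OF A B] by auto
qed

text \<open>\<open>P\<close> is self-adjoint for the inner product of \<open>M\<close>. Concretely, for a complex eigenvector with
  real part \<open>u\<close> and imaginary part \<open>v\<close>, subtracting \<open>u \<cdot> A v\<close> from \<open>v \<cdot> A u\<close> leaves the imaginary part of
  the eigenvalue times the positive number \<open>u \<cdot> M u + v \<cdot> M v\<close>. So the eigenvalue is real, and \<open>u\<close> or
  \<open>v\<close> is a real eigenvector.\<close>

lemma symmetric_pencil_real_eigenvalue:
  fixes P A M :: "real mat"
  assumes P: "P \<in> carrier_mat n n" and A: "A \<in> carrier_mat n n" and M: "M \<in> carrier_mat n n"
    and MP: "M * P = A" and n: "n > 0"
    and symA: "\<And>u v. u \<in> carrier_vec n \<Longrightarrow> v \<in> carrier_vec n \<Longrightarrow> scalar_prod u (A *\<^sub>v v) = scalar_prod v (A *\<^sub>v u)"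
    and symM: "\<And>u v. u \<in> carrier_vec n \<Longrightarrow> v \<in> carrier_vec n \<Longrightarrow> scalar_prod u (M *\<^sub>v v) = scalar_prod v (M *\<^sub>v u)"
    and posM: "\<And>v. v \<in> carrier_vec n \<Longrightarrow> v \<noteq> 0\<^sub>v n \<Longrightarrow> scalar_prod v (M *\<^sub>v v) > 0"
  shows "spectrum P \<noteq> {}"
proof -
  let ?P = "map_mat complex_of_real P"
  have "spectrum ?P \<noteq> {}" using spectrum_non_empty[of ?P n] P n by simp
  then obtain \<mu> z where z: "z \<in> carrier_vec n" "z \<noteq> 0\<^sub>v n" "?P *\<^sub>v z = \<mu> \<cdot>\<^sub>v z"
    using P unfolding spectrum_def eigenvalue_def eigenvector_def by auto
  define u where "u = map_vec Re z"
  define v where "v = map_vec Im z"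
  have uv: "u \<in> carrier_vec n" "v \<in> carrier_vec n" unfolding u_def v_def using z(1) by auto
  have comp: "vec_index (P *\<^sub>v u) i = Re \<mu> * vec_index u i - Im \<mu> * vec_index v i \<and>
      vec_index (P *\<^sub>v v) i = Re \<mu> * vec_index v i + Im \<mu> * vec_index u i" if i: "i < n" for i
  proof -
    have "vec_index (?P *\<^sub>v z) i = (\<Sum>j<n. complex_of_real (P $$ (i, j)) * vec_index z j)"
      using P z(1) i by (simp add: scalar_prod_def atLeast0LessThan)
    then have eq: "(\<Sum>j<n. complex_of_real (P $$ (i, j)) * vec_index z j) = \<mu> * vec_index z i"
      using z i by simp
    have "vec_index (P *\<^sub>v u) i = (\<Sum>j<n. P $$ (i, j) * Re (vec_index z j))"
      "vec_index (P *\<^sub>v v) i = (\<Sum>j<n. P $$ (i, j) * Im (vec_index z j))"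
      unfolding u_def v_def using P z(1) i by (simp_all add: scalar_prod_def atLeast0LessThan)
    moreover have "(\<Sum>j<n. P $$ (i, j) * Re (vec_index z j)) = Re (\<mu> * vec_index z i)"
      "(\<Sum>j<n. P $$ (i, j) * Im (vec_index z j)) = Im (\<mu> * vec_index z i)"
      unfolding eq[symmetric] by (simp_all add: Re_sum Im_sum)
    ultimately show ?thesis unfolding u_def v_def using z(1) i by simp
  qed
  have Pu: "P *\<^sub>v u = Re \<mu> \<cdot>\<^sub>v u - Im \<mu> \<cdot>\<^sub>v v" and Pv: "P *\<^sub>v v = Re \<mu> \<cdot>\<^sub>v v + Im \<mu> \<cdot>\<^sub>v u"
    using P uv comp by (auto intro!: eq_vecI)
  have Mu: "M *\<^sub>v u \<in> carrier_vec n" and Mv: "M *\<^sub>v v \<in> carrier_vec n" using M uv by auto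
  have "A *\<^sub>v u = M *\<^sub>v (P *\<^sub>v u)" "A *\<^sub>v v = M *\<^sub>v (P *\<^sub>v v)"
    using MP M P uv by auto
  then have "A *\<^sub>v u = Re \<mu> \<cdot>\<^sub>v (M *\<^sub>v u) - Im \<mu> \<cdot>\<^sub>v (M *\<^sub>v v)"
    "A *\<^sub>v v = Re \<mu> \<cdot>\<^sub>v (M *\<^sub>v v) + Im \<mu> \<cdot>\<^sub>v (M *\<^sub>v u)"
    unfolding Pu Pv using M uv
    by (simp_all add: mult_minus_distrib_mat_vec mult_add_distrib_mat_vec mult_mat_vec)
  then have "scalar_prod v (A *\<^sub>v u) = Re \<mu> * scalar_prod v (M *\<^sub>v u) - Im \<mu> * scalar_prod v (M *\<^sub>v v)"
    "scalar_prod u (A *\<^sub>v v) = Re \<mu> * scalar_prod u (M *\<^sub>v v) + Im \<mu> * scalar_prod u (M *\<^sub>v u)"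
    using uv Mu Mv
    by (simp_all add: scalar_prod_minus_distrib scalar_prod_add_distrib)
  then have "Im \<mu> * (scalar_prod u (M *\<^sub>v u) + scalar_prod v (M *\<^sub>v v)) = 0"
    using symA[OF uv] symM[OF uv] by (simp add: algebra_simps)
  moreover have nz: "u \<noteq> 0\<^sub>v n \<or> v \<noteq> 0\<^sub>v n"
  proof (rule ccontr)
    assume "\<not> ?thesis"
    then have "vec_index u i = 0 \<and> vec_index v i = 0" if "i < n" for i using that by simp
    then have "z = 0\<^sub>v n"
      using z(1) unfolding u_def v_def by (intro eq_vecI) (auto simp: complex_eq_iff)
    then show False using z(2) by simp
  qed
  moreover have "scalar_prod w (M *\<^sub>v w) \<ge> 0" if "w \<in> carrier_vec n" for w
    using posM[OF that] M by (cases "w = 0\<^sub>v n") auto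
  ultimately have "Im \<mu> = 0"
    using posM[OF uv(1)] posM[OF uv(2)] uv by (smt (verit) mult_eq_0_iff)
  then have "P *\<^sub>v u = Re \<mu> \<cdot>\<^sub>v u" "P *\<^sub>v v = Re \<mu> \<cdot>\<^sub>v v"
    unfolding Pu Pv using uv by (auto intro!: eq_vecI)
  then have "Re \<mu> \<in> spectrum P"
    using nz uv P unfolding spectrum_def eigenvalue_def eigenvector_def by auto
  then show ?thesis by blast
qed

lemma append_cols_mult_vec:
  assumes "G \<in> carrier_mat n p" "C \<in> carrier_mat n q" "x \<in> carrier_vec p" "y \<in> carrier_vec q"
  shows "append_cols G C *\<^sub>v (x @\<^sub>v y) = G *\<^sub>v x + C *\<^sub>v y"
proof -
  have "append_cols G C *\<^sub>v (x @\<^sub>v y) = (G *\<^sub>v x + C *\<^sub>v y) @\<^sub>v (0\<^sub>m 0 p *\<^sub>v x + 0\<^sub>m 0 q *\<^sub>v y)"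
    using four_block_mat_mult_vec[OF assms(1,2) zero_carrier_mat zero_carrier_mat assms(3,4), of 0] assms
    unfolding append_cols_def by simp
  also have "\<dots> = G *\<^sub>v x + C *\<^sub>v y" using assms by (intro eq_vecI) auto
  finally show ?thesis .
qed

lemma append_cols_carrier:
  assumes "G \<in> carrier_mat n p" "C \<in> carrier_mat n q"
  shows "append_cols G C \<in> carrier_mat n (p + q)"
  using four_block_carrier_mat[OF assms(1), of "0\<^sub>m 0 (dim_col C)" 0 q] assms
  unfolding append_cols_def by auto

lemma diag_block_two_mult_vec:
  assumes "A \<in> carrier_mat p p" "B \<in> carrier_mat q q" "x \<in> carrier_vec p" "y \<in> carrier_vec q"
  shows "diag_block_mat [A, B] *\<^sub>v (x @\<^sub>v y) = (A *\<^sub>v x) @\<^sub>v (B *\<^sub>v y)"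
proof -
  have "diag_block_mat [A, B] = four_block_mat A (0\<^sub>m p q) (0\<^sub>m q p) B"
    using assms(1,2) diag_block_mat_singleton[of B] by (simp del: diag_block_mat_singleton)
  moreover have "0\<^sub>m p q *\<^sub>v y = 0\<^sub>v p" "0\<^sub>m q p *\<^sub>v x = 0\<^sub>v q"
    using assms(3,4) by (auto intro!: eq_vecI)
  ultimately show ?thesis
    using four_block_mat_mult_vec[OF assms(1) zero_carrier_mat zero_carrier_mat assms(2-4)] assms by simp
qed

lemma mat_diag_mult_vec:
  fixes d :: "nat \<Rightarrow> real"
  assumes "a \<in> carrier_vec n"
  shows "mat_diag n d *\<^sub>v a = Matrix.vec n (\<lambda>i. d i * vec_index a i)"
proof (rule eq_vecI)
  fix i assume i: "i < dim_vec (Matrix.vec n (\<lambda>i. d i * vec_index a i))"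
  then have "vec_index (mat_diag n d *\<^sub>v a) i = (\<Sum>j\<in>{0..<n}. (if j = i then d i else 0) * vec_index a j)"
    using assms by (auto simp: mat_diag_def scalar_prod_def intro!: sum.cong)
  also have "\<dots> = d i * vec_index a i" using i by (simp add: if_distrib[of "\<lambda>x. x * _"] cong: if_cong)
  finally show "vec_index (mat_diag n d *\<^sub>v a) i = vec_index (Matrix.vec n (\<lambda>i. d i * vec_index a i)) i"
    using i by simp
qed (simp add: mat_diag_def)

lemma scalar_prod_mat_diag:
  fixes d :: "nat \<Rightarrow> real"
  assumes "a \<in> carrier_vec n" "b \<in> carrier_vec n"
  shows "scalar_prod a (mat_diag n d *\<^sub>v b) = (\<Sum>i<n. d i * (vec_index a i * vec_index b i))"
  unfolding mat_diag_mult_vec[OF assms(2)] scalar_prod_def using assms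
  by (auto intro!: sum.cong simp: atLeast0LessThan)

lemma scalar_prod_self_zero:
  fixes v :: "real vec"
  assumes "v \<in> carrier_vec n" "scalar_prod v v = 0" shows "v = 0\<^sub>v n"
proof (rule eq_vecI)
  fix i assume i: "i < dim_vec (0\<^sub>v n :: real vec)"
  have "(\<Sum>i\<in>{0..<n}. vec_index v i * vec_index v i) = 0" using assms unfolding scalar_prod_def by auto
  then show "vec_index v i = vec_index (0\<^sub>v n) i"
    using i by (subst (asm) sum_nonneg_eq_0_iff) auto
qed (use assms in auto)

lemma congruence_form:
  fixes G :: "real mat"
  assumes "G \<in> carrier_mat n p" "D \<in> carrier_mat n n" "x \<in> carrier_vec p" "y \<in> carrier_vec p"
  shows "scalar_prod x ((transpose_mat G * D * G) *\<^sub>v y) = scalar_prod (G *\<^sub>v x) (D *\<^sub>v (G *\<^sub>v y))"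
proof -
  have eq: "(transpose_mat G * D * G) *\<^sub>v y = transpose_mat G *\<^sub>v (D *\<^sub>v (G *\<^sub>v y))"
  proof -
    have "(transpose_mat G * D * G) *\<^sub>v y = (transpose_mat G * D) *\<^sub>v (G *\<^sub>v y)"
      using assms by (intro assoc_mult_mat_vec[of _ p n _ p]) auto
    also have "\<dots> = transpose_mat G *\<^sub>v (D *\<^sub>v (G *\<^sub>v y))"
      using assms by (intro assoc_mult_mat_vec[of _ p n _ n]) auto
    finally show ?thesis .
  qed
  have "scalar_prod x ((transpose_mat G * D * G) *\<^sub>v y) = scalar_prod (transpose_mat G *\<^sub>v (D *\<^sub>v (G *\<^sub>v y))) x"
    unfolding eq using assms by (intro comm_scalar_prod[of _ p]) auto
  also have "\<dots> = scalar_prod (D *\<^sub>v (G *\<^sub>v y)) (G *\<^sub>v x)"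
    using assms by (intro transpose_vec_mult_scalar) auto
  also have "\<dots> = scalar_prod (G *\<^sub>v x) (D *\<^sub>v (G *\<^sub>v y))"
    using assms by (intro comm_scalar_prod[of _ n]) auto
  finally show ?thesis .
qed

text \<open>The hypotheses on kernels say that neither \<open>H\<close> nor its transpose annihilates a nonzero vector,
  so that \<open>H\<close> has as many columns as rows and is invertible. The eigenvalue equation becomes
  \<open>Ah z = r M z\<close> with \<open>M = H\<^sup>T D H\<close>, and \<open>weighted_orthogonal_bounds\<close> confines \<open>r\<close> to
  \<open>[\<eta> / (2 \<eta> - 1), \<eta>]\<close>.\<close>

lemma orthogonal_blocks_spectral_cond:
  fixes G C :: "real mat" and d :: "nat \<Rightarrow> real"
  assumes G: "G \<in> carrier_mat n p" and C: "C \<in> carrier_mat n q" and n: "n > 0"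
    and orth: "\<And>x y. x \<in> carrier_vec p \<Longrightarrow> y \<in> carrier_vec q \<Longrightarrow> scalar_prod (G *\<^sub>v x) (C *\<^sub>v y) = 0"
    and kerG: "\<And>x. x \<in> carrier_vec p \<Longrightarrow> G *\<^sub>v x = 0\<^sub>v n \<Longrightarrow> x = 0\<^sub>v p"
    and kerC: "\<And>y. y \<in> carrier_vec q \<Longrightarrow> C *\<^sub>v y = 0\<^sub>v n \<Longrightarrow> y = 0\<^sub>v q"
    and complete: "\<And>w. w \<in> carrier_vec n \<Longrightarrow> transpose_mat G *\<^sub>v w = 0\<^sub>v p \<Longrightarrow> transpose_mat C *\<^sub>v w = 0\<^sub>v q
      \<Longrightarrow> w = 0\<^sub>v n"
    and d: "\<And>i. i < n \<Longrightarrow> kmin \<le> d i \<and> d i \<le> kmax" and pos: "0 < kmin" "kmin \<le> kmax"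
  defines "D \<equiv> mat_diag n d" and "H \<equiv> append_cols G C"
  defines "Ah \<equiv> diag_block_mat [transpose_mat G * D * G, transpose_mat C * D * C]"
  shows "spectral_cond (inv_mat H * inv_mat D * inv_mat (transpose_mat H) * Ah) \<le> 2 * (kmax / kmin) - 1"
proof -
  have D: "D \<in> carrier_mat n n" unfolding D_def by simp
  have H: "H \<in> carrier_mat n (p + q)" unfolding H_def using append_cols_carrier[OF G C] .
  have split: "\<exists>x y. x \<in> carrier_vec p \<and> y \<in> carrier_vec q \<and> z = x @\<^sub>v y" if "z \<in> carrier_vec (p + q)" for z :: "real vec"
    using vec_first_last_append[OF that] vec_first_carrier vec_last_carrier by metis
  have Hxy: "H *\<^sub>v (x @\<^sub>v y) = G *\<^sub>v x + C *\<^sub>v y" if "x \<in> carrier_vec p" "y \<in> carrier_vec q" for x y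
    unfolding H_def using append_cols_mult_vec[OF G C that] .
  have zero_append: "0\<^sub>v p @\<^sub>v 0\<^sub>v q = (0\<^sub>v (p + q) :: real vec)" by (intro eq_vecI) auto
  have kerH: "z = 0\<^sub>v (p + q)" if z: "z \<in> carrier_vec (p + q)" "H *\<^sub>v z = 0\<^sub>v n" for z
  proof -
    obtain x y where xy: "x \<in> carrier_vec p" "y \<in> carrier_vec q" "z = x @\<^sub>v y" using split[OF z(1)] by blast
    have car: "G *\<^sub>v x \<in> carrier_vec n" "C *\<^sub>v y \<in> carrier_vec n" using G C xy by auto
    have sum0: "G *\<^sub>v x + C *\<^sub>v y = 0\<^sub>v n" using z(2) Hxy xy by simp
    then have "scalar_prod (G *\<^sub>v x) (G *\<^sub>v x + C *\<^sub>v y) = 0" using car by simp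
    then have "scalar_prod (G *\<^sub>v x) (G *\<^sub>v x) = 0"
      using scalar_prod_add_distrib[OF car(1,1,2)] orth[OF xy(1,2)] by simp
    then have Gx: "G *\<^sub>v x = 0\<^sub>v n" using scalar_prod_self_zero[OF car(1)] by blast
    then have "C *\<^sub>v y = 0\<^sub>v n" using sum0 car by simp
    then show ?thesis using kerG[OF xy(1) Gx] kerC[OF xy(2)] xy(3) zero_append by simp
  qed
  have kerHT: "w = 0\<^sub>v n" if w: "w \<in> carrier_vec n" "transpose_mat H *\<^sub>v w = 0\<^sub>v (p + q)" for w
  proof (rule complete[OF w(1)])
    have test: "scalar_prod w (G *\<^sub>v x + C *\<^sub>v y) = 0" if "x \<in> carrier_vec p" "y \<in> carrier_vec q" for x y
    proof -
      have "x @\<^sub>v y \<in> carrier_vec (p + q)" using that by simp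
      then have "scalar_prod w (H *\<^sub>v (x @\<^sub>v y)) = 0"
        using transpose_vec_mult_scalar[OF H _ w(1), of "x @\<^sub>v y"] w(2) by simp
      then show ?thesis using Hxy[OF that] by simp
    qed
    have C0: "C *\<^sub>v 0\<^sub>v q = 0\<^sub>v n" and G0: "G *\<^sub>v 0\<^sub>v p = 0\<^sub>v n" using C G by (auto intro!: eq_vecI)
    have GT: "transpose_mat G *\<^sub>v w \<in> carrier_vec p" and CT: "transpose_mat C *\<^sub>v w \<in> carrier_vec q"
      using G C w(1) by auto
    have "scalar_prod w (G *\<^sub>v (transpose_mat G *\<^sub>v w)) = 0"
      using test[OF GT zero_carrier_vec] G GT unfolding C0 by simp
    then have "scalar_prod (transpose_mat G *\<^sub>v w) (transpose_mat G *\<^sub>v w) = 0"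
      using transpose_vec_mult_scalar[OF G GT w(1)] by simp
    then show "transpose_mat G *\<^sub>v w = 0\<^sub>v p" using scalar_prod_self_zero[OF GT] by blast
    have "scalar_prod w (C *\<^sub>v (transpose_mat C *\<^sub>v w)) = 0"
      using test[OF zero_carrier_vec CT] C CT unfolding G0 by simp
    then have "scalar_prod (transpose_mat C *\<^sub>v w) (transpose_mat C *\<^sub>v w) = 0"
      using transpose_vec_mult_scalar[OF C CT w(1)] by simp
    then show "transpose_mat C *\<^sub>v w = 0\<^sub>v q" using scalar_prod_self_zero[OF CT] by blast
  qed
  have pq: "p + q = n"
  proof (rule ccontr)
    assume "p + q \<noteq> n"
    then consider "n < p + q" | "p + q < n" by linarith
    then show False
    proof cases
      case 1
      then show False using wide_matrix_kernel[OF H] kerH by blast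
    next
      case 2
      have "transpose_mat H \<in> carrier_mat (p + q) n" using H by simp
      then show False using wide_matrix_kernel[OF _ 2] kerHT by blast
    qed
  qed
  have Hn: "H \<in> carrier_mat n n" using H pq by simp
  have HTn: "transpose_mat H \<in> carrier_mat n n" using Hn by simp
  note invH = inv_mat_of_trivial_kernel[OF Hn kerH[unfolded pq]]
  note invHT = inv_mat_of_trivial_kernel[OF HTn kerHT[unfolded pq]]
  have "v = 0\<^sub>v n" if v: "v \<in> carrier_vec n" "D *\<^sub>v v = 0\<^sub>v n" for v
  proof (rule eq_vecI)
    fix i assume "i < dim_vec (0\<^sub>v n :: real vec)"
    then have i: "i < n" by simp
    have "d i * vec_index v i = 0"
      using arg_cong[OF v(2), of "\<lambda>u. vec_index u i"] i unfolding D_def mat_diag_mult_vec[OF v(1)] by simp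
    moreover have "d i \<noteq> 0" using d[OF i] pos(1) by linarith
    ultimately show "vec_index v i = vec_index (0\<^sub>v n) i" using i by simp
  qed (use v(1) in simp)
  note invD = inv_mat_of_trivial_kernel[OF D this]
  define M where "M = transpose_mat H * D * H"
  have M: "M \<in> carrier_mat n n" unfolding M_def using Hn D by simp
  have Ah: "Ah \<in> carrier_mat n n"
    unfolding Ah_def using G C D pq by (intro carrier_matI) (simp_all add: dim_diag_block_mat)
  define P where "P = inv_mat H * inv_mat D * inv_mat (transpose_mat H) * Ah"
  have P: "P \<in> carrier_mat n n" 
    unfolding P_def by (rule mult_carrier_mat[OF mult_carrier_mat[OF mult_carrier_mat[OF invH(1) invD(1)] invHT(1)] Ah])
  have MP: "M * P = Ah"
  proof -
    have cancel: "X * (Y * Z) = Z" if "X * Y = 1\<^sub>m n" "X \<in> carrier_mat n n" "Y \<in> carrier_mat n n"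
      "Z \<in> carrier_mat n n" for X Y Z :: "real mat"
      using assoc_mult_mat[OF that(2-4)] left_mult_one_mat[OF that(4)] that(1) by simp
    let ?Z = "inv_mat (transpose_mat H) * Ah" and ?Y = "inv_mat D * (inv_mat (transpose_mat H) * Ah)"
    have Z: "?Z \<in> carrier_mat n n" by (rule mult_carrier_mat[OF invHT(1) Ah])
    have Y: "?Y \<in> carrier_mat n n" by (rule mult_carrier_mat[OF invD(1) Z])
    have "P = (inv_mat H * inv_mat D) * ?Z"
      unfolding P_def by (rule assoc_mult_mat[OF mult_carrier_mat[OF invH(1) invD(1)] invHT(1) Ah])
    also have "\<dots> = inv_mat H * ?Y"
      by (rule assoc_mult_mat[OF invH(1) invD(1) Z])
    finally have PY: "P = inv_mat H * ?Y" .
    have HP: "H * P = ?Y" unfolding PY by (rule cancel[OF invH(2) Hn invH(1) Y])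
    have "M * P = (transpose_mat H * D) * (H * P)"
      unfolding M_def by (rule assoc_mult_mat[OF mult_carrier_mat[OF HTn D] Hn P])
    also have "\<dots> = transpose_mat H * (D * ?Y)"
      unfolding HP by (rule assoc_mult_mat[OF HTn D Y])
    also have "D * ?Y = ?Z" by (rule cancel[OF invD(2) D invD(1) Z])
    also have "transpose_mat H * ?Z = Ah" by (rule cancel[OF invHT(2) HTn invHT(1) Ah])
    finally show ?thesis .
  qed
  define B where "B = (\<lambda>a b. \<Sum>i<n. d i * (vec_index a i * vec_index b i))"
  have B: "scalar_prod a (D *\<^sub>v b) = B a b" if "a \<in> carrier_vec n" "b \<in> carrier_vec n" for a b
    unfolding D_def B_def using scalar_prod_mat_diag[OF that] .
  have Bsym: "B a b = B b a" for a b unfolding B_def by (simp add: mult.commute)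
  have M_form: "scalar_prod u (M *\<^sub>v v) = B (H *\<^sub>v u) (H *\<^sub>v v)" if "u \<in> carrier_vec n" "v \<in> carrier_vec n" for u v
    unfolding M_def congruence_form[OF Hn D that] using B Hn that by simp
  have A_form: "scalar_prod (x @\<^sub>v y) (Ah *\<^sub>v (x' @\<^sub>v y')) = B (G *\<^sub>v x) (G *\<^sub>v x') + B (C *\<^sub>v y) (C *\<^sub>v y')"
    if xy: "x \<in> carrier_vec p" "y \<in> carrier_vec q" and xy': "x' \<in> carrier_vec p" "y' \<in> carrier_vec q" for x y x' y'
  proof -
    have GG: "transpose_mat G * D * G \<in> carrier_mat p p" and CC: "transpose_mat C * D * C \<in> carrier_mat q q"
      using G C D by auto
    have "scalar_prod (x @\<^sub>v y) (Ah *\<^sub>v (x' @\<^sub>v y')) =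
        scalar_prod x ((transpose_mat G * D * G) *\<^sub>v x') + scalar_prod y ((transpose_mat C * D * C) *\<^sub>v y')"
      unfolding Ah_def diag_block_two_mult_vec[OF GG CC xy']
      using scalar_prod_append[OF xy, of "(transpose_mat G * D * G) *\<^sub>v x'" "(transpose_mat C * D * C) *\<^sub>v y'"] GG CC xy'
      by simp
    then show ?thesis
      unfolding congruence_form[OF G D xy(1) xy'(1)] congruence_form[OF C D xy(2) xy'(2)]
      using B G C xy xy' by simp
  qed
  have B_pos: "B a a > 0" if a: "a \<in> carrier_vec n" "a \<noteq> 0\<^sub>v n" for a
  proof -
    have nonneg: "d i * (vec_index a i * vec_index a i) \<ge> 0" if "i < n" for i
    proof (rule mult_nonneg_nonneg)
      show "d i \<ge> 0" using d[OF that] pos(1) by linarith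
    qed (rule zero_le_square)
    have "\<exists>i<n. vec_index a i \<noteq> 0"
    proof (rule ccontr)
      assume "\<not> ?thesis"
      then have "vec_index a i = 0" if "i < n" for i using that by blast
      then have "a = 0\<^sub>v n" using a(1) by (intro eq_vecI) simp_all
      then show False using a(2) by simp
    qed
    then obtain i where i: "i < n" "vec_index a i \<noteq> 0" by blast
    have "d i > 0" using d[OF i(1)] pos(1) by linarith
    moreover have "vec_index a i * vec_index a i > 0" using i(2) not_real_square_gt_zero by blast
    ultimately have "d i * (vec_index a i * vec_index a i) > 0" by (rule mult_pos_pos)
    then show ?thesis unfolding B_def using i(1) nonneg by (intro sum_pos2[of _ i]) simp_all
  qed
  have Hnz: "H *\<^sub>v z \<noteq> 0\<^sub>v n" if "z \<in> carrier_vec n" "z \<noteq> 0\<^sub>v n" for z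
    using kerH[unfolded pq] that by blast
  \<comment> \<open>extrema of an empty spectrum would be unspecified\<close>
  have nonempty: "spectrum P \<noteq> {}"
  proof (rule symmetric_pencil_real_eigenvalue[OF P Ah M MP n])
    fix u v :: "real vec" assume uv: "u \<in> carrier_vec n" "v \<in> carrier_vec n"
    show "scalar_prod u (M *\<^sub>v v) = scalar_prod v (M *\<^sub>v u)"
      unfolding M_form[OF uv] M_form[OF uv(2,1)] by (rule Bsym)
    obtain x y where xy: "x \<in> carrier_vec p" "y \<in> carrier_vec q" "u = x @\<^sub>v y" using split uv(1) pq by blast
    obtain x' y' where xy': "x' \<in> carrier_vec p" "y' \<in> carrier_vec q" "v = x' @\<^sub>v y'" using split uv(2) pq by blast
    show "scalar_prod u (Ah *\<^sub>v v) = scalar_prod v (Ah *\<^sub>v u)"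
      unfolding xy(3) xy'(3) A_form[OF xy(1,2) xy'(1,2)] A_form[OF xy'(1,2) xy(1,2)]
      using Bsym[of "G *\<^sub>v x"] Bsym[of "C *\<^sub>v y"] by simp
  next
    fix v :: "real vec" assume v: "v \<in> carrier_vec n" "v \<noteq> 0\<^sub>v n"
    show "scalar_prod v (M *\<^sub>v v) > 0"
      unfolding M_form[OF v(1,1)] using B_pos[OF _ Hnz[OF v]] Hn v(1) by simp
  qed
  define \<eta> where "\<eta> = kmax / kmin"
  have \<eta>: "\<eta> \<ge> 1" unfolding \<eta>_def using pos by simp
  have inv\<eta>: "kmin / kmax = 1 / \<eta>" unfolding \<eta>_def by simp
  have bounds: "\<eta> / (2 * \<eta> - 1) \<le> r \<and> r \<le> \<eta>" if r: "r \<in> spectrum P" for r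
  proof -
    obtain z where z: "z \<in> carrier_vec n" "z \<noteq> 0\<^sub>v n" "P *\<^sub>v z = r \<cdot>\<^sub>v z"
      using r P unfolding spectrum_def eigenvalue_def eigenvector_def by auto
    obtain x y where xy: "x \<in> carrier_vec p" "y \<in> carrier_vec q" "z = x @\<^sub>v y" using split z(1) pq by blast
    have "Ah *\<^sub>v z = M *\<^sub>v (P *\<^sub>v z)" using MP M P z(1) by auto
    also have "\<dots> = r \<cdot>\<^sub>v (M *\<^sub>v z)" unfolding z(3) using M z(1) by (simp add: mult_mat_vec)
    finally have "scalar_prod z (Ah *\<^sub>v z) = r * scalar_prod z (M *\<^sub>v z)" using M z(1) by simp
    define a where "a = G *\<^sub>v x"
    define b where "b = C *\<^sub>v y"
    have ab: "a \<in> carrier_vec n" "b \<in> carrier_vec n" unfolding a_def b_def using G C xy by auto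
    have Hz: "H *\<^sub>v z = a + b" unfolding a_def b_def xy(3) using Hxy[OF xy(1,2)] .
    have eig: "B a a + B b b = r * B (a + b) (a + b)"
      using \<open>scalar_prod z (Ah *\<^sub>v z) = r * scalar_prod z (M *\<^sub>v z)\<close>
      unfolding M_form[OF z(1,1)] Hz unfolding xy(3) A_form[OF xy(1,2) xy(1,2)] a_def b_def .
    have Bpos: "B (a + b) (a + b) > 0" using B_pos[OF _ Hnz[OF z(1,2)]] Hz ab by simp
    have Bsq: "B v v = (\<Sum>i<n. d i * (vec_index v i)\<^sup>2)" for v unfolding B_def by (simp add: power2_eq_square)
    have Bsum: "B (a + b) (a + b) = (\<Sum>i<n. d i * (vec_index a i + vec_index b i)\<^sup>2)"
      unfolding Bsq using ab by (intro sum.cong) auto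
    have "(\<Sum>i<n. vec_index a i * vec_index b i) = 0"
      using orth[OF xy(1,2)] ab unfolding a_def[symmetric] b_def[symmetric] scalar_prod_def
      by (simp add: atLeast0LessThan)
    then have "B a a + B b b \<le> \<eta> * B (a + b) (a + b)"
      "B (a + b) (a + b) \<le> (2 - 1 / \<eta>) * (B a a + B b b)"
      unfolding Bsum unfolding Bsq \<eta>_def[symmetric] inv\<eta>[symmetric] unfolding \<eta>_def
      using weighted_orthogonal_bounds[of "{..<n}" kmin d kmax] d pos by auto
    then have "r * B (a + b) (a + b) \<le> \<eta> * B (a + b) (a + b)"
      "1 * B (a + b) (a + b) \<le> ((2 - 1 / \<eta>) * r) * B (a + b) (a + b)"
      unfolding eig by (simp_all add: mult.assoc)
    then have "r \<le> \<eta>" "1 \<le> (2 - 1 / \<eta>) * r" using Bpos by (auto dest: mult_right_le_imp_le)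
    moreover have "(2 - 1 / \<eta>) = (2 * \<eta> - 1) / \<eta>" using \<eta> by (simp add: field_simps)
    ultimately show ?thesis using \<eta> by (simp add: field_simps)
  qed
  have fin: "finite (spectrum P)" using card_finite_spectrum(1)[OF P] .
  have "Max (spectrum P) \<le> \<eta>" using bounds fin nonempty by (subst Max_le_iff) auto
  moreover have min: "\<eta> / (2 * \<eta> - 1) \<le> Min (spectrum P)" using bounds fin nonempty by (subst Min_ge_iff) auto
  ultimately have "Max (spectrum P) / Min (spectrum P) \<le> \<eta> / (\<eta> / (2 * \<eta> - 1))"
    using \<eta> by (intro frac_le) auto
  also have "\<dots> = 2 * \<eta> - 1" using \<eta> by simp
  finally show ?thesis unfolding spectral_cond_def P_def \<eta>_def .
qed

section \<open>Gradients of finite element functions\<close>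

definition gradient :: "(real^2 \<Rightarrow> real) \<Rightarrow> real^2 \<Rightarrow> real^2" where
  "gradient f x = (\<chi> l. partial_deriv l f x)"

text \<open>The rotation by a right angle; the vector curl of \<open>w\<close> is \<open>- rot90\<close> of its gradient.\<close>

definition rot90 :: "real^2 \<Rightarrow> real^2" where
  "rot90 v = (\<chi> i. if i = 1 then - vec_nth v 2 else vec_nth v 1)"

lemma gradient_nth: "vec_nth (gradient f x) l = partial_deriv l f x"
  unfolding gradient_def by simp

lemma rot90_nth: "vec_nth (rot90 v) 1 = - vec_nth v 2" "vec_nth (rot90 v) 2 = vec_nth v 1"
  unfolding rot90_def by simp_all

lemma inner_rot90: "inner (rot90 v) w = cross2 v w"
  unfolding inner_plane rot90_nth cross2_def by simp

lemma inner_rot90_rot90: "inner (rot90 x) (rot90 y) = inner x y"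
  by (simp add: rot90_nth inner_plane)

lemma gradient_of_locally_affine:
  assumes "open S" "x \<in> S" "\<And>y. y \<in> S \<Longrightarrow> f y = inner g y + k"
  shows "gradient f x = g"
proof -
  have "partial_deriv l f x = vec_nth g l" for l
  proof -
    let ?h = "\<lambda>t::real. x + t *\<^sub>R axis l 1"
    have "(?h \<longlongrightarrow> ?h 0) (nhds 0)"
      by (intro tendsto_intros filterlim_ident)
    then have "eventually (\<lambda>t. ?h t \<in> S) (nhds 0)"
      using assms(1,2) by (auto intro: topological_tendstoD)
    then have ev: "eventually (\<lambda>t. f (?h t) = inner g (?h t) + k) (nhds 0)"
      by eventually_elim (rule assms(3))
    have "((\<lambda>t. inner g (?h t) + k) has_field_derivative vec_nth g l) (at 0)"
      by (auto intro!: derivative_eq_intros simp: inner_add_right inner_axis)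
    then have "((\<lambda>t. f (?h t)) has_field_derivative vec_nth g l) (at 0)"
      using DERIV_cong_ev[OF refl ev refl] by blast
    then show ?thesis unfolding partial_deriv_def by (rule DERIV_imp_deriv)
  qed
  then show ?thesis by (auto intro!: plane_vector_eqI simp: gradient_nth)
qed

lemma affine_fun_on_gradient:
  assumes T: "triangle_with a b c T" and f: "affine_fun_on (interior T) f"
  obtains k where "\<And>x. x \<in> interior T \<Longrightarrow> f x = inner (gradient f (barycenter T)) x + k"
proof -
  obtain g k where gk: "\<And>x. x \<in> interior T \<Longrightarrow> f x = inner g x + k"
    using f unfolding affine_fun_on_def by blast
  have "gradient f (barycenter T) = g"
    by (rule gradient_of_locally_affine[OF open_interior barycenter_in_interior[OF T] gk])
  then show ?thesis using that gk by blast
qed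

lemma affine_fun_on_closed_gradient:
  assumes T: "triangle_with a b c T" and f: "affine_fun_on T f"
  obtains k where "\<And>x. x \<in> T \<Longrightarrow> f x = inner (gradient f (barycenter T)) x + k"
proof -
  obtain g k where gk: "\<And>x. x \<in> T \<Longrightarrow> f x = inner g x + k"
    using f unfolding affine_fun_on_def by blast
  have "gradient f (barycenter T) = g"
  proof (rule gradient_of_locally_affine[OF open_interior barycenter_in_interior[OF T]])
    fix y assume "y \<in> interior T"
    then show "f y = inner g y + k" using gk interior_subset by blast
  qed
  then show ?thesis using that gk by blast
qed

lemma affine_fun_on_sum:
  assumes "finite E" "\<And>e. e \<in> E \<Longrightarrow> affine_fun_on S (f e)"
  shows "affine_fun_on S (\<lambda>x. \<Sum>e\<in>E. c e * f e x)"
proof -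
  have "\<forall>e\<in>E. \<exists>g k. \<forall>x\<in>S. f e x = inner g x + k" using assms(2) unfolding affine_fun_on_def by blast
  then have "\<exists>G. \<forall>e\<in>E. \<exists>k. \<forall>x\<in>S. f e x = inner (G e) x + k" by (rule bchoice)
  then obtain G where "\<forall>e\<in>E. \<exists>k. \<forall>x\<in>S. f e x = inner (G e) x + k" by blast
  then have "\<exists>K. \<forall>e\<in>E. \<forall>x\<in>S. f e x = inner (G e) x + K e" by (rule bchoice)
  then obtain K where K: "\<forall>e\<in>E. \<forall>x\<in>S. f e x = inner (G e) x + K e" by blast
  have "(\<Sum>e\<in>E. c e * f e x) = inner (\<Sum>e\<in>E. c e *\<^sub>R G e) x + (\<Sum>e\<in>E. c e * K e)" if "x \<in> S" for x
  proof -
    have "(\<Sum>e\<in>E. c e * f e x) = (\<Sum>e\<in>E. c e * inner (G e) x + c e * K e)"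
      using K that by (intro sum.cong) (auto simp: distrib_left)
    then show ?thesis by (simp add: inner_sum_left sum.distrib)
  qed
  then show ?thesis unfolding affine_fun_on_def by blast
qed

context triangulated_polygon
begin

lemma finite_mesh_edges: "finite (mesh_edges \<T>)"
proof -
  have "mesh_edges \<T> \<subseteq> (\<Union>T\<in>\<T>. {F. F face_of T})"
    unfolding mesh_edges_def edge_of_def by blast
  moreover have "finite {F. F face_of T}" if "T \<in> \<T>" for T
    using mesh_simplex[OF that] simplex_imp_polytope finite_polytope_faces by blast
  ultimately show ?thesis using finite_mesh finite_subset by blast
qed

text \<open>Approach the midpoint of the edge along a ray into the triangle: on the ray the function is
  affine, and at the midpoint it is continuous within the closed domain.\<close>

lemma CR_space_trace:
  assumes f: "f \<in> CR_space \<Omega> \<T>" and T: "T \<in> \<T>" and e: "e edge_of T"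
    and aff: "\<And>x. x \<in> interior T \<Longrightarrow> f x = inner g x + k"
  shows "f (barycenter e) = inner g (barycenter e) + k"
proof -
  obtain a b c where abc: "triangle_with a b c T" "e = closed_segment a b"
    using mesh_edge[OF T e] by metis
  let ?m = "midpoint a b"
  have m: "barycenter e = ?m"
    using barycenter_segment triangle_with_distinct(1)[OF abc(1)] abc(2) by simp
  have nz: "cross2 (b - a) (c - a) \<noteq> 0" using abc(1) unfolding triangle_with_def by simp
  let ?h = "\<lambda>t. ?m + t *\<^sub>R (c - a)"
  have ev: "eventually (\<lambda>t. ?h t \<in> interior T) (at_right 0)"
    by (rule midpoint_shift_in_interior[OF abc(1)]) (simp add: nz)
  have lim: "(?h \<longlongrightarrow> ?m) (at_right 0)"
    by (rule tendsto_eq_intros refl | simp)+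
  have "e \<in> mesh_edges \<T>" using T e unfolding mesh_edges_def by blast
  then have "continuous (at ?m within closure \<Omega>) f" using f m unfolding CR_space_def by auto
  moreover have "eventually (\<lambda>t. ?h t \<in> closure \<Omega>) (at_right 0)"
    using ev by eventually_elim (use mesh_subset[OF T] interior_subset in blast)
  ultimately have "((\<lambda>t. f (?h t)) \<longlongrightarrow> f ?m) (at_right 0)"
    using lim by (rule continuous_within_tendsto_compose)
  moreover have "eventually (\<lambda>t. f (?h t) = inner g (?h t) + k) (at_right 0)"
    using ev by eventually_elim (rule aff)
  ultimately have "((\<lambda>t. inner g (?h t) + k) \<longlongrightarrow> f ?m) (at_right 0)"
    by (rule Lim_transform_eventually)
  moreover have "((\<lambda>t. inner g (?h t) + k) \<longlongrightarrow> inner g ?m + k) (at_right 0)"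
    by (intro tendsto_intros lim)
  ultimately show ?thesis
    unfolding m using tendsto_unique[OF trivial_limit_at_right_real] by blast
qed

lemma CR_space_sum:
  assumes "finite E" "\<And>e. e \<in> E \<Longrightarrow> f e \<in> CR_space \<Omega> \<T>"
  shows "(\<lambda>x. \<Sum>e\<in>E. c e * f e x) \<in> CR_space \<Omega> \<T>"
proof -
  have "affine_fun_on (interior T) (\<lambda>x. \<Sum>e\<in>E. c e * f e x)" if "T \<in> \<T>" for T
    using assms that by (intro affine_fun_on_sum) (auto simp: CR_space_def)
  moreover have "continuous (at (barycenter e') within closure \<Omega>) (\<lambda>x. \<Sum>e\<in>E. c e * f e x)" if "e' \<in> mesh_edges \<T>" for e'
    using assms that by (intro continuous_intros) (auto simp: CR_space_def)
  moreover have "(\<Sum>e\<in>E. c e * f e (barycenter e')) = 0" if "e' \<in> boundary_edges \<Omega> \<T>" for e'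
    using assms that by (intro sum.neutral) (auto simp: CR_space_def)
  ultimately show ?thesis unfolding CR_space_def by blast
qed

text \<open>Differences of edge midpoints are halves of edge vectors, so the three midpoint values determine
  the gradient.\<close>

lemma CR_midpoint_gradient:
  assumes f: "f \<in> CR_space \<Omega> \<T>" and T: "T \<in> \<T>" "triangle_with a b c T"
  shows "inner (gradient f (barycenter T)) (b - a) =
      2 * (f (barycenter (closed_segment b c)) - f (barycenter (closed_segment c a)))"
    and "inner (gradient f (barycenter T)) (c - a) =
      2 * (f (barycenter (closed_segment b c)) - f (barycenter (closed_segment a b)))"
proof -
  let ?g = "gradient f (barycenter T)"
  have "affine_fun_on (interior T) f" using f T(1) unfolding CR_space_def by blast
  then obtain k where k: "\<And>x. x \<in> interior T \<Longrightarrow> f x = inner ?g x + k"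
    using affine_fun_on_gradient[OF T(2)] by metis
  have mids: "barycenter (closed_segment b c) = midpoint b c" "barycenter (closed_segment c a) = midpoint c a"
    "barycenter (closed_segment a b) = midpoint a b"
    using triangle_with_distinct[OF T(2)] by (auto intro!: barycenter_segment)
  have edges: "closed_segment a b edge_of T" "closed_segment b c edge_of T" "closed_segment c a edge_of T"
    unfolding edge_of_triangle[OF T(2)] by auto
  have trace: "f (barycenter e) = inner ?g (barycenter e) + k" if "e edge_of T" for e
    by (rule CR_space_trace[OF f T(1) that]) (rule k)
  note tr = trace[OF edges(1)] trace[OF edges(2)] trace[OF edges(3)]
  show "inner ?g (b - a) = 2 * (f (barycenter (closed_segment b c)) - f (barycenter (closed_segment c a)))"
    unfolding tr unfolding mids midpoint_def
    by (simp add: inner_add_right inner_diff_right add_divide_distrib)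
  show "inner ?g (c - a) = 2 * (f (barycenter (closed_segment b c)) - f (barycenter (closed_segment a b)))"
    unfolding tr unfolding mids midpoint_def
    by (simp add: inner_add_right inner_diff_right add_divide_distrib)
qed

text \<open>On this triangle the basis function is \<open>1\<close> minus twice the barycentric coordinate of \<open>c\<close>.\<close>

lemma CR_basis_gradient_on_edge:
  assumes f: "CR_basis_function \<Omega> \<T> e f" and T: "T \<in> \<T>" "triangle_with a b c T" and e: "e = closed_segment a b"
  shows "inner (gradient f (barycenter T)) w = - 2 * cross2 (b - a) w / cross2 (b - a) (c - a)"
proof -
  let ?D = "cross2 (b - a) (c - a)"
  have nz: "?D \<noteq> 0" using T(2) unfolding triangle_with_def by simp
  have fCR: "f \<in> CR_space \<Omega> \<T>" using f unfolding CR_basis_function_def by blast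
  have "closed_segment b c \<in> mesh_edges \<T>" "closed_segment c a \<in> mesh_edges \<T>"
    unfolding mesh_edges_def using T(1) edge_of_triangle[OF T(2)] by auto
  moreover have "closed_segment b c \<noteq> e" "closed_segment c a \<noteq> e"
    unfolding e using triangle_with_distinct[OF T(2)] by (auto simp: closed_segment_eq doubleton_eq_iff)
  ultimately have v: "f (barycenter (closed_segment b c)) = 0" "f (barycenter (closed_segment c a)) = 0"
    "f (barycenter (closed_segment a b)) = 1"
    using f e unfolding CR_basis_function_def by auto
  have "gradient f (barycenter T) = (- 2 / ?D) *\<^sub>R rot90 (b - a)"
    by (rule cross2_nonzero_inner_unique[OF nz])
      (simp_all add: CR_midpoint_gradient[OF fCR T] v inner_rot90 nz)
  then show ?thesis by (simp add: inner_rot90)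
qed

lemma CR_basis_gradient_off_edge:
  assumes f: "CR_basis_function \<Omega> \<T> e f" and T: "T \<in> \<T>" and e: "\<not> e edge_of T"
  shows "gradient f (barycenter T) = 0"
proof -
  obtain a b c where abc: "triangle_with a b c T" using mesh_triangle[OF T] .
  have nz: "cross2 (b - a) (c - a) \<noteq> 0" using abc unfolding triangle_with_def by simp
  have fCR: "f \<in> CR_space \<Omega> \<T>" using f unfolding CR_basis_function_def by blast
  have "f (barycenter e') = 0" if "e' edge_of T" for e'
    using f T e that unfolding CR_basis_function_def mesh_edges_def by blast
  then have v: "f (barycenter (closed_segment b c)) = 0" "f (barycenter (closed_segment c a)) = 0"
    "f (barycenter (closed_segment a b)) = 0"
    using edge_of_triangle[OF abc] by auto
  show ?thesis
    by (rule cross2_nonzero_inner_unique[OF nz]) (simp_all add: CR_midpoint_gradient[OF fCR T abc] v)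
qed

text \<open>Only the two triangles at the edge contribute, and there the area times the gradient is the edge
  vector rotated by a right angle, with opposite signs. What remains is the jump of the normal
  component of \<open>w\<close>, scaled by the length of the edge. \<open>S\<close> lies to the left of the edge from \<open>a\<close> to \<open>b\<close> and
  \<open>T\<close> to the right, as the inequality for the barycenters records.\<close>

lemma CR_basis_pairing:
  assumes "e \<in> interior_edges \<Omega> \<T>"
  obtains a b S T where "e = closed_segment a b" "S \<in> \<T>" "T \<in> \<T>" "e edge_of S" "e edge_of T"
    "\<And>R. R \<in> \<T> \<Longrightarrow> e edge_of R \<Longrightarrow> R = S \<or> R = T"
    "cross2 (b - a) (barycenter T - barycenter S) < 0"
    "\<And>f w. CR_basis_function \<Omega> \<T> e f \<Longrightarrow>
      (\<Sum>R\<in>\<T>. area R * inner (gradient f (barycenter R)) (w R)) = cross2 (b - a) (w T - w S)"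
proof (rule interior_edge_two_triangles[OF assms])
  fix a b c d S T
  assume e: "e = closed_segment a b" and S: "S \<in> \<T>" and T: "T \<in> \<T>"
    and abc: "triangle_with a b c S" and abd: "triangle_with a b d T"
    and pos: "cross2 (b - a) (c - a) > 0" and neg: "cross2 (b - a) (d - a) < 0"
    and only: "\<And>R. R \<in> \<T> \<Longrightarrow> e edge_of R \<Longrightarrow> R = S \<or> R = T"
  have edges: "e edge_of S" "e edge_of T" unfolding e using triangle_with_edge abc abd by auto
  have ST: "S \<noteq> T"
  proof
    assume "S = T"
    then have "c \<in> {a, b, d}"
      using triangle_with_extreme_point[OF abc, of c] triangle_with_extreme_point[OF abd, of c] by simp
    then have "c = d" using triangle_with_distinct[OF abc] by auto
    then show False using pos neg by simp
  qed
  have cen: "cross2 (b - a) (barycenter S - a) = cross2 (b - a) (c - a) / 3"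
    "cross2 (b - a) (barycenter T - a) = cross2 (b - a) (d - a) / 3"
    using bary_coord_barycenter[OF abc] bary_coord_barycenter[OF abd] pos neg
    unfolding bary_coord_def by (simp_all add: field_simps)
  have "cross2 (b - a) (barycenter T - barycenter S) =
      cross2 (b - a) (barycenter T - a) - cross2 (b - a) (barycenter S - a)"
    by (simp add: cross2_diff_right)
  then have below: "cross2 (b - a) (barycenter T - barycenter S) < 0" unfolding cen using pos neg by simp
  have pairing: "(\<Sum>R\<in>\<T>. area R * inner (gradient f (barycenter R)) (w R)) = cross2 (b - a) (w T - w S)"
    if f: "CR_basis_function \<Omega> \<T> e f" for f w
  proof -
    have "(\<Sum>R\<in>\<T>. area R * inner (gradient f (barycenter R)) (w R)) =
        (\<Sum>R\<in>{S, T}. area R * inner (gradient f (barycenter R)) (w R))"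
    proof (rule sum.mono_neutral_right[OF finite_mesh])
      show "{S, T} \<subseteq> \<T>" using S T by simp
      show "\<forall>R\<in>\<T> - {S, T}. area R * inner (gradient f (barycenter R)) (w R) = 0"
        using only CR_basis_gradient_off_edge[OF f] by fastforce
    qed
    also have "\<dots> = area S * inner (gradient f (barycenter S)) (w S) + area T * inner (gradient f (barycenter T)) (w T)"
      using ST by simp
    also have "\<dots> = cross2 (b - a) (w T) - cross2 (b - a) (w S)"
      unfolding CR_basis_gradient_on_edge[OF f S abc e] CR_basis_gradient_on_edge[OF f T abd e]
        area_triangle[OF abc] area_triangle[OF abd]
      using pos neg by simp
    finally show ?thesis by (simp only: cross2_diff_right)
  qed
  show thesis by (rule that[OF e S T edges only below pairing])
qed

section \<open>The discrete Helmholtz decomposition\<close>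

lemma area_pos: "T \<in> \<T> \<Longrightarrow> area T > 0"
proof -
  assume T: "T \<in> \<T>"
  obtain a b c where abc: "triangle_with a b c T" using mesh_triangle[OF T] .
  then have "cross2 (b - a) (c - a) \<noteq> 0" unfolding triangle_with_def by simp
  then show ?thesis using area_triangle[OF abc] by simp
qed

text \<open>A combination \<open>v\<close> with vanishing gradients is constant on each triangle, with the same value
  \<open>c e\<close> on both sides of an interior edge \<open>e\<close>. Pair the vanishing gradients with the field whose value
  on \<open>T\<close> is \<open>v\<close> times the barycenter of \<open>T\<close>: by \<open>CR_basis_pairing\<close> the contribution of \<open>e\<close> is
  \<open>(c e)\<^sup>2\<close> times a negative number, because the two barycenters lie on opposite sides of \<open>e\<close>. So all
  coefficients vanish.\<close>

lemma CR_gradient_injective: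
  assumes \<phi>_basis: "\<And>e. e \<in> interior_edges \<Omega> \<T> \<Longrightarrow> CR_basis_function \<Omega> \<T> e (\<phi> e)"
    and zero_all: "\<And>T. T \<in> \<T> \<Longrightarrow>
      (\<Sum>e\<in>interior_edges \<Omega> \<T>. c e *\<^sub>R gradient (\<phi> e) (barycenter T)) = 0"
    and e_interior: "e \<in> interior_edges \<Omega> \<T>"
  shows "c e = 0"
proof -
  define E where "E = interior_edges \<Omega> \<T>"
  have E: "finite E" "E \<subseteq> interior_edges \<Omega> \<T>"
    using finite_subset[OF _ finite_mesh_edges] unfolding E_def interior_edges_def by auto
  note \<phi> = \<phi>_basis[folded E_def] and zero = zero_all[folded E_def] and e = e_interior[folded E_def]
  define v where "v = (\<lambda>x. \<Sum>e\<in>E. c e * \<phi> e x)"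
  have vCR: "v \<in> CR_space \<Omega> \<T>"
    unfolding v_def using \<phi> by (intro CR_space_sum E(1)) (auto simp: CR_basis_function_def)
  have v_mid: "v (barycenter e) = c e" if "e \<in> E" for e
  proof -
    have "e \<in> mesh_edges \<T>" using that E(2) unfolding interior_edges_def by blast
    then have "\<phi> e' (barycenter e) = (if e' = e then 1 else 0)" if "e' \<in> E" for e'
      using \<phi>[OF that] unfolding CR_basis_function_def by auto
    then have "v (barycenter e) = (\<Sum>e'\<in>E. if e' = e then c e' else 0)"
      unfolding v_def by (intro sum.cong) auto
    then show ?thesis using E(1) that by simp
  qed
  have v_T: "v (barycenter T) = c e" if T: "T \<in> \<T>" and e: "e \<in> E" "e edge_of T" for T e
  proof -
    have "\<exists>k. \<forall>x\<in>interior T. v x = inner 0 x + k"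
    proof -
      obtain a b d where abd: "triangle_with a b d T" using mesh_triangle[OF T] .
      have "\<exists>k. \<forall>x\<in>interior T. \<phi> e x = inner (gradient (\<phi> e) (barycenter T)) x + k" if "e \<in> E" for e
      proof -
        have "affine_fun_on (interior T) (\<phi> e)"
          using \<phi>[OF that] T unfolding CR_basis_function_def CR_space_def by blast
        then show ?thesis using affine_fun_on_gradient[OF abd] by metis
      qed
      then obtain k where k: "\<forall>e\<in>E. \<forall>x\<in>interior T. \<phi> e x = inner (gradient (\<phi> e) (barycenter T)) x + k e"
        by metis
      have "v x = (\<Sum>e\<in>E. c e * k e)" if "x \<in> interior T" for x
      proof -
        have "v x = (\<Sum>e\<in>E. c e * inner (gradient (\<phi> e) (barycenter T)) x + c e * k e)"
          unfolding v_def using k that by (intro sum.cong) (auto simp: distrib_left)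
        also have "\<dots> = inner (\<Sum>e\<in>E. c e *\<^sub>R gradient (\<phi> e) (barycenter T)) x + (\<Sum>e\<in>E. c e * k e)"
          by (simp add: sum.distrib inner_sum_left)
        finally show ?thesis using zero[OF T] by simp
      qed
      then show ?thesis by auto
    qed
    then obtain k where k: "\<And>x. x \<in> interior T \<Longrightarrow> v x = inner 0 x + k" by blast
    have "v (barycenter e) = inner 0 (barycenter e) + k"
      by (rule CR_space_trace[OF vCR T e(2)]) (rule k)
    moreover obtain a b d where "triangle_with a b d T" using mesh_triangle[OF T] .
    then have "v (barycenter T) = inner 0 (barycenter T) + k" using k barycenter_in_interior by blast
    ultimately show ?thesis using v_mid[OF e(1)] by simp
  qed
  let ?w = "\<lambda>T. v (barycenter T) *\<^sub>R barycenter T"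
  define J where "J = (\<lambda>e. \<Sum>T\<in>\<T>. area T * inner (gradient (\<phi> e) (barycenter T)) (?w T))"
  have J: "c e * J e \<le> 0 \<and> (c e * J e = 0 \<longrightarrow> c e = 0)" if eE: "e \<in> E" for e
  proof -
    have "e \<in> interior_edges \<Omega> \<T>" using eE E(2) by blast
    then show ?thesis
    proof (rule CR_basis_pairing)
      fix a b S T
      assume ST: "S \<in> \<T>" "T \<in> \<T>" "e edge_of S" "e edge_of T"
        and neg: "cross2 (b - a) (barycenter T - barycenter S) < 0"
        and pair: "\<And>f w. CR_basis_function \<Omega> \<T> e f \<Longrightarrow>
          (\<Sum>R\<in>\<T>. area R * inner (gradient f (barycenter R)) (w R)) = cross2 (b - a) (w T - w S)"
      have "J e = cross2 (b - a) (?w T - ?w S)" unfolding J_def by (rule pair[OF \<phi>[OF eE]])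
      also have "\<dots> = c e * cross2 (b - a) (barycenter T - barycenter S)"
        using v_T[OF ST(1) eE ST(3)] v_T[OF ST(2) eE ST(4)] by (simp flip: scaleR_diff_right)
      finally have "c e * J e = (c e)\<^sup>2 * cross2 (b - a) (barycenter T - barycenter S)"
        by (simp add: power2_eq_square)
      then show ?thesis using neg by (auto simp: mult_nonneg_nonpos)
    qed
  qed
  have "(\<Sum>e\<in>E. c e * J e) = (\<Sum>T\<in>\<T>. area T * inner (\<Sum>e\<in>E. c e *\<^sub>R gradient (\<phi> e) (barycenter T)) (?w T))"
    unfolding J_def inner_sum_left sum_distrib_left by (subst sum.swap) (simp add: mult_ac)
  also have "\<dots> = 0" using zero by simp
  finally have "(\<Sum>e\<in>E. - (c e * J e)) = 0" by (simp add: sum_negf)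
  then have "\<forall>e\<in>E. - (c e * J e) = 0" using J E(1) by (subst (asm) sum_nonneg_eq_0_iff) auto
  then show ?thesis using J e by auto
qed

lemma P1_gradient:
  assumes f: "f \<in> P1_space \<Omega> \<T>" and T: "T \<in> \<T>"
  shows "\<exists>k. \<forall>x\<in>T. f x = inner (gradient f (barycenter T)) x + k"
proof -
  obtain a b c where abc: "triangle_with a b c T" using mesh_triangle[OF T] .
  have "affine_fun_on T f" using f T unfolding P1_space_def by blast
  then show ?thesis using affine_fun_on_closed_gradient[OF abc] by metis
qed

lemma edge_subset: "e edge_of T \<Longrightarrow> e \<subseteq> T"
  unfolding edge_of_def using face_of_imp_subset by blast

text \<open>The normal component of a curl along an edge is the tangential derivative of \<open>\<psi>\<close>, which depends
  only on the values of \<open>\<psi>\<close> at the end points; so it does not jump.\<close>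

lemma CR_gradient_orthogonal_curl:
  assumes \<phi>: "CR_basis_function \<Omega> \<T> e \<phi>" "e \<in> interior_edges \<Omega> \<T>" and \<psi>: "\<psi> \<in> P1_space \<Omega> \<T>"
  shows "(\<Sum>T\<in>\<T>. area T * inner (gradient \<phi> (barycenter T)) (- rot90 (gradient \<psi> (barycenter T)))) = 0"
proof (rule CR_basis_pairing[OF \<phi>(2)])
  fix a b S T
  assume e: "e = closed_segment a b" and ST: "S \<in> \<T>" "T \<in> \<T>" "e edge_of S" "e edge_of T"
    and pair: "\<And>f w. CR_basis_function \<Omega> \<T> e f \<Longrightarrow>
      (\<Sum>R\<in>\<T>. area R * inner (gradient f (barycenter R)) (w R)) = cross2 (b - a) (w T - w S)"
  let ?g = "\<lambda>T. gradient \<psi> (barycenter T)"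
  have tang: "inner (?g R) (b - a) = \<psi> b - \<psi> a" if R: "R \<in> \<T>" "e edge_of R" for R
  proof -
    obtain k where "\<forall>x\<in>R. \<psi> x = inner (?g R) x + k" using P1_gradient[OF \<psi> R(1)] by blast
    moreover have "a \<in> R" "b \<in> R" using edge_subset[OF R(2)] e by auto
    ultimately show ?thesis by (simp add: inner_diff_right)
  qed
  have rot: "cross2 v (- rot90 g) = - inner g v" for v g
    by (simp add: cross2_def rot90_nth inner_plane)
  have "(\<Sum>T\<in>\<T>. area T * inner (gradient \<phi> (barycenter T)) (- rot90 (?g T))) =
      cross2 (b - a) (- rot90 (?g T) - - rot90 (?g S))" by (rule pair[OF \<phi>(1)])
  also have "\<dots> = inner (?g S) (b - a) - inner (?g T) (b - a)"
    unfolding cross2_diff_right rot by simp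
  also have "\<dots> = 0" using tang ST by simp
  finally show ?thesis .
qed

lemma domain_lmeasurable: "\<Omega> \<in> lmeasurable"
  using polygonal_domain_bounded[OF domain] polygonal_domain_open[OF domain] lmeasurable_open by blast

lemma domain_measure_pos: "measure lebesgue \<Omega> > 0"
proof -
  have "\<not> negligible \<Omega>"
    using open_not_negligible polygonal_domain_open[OF domain] polygonal_domain_nonempty[OF domain] by blast
  then show ?thesis
    using domain_lmeasurable by (simp add: negligible_iff_measure zero_less_measure_iff)
qed

lemma P1_integrable:
  assumes "f \<in> P1_space \<Omega> \<T>" shows "set_integrable lebesgue \<Omega> f"
proof -
  have "compact (closure \<Omega>)" using polygonal_domain_bounded[OF domain] by simp
  moreover have "continuous_on (closure \<Omega>) f" using assms unfolding P1_space_def by blast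
  ultimately have int: "integrable lborel (\<lambda>x. indicator (closure \<Omega>) x *\<^sub>R f x)"
    by (rule borel_integrable_compact)
  have "integrable lebesgue (\<lambda>x. indicator (closure \<Omega>) x *\<^sub>R f x)"
    using integrable_completion[of "\<lambda>x. indicator (closure \<Omega>) x *\<^sub>R f x" lborel] int
      borel_measurable_integrable[OF int] by simp
  then have "set_integrable lebesgue (closure \<Omega>) f" unfolding set_integrable_def .
  then show ?thesis
    by (rule set_integrable_subset) (use domain_lmeasurable closure_subset in auto)
qed

lemma P1_constant: "(\<lambda>x. k) \<in> P1_space \<Omega> \<T>"
proof -
  have "affine_fun_on T (\<lambda>x. k)" for T
    unfolding affine_fun_on_def by (intro exI[of _ 0] exI[of _ k]) simp
  then show ?thesis unfolding P1_space_def by simp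
qed

lemma constant_integral: "set_lebesgue_integral lebesgue \<Omega> (\<lambda>x. k) = measure lebesgue \<Omega> * k"
  using set_integral_const[of \<Omega> lebesgue k] fmeasurableD[OF domain_lmeasurable] fmeasurableD2[OF domain_lmeasurable]
  by simp

lemma P1_sum:
  fixes n :: nat
  assumes "\<And>j. j < n \<Longrightarrow> f j \<in> P1_space \<Omega> \<T>"
  shows "(\<lambda>x. \<Sum>j<n. c j * f j x) \<in> P1_space \<Omega> \<T>"
proof -
  have "continuous_on (closure \<Omega>) (\<lambda>x. \<Sum>j<n. c j * f j x)"
    using assms by (intro continuous_intros) (auto simp: P1_space_def)
  moreover have "affine_fun_on T (\<lambda>x. \<Sum>j<n. c j * f j x)" if "T \<in> \<T>" for T
    using assms that by (intro affine_fun_on_sum) (auto simp: P1_space_def)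
  ultimately show ?thesis unfolding P1_space_def by blast
qed

lemma P1_sum_gradient:
  fixes n :: nat
  assumes f: "\<And>j. j < n \<Longrightarrow> f j \<in> P1_space \<Omega> \<T>" and T: "T \<in> \<T>"
    and F: "\<And>x. x \<in> closure \<Omega> \<Longrightarrow> F x = (\<Sum>j<n. c j * f j x)"
  shows "gradient F (barycenter T) = (\<Sum>j<n. c j *\<^sub>R gradient (f j) (barycenter T))"
proof -
  obtain a b d where abd: "triangle_with a b d T" using mesh_triangle[OF T] .
  have "\<forall>j. \<exists>k. j < n \<longrightarrow> (\<forall>x\<in>T. f j x = inner (gradient (f j) (barycenter T)) x + k)"
    using P1_gradient[OF f T] by blast
  then obtain k where k: "\<And>j x. j < n \<Longrightarrow> x \<in> T \<Longrightarrow> f j x = inner (gradient (f j) (barycenter T)) x + k j"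
    by metis
  show ?thesis
  proof (rule gradient_of_locally_affine[OF open_interior barycenter_in_interior[OF abd]])
    fix x assume "x \<in> interior T"
    then have x: "x \<in> T" using interior_subset by blast
    then have "F x = (\<Sum>j<n. c j * f j x)" using F mesh_subset[OF T] by blast
    also have "\<dots> = (\<Sum>j<n. c j * inner (gradient (f j) (barycenter T)) x + c j * k j)"
      using k x by (intro sum.cong) (auto simp: distrib_left)
    also have "\<dots> = inner (\<Sum>j<n. c j *\<^sub>R gradient (f j) (barycenter T)) x + (\<Sum>j<n. c j * k j)"
      by (simp add: sum.distrib inner_sum_left)
    finally show "F x = inner (\<Sum>j<n. c j *\<^sub>R gradient (f j) (barycenter T)) x + (\<Sum>j<n. c j * k j)" .
  qed
qed

text \<open>A continuous function with finitely many values on a connected set is constant.\<close>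

lemma P1_zero_gradient_constant:
  assumes f: "f \<in> P1_space \<Omega> \<T>" and zero: "\<And>T. T \<in> \<T> \<Longrightarrow> gradient f (barycenter T) = 0"
  shows "\<exists>k. \<forall>x\<in>closure \<Omega>. f x = k"
proof -
  have "\<forall>T\<in>\<T>. \<exists>k. \<forall>x\<in>T. f x = k"
  proof
    fix T assume T: "T \<in> \<T>"
    then show "\<exists>k. \<forall>x\<in>T. f x = k" using P1_gradient[OF f T] zero[OF T] by simp
  qed
  then have "\<exists>K. \<forall>T\<in>\<T>. \<forall>x\<in>T. f x = K T" by (rule bchoice)
  then obtain K where K: "\<forall>T\<in>\<T>. \<forall>x\<in>T. f x = K T" by blast
  have "f ` closure \<Omega> \<subseteq> K ` \<T>"
  proof clarify
    fix x assume "x \<in> closure \<Omega>"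
    then obtain T where "T \<in> \<T>" "x \<in> T" using mesh_Union by blast
    then show "f x \<in> K ` \<T>" using K by simp
  qed
  then have "finite (f ` closure \<Omega>)" using finite_mesh finite_subset by blast
  moreover have "connected (closure \<Omega>)" using polygonal_domain_connected[OF domain] connected_imp_connected_closure by blast
  moreover have "continuous_on (closure \<Omega>) f" using f unfolding P1_space_def by blast
  ultimately have "f constant_on closure \<Omega>" by (intro continuous_finite_range_constant)
  then show ?thesis unfolding constant_on_def .
qed

lemma P1_gradient_injective:
  assumes basis: "is_function_basis (closure \<Omega>) (P1_mean_zero_space \<Omega> \<T>) fs"
    and zero: "\<And>T. T \<in> \<T> \<Longrightarrow> (\<Sum>j<length fs. c j *\<^sub>R gradient (fs ! j) (barycenter T)) = 0"
    and j: "j < length fs"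
  shows "c j = 0"
proof -
  define F where "F = (\<lambda>x. \<Sum>j<length fs. c j * (fs ! j) x)"
  have mz: "fs ! j \<in> P1_mean_zero_space \<Omega> \<T>" if "j < length fs" for j
    using basis that nth_mem unfolding is_function_basis_def by blast
  then have P1: "fs ! j \<in> P1_space \<Omega> \<T>" if "j < length fs" for j
    using that unfolding P1_mean_zero_space_def by blast
  have FP1: "F \<in> P1_space \<Omega> \<T>" unfolding F_def by (rule P1_sum) (rule P1)
  have "gradient F (barycenter T) = 0" if "T \<in> \<T>" for T
    using P1_sum_gradient[OF P1 that, where F = F and c = c] zero[OF that] unfolding F_def by simp
  then obtain k where k: "\<forall>x\<in>closure \<Omega>. F x = k" using P1_zero_gradient_constant[OF FP1] by blast
  have "set_lebesgue_integral lebesgue \<Omega> F = (\<Sum>j<length fs. c j * set_lebesgue_integral lebesgue \<Omega> (fs ! j))"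
  proof -
    have int: "integrable lebesgue (\<lambda>x. indicator \<Omega> x * (fs ! j) x)" if "j < length fs" for j
      using P1_integrable[OF P1[OF that]] unfolding set_integrable_def by simp
    have "set_lebesgue_integral lebesgue \<Omega> F =
        (LINT x|lebesgue. (\<Sum>j<length fs. c j * (indicator \<Omega> x * (fs ! j) x)))"
      unfolding set_lebesgue_integral_def F_def by (simp add: sum_distrib_left mult_ac)
    also have "\<dots> = (\<Sum>j<length fs. LINT x|lebesgue. c j * (indicator \<Omega> x * (fs ! j) x))"
      using int by (intro Bochner_Integration.integral_sum integrable_mult_right) simp
    also have "\<dots> = (\<Sum>j<length fs. c j * set_lebesgue_integral lebesgue \<Omega> (fs ! j))"
      unfolding set_lebesgue_integral_def by simp
    finally show ?thesis .
  qed
  also have "\<dots> = 0" using mz unfolding P1_mean_zero_space_def by simp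
  finally have "set_lebesgue_integral lebesgue \<Omega> F = 0" .
  moreover have "set_lebesgue_integral lebesgue \<Omega> F = set_lebesgue_integral lebesgue \<Omega> (\<lambda>x. k)"
    using k closure_subset domain_lmeasurable by (intro set_lebesgue_integral_cong) auto
  ultimately have "k = 0" using domain_measure_pos constant_integral[of k] by simp
  then have "\<forall>x\<in>closure \<Omega>. (\<Sum>j<length fs. c j * (fs ! j) x) = 0" using k unfolding F_def by simp
  then show ?thesis using basis j unfolding is_function_basis_def by blast
qed

lemma P1_subtract_mean:
  assumes q: "q \<in> P1_space \<Omega> \<T>"
  obtains m where "(\<lambda>x. q x - m) \<in> P1_mean_zero_space \<Omega> \<T>"
proof -
  define m where "m = set_lebesgue_integral lebesgue \<Omega> q / measure lebesgue \<Omega>"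
  have "(\<lambda>x. q x - m) \<in> P1_space \<Omega> \<T>"
  proof -
    have "affine_fun_on T (\<lambda>x. q x - m)" if T: "T \<in> \<T>" for T
    proof -
      have "affine_fun_on T q" using q T unfolding P1_space_def by blast
      then obtain g k where "\<forall>x\<in>T. q x = inner g x + k" unfolding affine_fun_on_def by blast
      then show ?thesis unfolding affine_fun_on_def by (intro exI[of _ g] exI[of _ "k - m"]) simp
    qed
    moreover have "continuous_on (closure \<Omega>) (\<lambda>x. q x - m)"
      using q by (intro continuous_intros) (auto simp: P1_space_def)
    ultimately show ?thesis unfolding P1_space_def by blast
  qed
  moreover have "set_lebesgue_integral lebesgue \<Omega> (\<lambda>x. q x - m) = 0"
    using set_integral_diff(2)[OF P1_integrable[OF q] P1_integrable[OF P1_constant[of m]]]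
      domain_measure_pos unfolding constant_integral m_def by simp
  ultimately show ?thesis using that unfolding P1_mean_zero_space_def by blast
qed

text \<open>Orthogonality to the gradients makes the normal components of \<open>w\<close> continuous across interior
  edges. So \<open>rot90 w\<close> has a potential \<open>q\<close>, and \<open>w\<close> is the curl of \<open>q\<close>. After subtraction of its mean,
  \<open>q\<close> is a combination of the \<open>fs\<close>, and orthogonality to their curls makes \<open>w\<close> orthogonal to itself.\<close>

lemma discrete_Helmholtz_complete:
  assumes CR: "\<And>e. e \<in> interior_edges \<Omega> \<T> \<Longrightarrow> CR_basis_function \<Omega> \<T> e (\<phi> e)"
    and basis: "is_function_basis (closure \<Omega>) (P1_mean_zero_space \<Omega> \<T>) fs"
    and grad: "\<And>e. e \<in> interior_edges \<Omega> \<T> \<Longrightarrow>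
      (\<Sum>T\<in>\<T>. area T * inner (gradient (\<phi> e) (barycenter T)) (w T)) = 0"
    and curl: "\<And>j. j < length fs \<Longrightarrow>
      (\<Sum>T\<in>\<T>. area T * inner (- rot90 (gradient (fs ! j) (barycenter T))) (w T)) = 0"
    and T: "T \<in> \<T>"
  shows "w T = 0"
proof -
  have tangential: "inner (rot90 (w S)) (y - x) = inner (rot90 (w R)) (y - x)"
    if SR: "S \<in> \<T>" "R \<in> \<T>" "S \<noteq> R" "closed_segment x y edge_of S" "closed_segment x y edge_of R" for S R x y
  proof -
    have int: "closed_segment x y \<in> interior_edges \<Omega> \<T>" by (rule shared_edge_interior[OF SR])
    then show ?thesis
    proof (rule CR_basis_pairing)
      fix a b S' T'
      assume e: "closed_segment x y = closed_segment a b"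
        and only: "\<And>R. R \<in> \<T> \<Longrightarrow> closed_segment x y edge_of R \<Longrightarrow> R = S' \<or> R = T'"
        and pair: "\<And>f w. CR_basis_function \<Omega> \<T> (closed_segment x y) f \<Longrightarrow>
          (\<Sum>R\<in>\<T>. area R * inner (gradient f (barycenter R)) (w R)) = cross2 (b - a) (w T' - w S')"
      have "cross2 (b - a) (w T' - w S') = 0" using pair[OF CR[OF int], of w] grad[OF int] by simp
      then have eq: "cross2 (b - a) (w T') = cross2 (b - a) (w S')" by (simp add: cross2_diff_right)
      have "S = S' \<and> R = T' \<or> S = T' \<and> R = S'"
        using only[OF SR(1,4)] only[OF SR(2,5)] SR(3) by blast
      then have eq': "cross2 (b - a) (w S) = cross2 (b - a) (w R)" using eq by auto
      have "{x, y} = {a, b}" using e by (simp add: closed_segment_eq)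
      then have "y - x = b - a \<or> y - x = - (b - a)" by (auto simp: doubleton_eq_iff)
      moreover have "cross2 (- v) z = - cross2 v z" for v z by (simp add: cross2_def)
      ultimately have "cross2 (y - x) (w S) = cross2 (y - x) (w R)" using eq' by metis
      then show ?thesis
        unfolding inner_rot90 using cross2_commute[of "w S"] cross2_commute[of "w R"] by simp
    qed
  qed
  show ?thesis
  proof (rule curl_free_potential[of "\<lambda>T. rot90 (w T)"])
    show "\<And>S T a b. \<lbrakk>S \<in> \<T>; T \<in> \<T>; S \<noteq> T; closed_segment a b edge_of S; closed_segment a b edge_of T\<rbrakk>
      \<Longrightarrow> inner (rot90 (w S)) (b - a) = inner (rot90 (w T)) (b - a)" by (rule tangential)
  next
    fix q assume qc: "continuous_on (closure \<Omega>) q"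
      and q: "\<And>T. T \<in> \<T> \<Longrightarrow> \<exists>k. \<forall>x\<in>T. q x = inner (rot90 (w T)) x + k"
    have "q \<in> P1_space \<Omega> \<T>" unfolding P1_space_def affine_fun_on_def using qc q by blast
    then obtain m where m: "(\<lambda>x. q x - m) \<in> P1_mean_zero_space \<Omega> \<T>" by (rule P1_subtract_mean)
    have fs: "fs ! j \<in> P1_space \<Omega> \<T>" if "j < length fs" for j
      using basis that nth_mem unfolding is_function_basis_def P1_mean_zero_space_def by blast
    have "\<forall>f\<in>P1_mean_zero_space \<Omega> \<T>. \<exists>c. \<forall>x\<in>closure \<Omega>. f x = (\<Sum>j<length fs. c j * (fs ! j) x)"
      using basis unfolding is_function_basis_def by blast
    from bspec[OF this m] obtain c where c: "\<And>x. x \<in> closure \<Omega> \<Longrightarrow> q x - m = (\<Sum>j<length fs. c j * (fs ! j) x)"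
      by blast
    have rot_w: "rot90 (w T) = (\<Sum>j<length fs. c j *\<^sub>R gradient (fs ! j) (barycenter T))" if T: "T \<in> \<T>" for T
    proof -
      obtain a b d where abd: "triangle_with a b d T" using mesh_triangle[OF T] .
      obtain k where k: "\<forall>x\<in>T. q x = inner (rot90 (w T)) x + k" using q[OF T] by blast
      have "gradient (\<lambda>x. q x - m) (barycenter T) = rot90 (w T)"
      proof (rule gradient_of_locally_affine[OF open_interior barycenter_in_interior[OF abd]])
        fix x assume "x \<in> interior T"
        then show "q x - m = inner (rot90 (w T)) x + (k - m)" using k interior_subset by fastforce
      qed
      moreover have "gradient (\<lambda>x. q x - m) (barycenter T) = (\<Sum>j<length fs. c j *\<^sub>R gradient (fs ! j) (barycenter T))"
        by (rule P1_sum_gradient[OF fs T c])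
      ultimately show ?thesis by simp
    qed
    have "(\<Sum>T\<in>\<T>. area T * inner (rot90 (w T)) (rot90 (w T))) =
        (\<Sum>T\<in>\<T>. \<Sum>j<length fs. c j * (area T * inner (gradient (fs ! j) (barycenter T)) (rot90 (w T))))"
    proof (rule sum.cong[OF refl])
      fix T assume "T \<in> \<T>"
      then have "inner (rot90 (w T)) (rot90 (w T)) =
          inner (\<Sum>j<length fs. c j *\<^sub>R gradient (fs ! j) (barycenter T)) (rot90 (w T))" using rot_w by metis
      then show "area T * inner (rot90 (w T)) (rot90 (w T)) =
          (\<Sum>j<length fs. c j * (area T * inner (gradient (fs ! j) (barycenter T)) (rot90 (w T))))"
        by (simp add: inner_sum_left sum_distrib_left mult_ac)
    qed
    also have "\<dots> = (\<Sum>j<length fs. c j * (\<Sum>T\<in>\<T>. area T * inner (gradient (fs ! j) (barycenter T)) (rot90 (w T))))"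
      by (subst sum.swap) (simp add: sum_distrib_left)
    also have "\<dots> = 0"
    proof (rule sum.neutral, clarify)
      fix j assume "j < length fs"
      have "inner g (rot90 v) = inner (- rot90 g) v" for g v
        by (simp add: inner_plane rot90_nth)
      then show "c j * (\<Sum>T\<in>\<T>. area T * inner (gradient (fs ! j) (barycenter T)) (rot90 (w T))) = 0"
        using curl[OF \<open>j < length fs\<close>] by simp
    qed
    finally have sum0: "(\<Sum>T\<in>\<T>. area T * inner (rot90 (w T)) (rot90 (w T))) = 0" .
    have "\<forall>T\<in>\<T>. area T * inner (rot90 (w T)) (rot90 (w T)) = 0"
    proof (rule iffD1[OF sum_nonneg_eq_0_iff sum0])
      fix T assume "T \<in> \<T>"
      then show "area T * inner (rot90 (w T)) (rot90 (w T)) \<ge> 0" using area_pos[of T] by simp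
    qed (rule finite_mesh)
    then show "w T = 0" using bspec[OF _ T] area_pos[OF T] by (force simp: inner_rot90_rot90)
  qed
qed

text \<open>The bounds on \<open>\<kappa>\<close> are available on the open domain only; it contains the interior of every
  triangle, and the boundary of a triangle has measure zero.\<close>

lemma triangle_average_bounds:
  assumes T: "T \<in> \<T>" and meas: "\<kappa> \<in> borel_measurable (lebesgue_on \<Omega>)"
    and \<kappa>: "\<And>x. x \<in> \<Omega> \<Longrightarrow> \<kappa>min \<le> \<kappa> x \<and> \<kappa> x \<le> \<kappa>max"
  shows "\<kappa>min \<le> triangle_average \<kappa> T \<and> triangle_average \<kappa> T \<le> \<kappa>max"
proof -
  let ?I = "interior T"
  have IO: "?I \<subseteq> \<Omega>" using mesh_interior_subset[OF T] .
  have lm: "?I \<in> lmeasurable"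
    using bounded_subset[OF polygonal_domain_bounded[OF domain] IO] lmeasurable_open by blast
  have area: "measure lebesgue ?I = area T"
    unfolding area_def using measure_interior[of T] mesh_convex[OF T] mesh_closed[OF T]
      bounded_subset[OF bounded_closure[OF polygonal_domain_bounded[OF domain]] mesh_subset[OF T]]
      negligible_convex_frontier by blast
  have "\<kappa> \<in> borel_measurable (lebesgue_on ?I)"
    using meas IO lm by (metis fmeasurableD measurable_restrict_mono)
  then have m: "set_borel_measurable lebesgue ?I \<kappa>"
    unfolding set_borel_measurable_def using borel_measurable_restrict_space_iff[of ?I lebesgue \<kappa>] lm by simp
  have const: "set_integrable lebesgue ?I (\<lambda>x. k)" for k :: real
    using lm unfolding set_integrable_def by (simp add: fmeasurable_def)
  have int: "set_integrable lebesgue ?I \<kappa>"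
  proof (rule set_integrable_bound[OF const[of "max \<bar>\<kappa>min\<bar> \<bar>\<kappa>max\<bar>"] m])
    show "AE x in lebesgue. x \<in> ?I \<longrightarrow> norm (\<kappa> x) \<le> norm (max \<bar>\<kappa>min\<bar> \<bar>\<kappa>max\<bar>)"
    proof (intro AE_I2 impI)
      fix x assume "x \<in> ?I"
      then have "\<kappa>min \<le> \<kappa> x" "\<kappa> x \<le> \<kappa>max" using \<kappa> IO by auto
      then show "norm (\<kappa> x) \<le> norm (max \<bar>\<kappa>min\<bar> \<bar>\<kappa>max\<bar>)" by auto
    qed
  qed
  have c: "set_lebesgue_integral lebesgue ?I (\<lambda>x. k) = area T * k" for k :: real
    using lm by (simp add: set_integral_const fmeasurable_def area)
  have "set_lebesgue_integral lebesgue ?I (\<lambda>x. \<kappa>min) \<le> set_lebesgue_integral lebesgue ?I \<kappa>"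
    "set_lebesgue_integral lebesgue ?I \<kappa> \<le> set_lebesgue_integral lebesgue ?I (\<lambda>x. \<kappa>max)"
    using \<kappa> IO by (auto intro!: set_integral_mono const int)
  then show ?thesis
    unfolding c triangle_average_def using area_pos[OF T] by (simp add: field_simps)
qed

end

section \<open>From piecewise constant fields to matrices\<close>

lemma scaled_deriv_mat_mult_vec:
  assumes "x \<in> carrier_vec (length fs)" "i < length ts"
  shows "vec_index (scaled_deriv_mat ts fs l *\<^sub>v x) i =
    sqrt (area (ts ! i)) * vec_nth (\<Sum>j<length fs. vec_index x j *\<^sub>R gradient (fs ! j) (barycenter (ts ! i))) l"
proof -
  have "vec_index (scaled_deriv_mat ts fs l *\<^sub>v x) i =
      (\<Sum>j<length fs. sqrt (area (ts ! i)) * partial_deriv l (fs ! j) (barycenter (ts ! i)) * vec_index x j)"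
    using assms unfolding scaled_deriv_mat_def by (simp add: scalar_prod_def atLeast0LessThan)
  also have "\<dots> = sqrt (area (ts ! i)) * (\<Sum>j<length fs. vec_index x j * partial_deriv l (fs ! j) (barycenter (ts ! i)))"
    unfolding sum_distrib_left by (intro sum.cong) (simp_all add: mult_ac)
  also have "(\<Sum>j<length fs. vec_index x j * partial_deriv l (fs ! j) (barycenter (ts ! i))) =
      vec_nth (\<Sum>j<length fs. vec_index x j *\<^sub>R gradient (fs ! j) (barycenter (ts ! i))) l"
    by (simp add: gradient_nth)
  finally show ?thesis .
qed

lemma scaled_deriv_mat_carrier: "scaled_deriv_mat ts fs l \<in> carrier_mat (length ts) (length fs)"
  unfolding scaled_deriv_mat_def by simp

lemma grad_mat_carrier: "grad_mat ts fs \<in> carrier_mat (length ts + length ts) (length fs)"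
  unfolding grad_mat_def by (intro carrier_append_rows scaled_deriv_mat_carrier)

lemma curl_mat_carrier: "curl_mat ts fs \<in> carrier_mat (length ts + length ts) (length fs)"
  unfolding curl_mat_def by (intro carrier_append_rows uminus_carrier_mat scaled_deriv_mat_carrier)

text \<open>Coordinates of a piecewise constant vector field in the row order of the matrices. With these
  weights the scalar product of coordinate vectors is the \<open>L\<^sup>2\<close> product of the fields.\<close>

definition field_vec :: "(real^2) set list \<Rightarrow> ((real^2) set \<Rightarrow> real^2) \<Rightarrow> real vec" where
  "field_vec ts w = Matrix.vec (length ts) (\<lambda>i. sqrt (area (ts ! i)) * vec_nth (w (ts ! i)) 1) @\<^sub>v
     Matrix.vec (length ts) (\<lambda>i. sqrt (area (ts ! i)) * vec_nth (w (ts ! i)) 2)"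

lemma field_vec_carrier: "field_vec ts w \<in> carrier_vec (length ts + length ts)"
  unfolding field_vec_def by simp

lemma grad_mat_mult_vec:
  assumes "x \<in> carrier_vec (length fs)"
  shows "grad_mat ts fs *\<^sub>v x =
    field_vec ts (\<lambda>T. \<Sum>j<length fs. vec_index x j *\<^sub>R gradient (fs ! j) (barycenter T))"
proof -
  have rows: "scaled_deriv_mat ts fs l *\<^sub>v x = Matrix.vec (length ts) (\<lambda>i. sqrt (area (ts ! i)) *
      vec_nth (\<Sum>j<length fs. vec_index x j *\<^sub>R gradient (fs ! j) (barycenter (ts ! i))) l)" for l
  proof (rule eq_vecI)
    show "dim_vec (scaled_deriv_mat ts fs l *\<^sub>v x) = dim_vec (Matrix.vec (length ts) (\<lambda>i. sqrt (area (ts ! i)) *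
      vec_nth (\<Sum>j<length fs. vec_index x j *\<^sub>R gradient (fs ! j) (barycenter (ts ! i))) l))"
      by (simp add: scaled_deriv_mat_def)
  qed (simp only: dim_vec index_vec scaled_deriv_mat_mult_vec[OF assms])
  show ?thesis
    unfolding grad_mat_def field_vec_def
    by (simp only: mat_mult_append[OF scaled_deriv_mat_carrier scaled_deriv_mat_carrier assms] rows)
qed

lemma curl_mat_mult_vec:
  assumes "x \<in> carrier_vec (length fs)"
  shows "curl_mat ts fs *\<^sub>v x =
    field_vec ts (\<lambda>T. - rot90 (\<Sum>j<length fs. vec_index x j *\<^sub>R gradient (fs ! j) (barycenter T)))"
proof -
  have row2: "scaled_deriv_mat ts fs 2 *\<^sub>v x = Matrix.vec (length ts) (\<lambda>i. sqrt (area (ts ! i)) *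
      vec_nth (- rot90 (\<Sum>j<length fs. vec_index x j *\<^sub>R gradient (fs ! j) (barycenter (ts ! i)))) 1)"
  proof (rule eq_vecI)
    fix i assume "i < dim_vec (Matrix.vec (length ts) (\<lambda>i. sqrt (area (ts ! i)) *
      vec_nth (- rot90 (\<Sum>j<length fs. vec_index x j *\<^sub>R gradient (fs ! j) (barycenter (ts ! i)))) 1))"
    then have i: "i < length ts" by (simp only: dim_vec)
    show "vec_index (scaled_deriv_mat ts fs 2 *\<^sub>v x) i = vec_index (Matrix.vec (length ts) (\<lambda>i. sqrt (area (ts ! i)) *
      vec_nth (- rot90 (\<Sum>j<length fs. vec_index x j *\<^sub>R gradient (fs ! j) (barycenter (ts ! i)))) 1)) i"
      unfolding index_vec[OF i] scaled_deriv_mat_mult_vec[OF assms i] vector_uminus_component rot90_nth by simp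
  qed (simp add: scaled_deriv_mat_def)
  have row1: "(- scaled_deriv_mat ts fs 1) *\<^sub>v x = Matrix.vec (length ts) (\<lambda>i. sqrt (area (ts ! i)) *
      vec_nth (- rot90 (\<Sum>j<length fs. vec_index x j *\<^sub>R gradient (fs ! j) (barycenter (ts ! i)))) 2)"
  proof (rule eq_vecI)
    fix i assume "i < dim_vec (Matrix.vec (length ts) (\<lambda>i. sqrt (area (ts ! i)) *
      vec_nth (- rot90 (\<Sum>j<length fs. vec_index x j *\<^sub>R gradient (fs ! j) (barycenter (ts ! i)))) 2))"
    then have i: "i < length ts" by (simp only: dim_vec)
    have "vec_index ((- scaled_deriv_mat ts fs 1) *\<^sub>v x) i = - vec_index (scaled_deriv_mat ts fs 1 *\<^sub>v x) i"
      using i assms scaled_deriv_mat_carrier[of ts fs 1]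
      by (simp add: uminus_mult_mat_vec)
    then show "vec_index ((- scaled_deriv_mat ts fs 1) *\<^sub>v x) i = vec_index (Matrix.vec (length ts) (\<lambda>i. sqrt (area (ts ! i)) *
      vec_nth (- rot90 (\<Sum>j<length fs. vec_index x j *\<^sub>R gradient (fs ! j) (barycenter (ts ! i)))) 2)) i"
      unfolding index_vec[OF i] scaled_deriv_mat_mult_vec[OF assms i] vector_uminus_component rot90_nth by simp
  qed (simp add: scaled_deriv_mat_def)
  show ?thesis
    unfolding curl_mat_def field_vec_def
    by (simp only: mat_mult_append[OF scaled_deriv_mat_carrier uminus_carrier_mat[OF scaled_deriv_mat_carrier] assms] row1 row2)
qed

lemma scalar_prod_field_vec:
  assumes "distinct ts" and nonneg: "\<And>T. T \<in> set ts \<Longrightarrow> area T \<ge> 0"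
  shows "scalar_prod (field_vec ts v) (field_vec ts w) = (\<Sum>T\<in>set ts. area T * inner (v T) (w T))"
proof -
  let ?n = "length ts"
  have "scalar_prod (field_vec ts v) (field_vec ts w) =
      (\<Sum>i<?n. (sqrt (area (ts ! i)) * vec_nth (v (ts ! i)) 1) * (sqrt (area (ts ! i)) * vec_nth (w (ts ! i)) 1)) +
      (\<Sum>i<?n. (sqrt (area (ts ! i)) * vec_nth (v (ts ! i)) 2) * (sqrt (area (ts ! i)) * vec_nth (w (ts ! i)) 2))"
    unfolding field_vec_def
    by (subst scalar_prod_append[where ?n1.0 = ?n and ?n2.0 = ?n])
      (auto simp: scalar_prod_def atLeast0LessThan)
  also have "\<dots> = (\<Sum>i<?n. area (ts ! i) * inner (v (ts ! i)) (w (ts ! i)))"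
    unfolding sum.distrib[symmetric]
  proof (rule sum.cong[OF refl])
    fix i assume "i \<in> {..<?n}"
    then have sq: "sqrt (area (ts ! i)) * sqrt (area (ts ! i)) = area (ts ! i)"
      using nonneg by simp
    have "(s * a) * (s * b) + (s * c) * (s * d) = (s * s) * (a * b + c * d)" for s a b c d :: real
      by (simp add: algebra_simps)
    then show "(sqrt (area (ts ! i)) * vec_nth (v (ts ! i)) 1) * (sqrt (area (ts ! i)) * vec_nth (w (ts ! i)) 1) +
        (sqrt (area (ts ! i)) * vec_nth (v (ts ! i)) 2) * (sqrt (area (ts ! i)) * vec_nth (w (ts ! i)) 2) =
        area (ts ! i) * inner (v (ts ! i)) (w (ts ! i))"
      unfolding inner_plane by (simp only: sq)
  qed
  also have "\<dots> = (\<Sum>T\<in>set ts. area T * inner (v T) (w T))"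
    by (rule sum.reindex_bij_betw[OF bij_betw_nth[OF assms(1) refl refl]])
  finally show ?thesis .
qed

lemma field_vec_eq_zero:
  assumes "distinct ts" "\<And>T. T \<in> set ts \<Longrightarrow> area T > 0"
    and zero: "field_vec ts w = 0\<^sub>v (length ts + length ts)" and T: "T \<in> set ts"
  shows "w T = 0"
proof -
  have "scalar_prod (field_vec ts w) (field_vec ts w) = 0" unfolding zero by simp
  then have sum0: "(\<Sum>T\<in>set ts. area T * inner (w T) (w T)) = 0"
    by (simp only: scalar_prod_field_vec[OF assms(1) less_imp_le[OF assms(2)]])
  have "\<forall>T\<in>set ts. area T * inner (w T) (w T) = 0"
  proof (rule iffD1[OF sum_nonneg_eq_0_iff sum0])
    fix T assume "T \<in> set ts"
    then show "area T * inner (w T) (w T) \<ge> 0" using assms(2)[of T] by simp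
  qed simp
  then have "area T * inner (w T) (w T) = 0" using T by blast
  then show ?thesis using assms(2)[OF T] by simp
qed

lemma field_vec_surj:
  assumes "distinct ts" "\<And>T. T \<in> set ts \<Longrightarrow> area T > 0" and z: "z \<in> carrier_vec (length ts + length ts)"
  shows "\<exists>w. z = field_vec ts w"
proof (rule exI)
  let ?n = "length ts"
  define w where "w = (\<lambda>T. let i = (SOME i. i < ?n \<and> ts ! i = T) in
    (\<chi> l. if l = 1 then vec_index z i / sqrt (area T) else vec_index z (?n + i) / sqrt (area T)) :: real^2)"
  have pick: "(SOME j. j < ?n \<and> ts ! j = ts ! i) = i" if "i < ?n" for i
    using assms(1) that by (intro some_equality) (auto simp: nth_eq_iff_index_eq)
  have w1: "sqrt (area (ts ! i)) * vec_nth (w (ts ! i)) 1 = vec_index z i"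
    and w2: "sqrt (area (ts ! i)) * vec_nth (w (ts ! i)) 2 = vec_index z (?n + i)" if "i < ?n" for i
    using assms(2)[of "ts ! i"] that unfolding w_def pick[OF that] Let_def by simp_all
  show "z = field_vec ts w"
  proof (rule eq_vecI)
    fix i assume "i < dim_vec (field_vec ts w)"
    then have i: "i < ?n + ?n" using field_vec_carrier[of ts w] by simp
    show "vec_index z i = vec_index (field_vec ts w) i"
    proof (cases "i < ?n")
      case True
      then show ?thesis unfolding field_vec_def using w1[OF True] by simp
    next
      case False
      then show ?thesis unfolding field_vec_def using w2[of "i - ?n"] i by simp
    qed
  qed (use z field_vec_carrier[of ts w] in simp)
qed

lemma coeff_mat_eq_diag:
  "coeff_mat ts \<kappa> = mat_diag (length ts + length ts)
    (\<lambda>i. triangle_average \<kappa> (ts ! (if i < length ts then i else i - length ts)))"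
  unfolding coeff_mat_def Let_def
  by (rule eq_matI) (auto simp: mat_diag_def)

lemma transpose_mult_vec_zeroI:
  fixes A :: "real mat"
  assumes A: "A \<in> carrier_mat n m" and w: "w \<in> carrier_vec n" and z: "transpose_mat A *\<^sub>v w = 0\<^sub>v m"
    and x: "x \<in> carrier_vec m"
  shows "scalar_prod (A *\<^sub>v x) w = 0"
proof -
  have "scalar_prod (A *\<^sub>v x) w = scalar_prod w (A *\<^sub>v x)" using A w x by (intro comm_scalar_prod[of _ n]) auto
  also have "\<dots> = scalar_prod (transpose_mat A *\<^sub>v w) x" using transpose_vec_mult_scalar[OF A x w] by simp
  finally show ?thesis using z x by simp
qed

lemma sum_unit_vec:
  assumes "j < n" shows "(\<Sum>i<n. vec_index (unit_vec n j) i *\<^sub>R f i) = (f j :: 'a :: real_vector)"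
proof -
  have "(\<Sum>i<n. vec_index (unit_vec n j) i *\<^sub>R f i) = (\<Sum>i<n. if i = j then f j else 0)"
    using assms by (intro sum.cong) (auto simp: unit_vec_def)
  then show ?thesis using assms by simp
qed

theorem theorem1:
  fixes \<Omega> :: "(real^2) set"
    and \<T> :: "(real^2) set set"
    and ts :: "(real^2) set list"
    and es :: "(real^2) set list"
    and \<phi> :: "(real^2) set \<Rightarrow> real^2 \<Rightarrow> real"
    and \<psi>s :: "(real^2 \<Rightarrow> real) list"
    and \<kappa> :: "real^2 \<Rightarrow> real"
    and \<kappa>min \<kappa>max \<eta> :: real
    and H D Ah :: "real mat"
  assumes domain: "polygonal_domain \<Omega>"
    and mesh: "triangulation_of \<T> \<Omega>"
    and triangles: "distinct ts" "set ts = \<T>"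
    and edges: "distinct es" "set es = interior_edges \<Omega> \<T>"
    and CR_basis: "\<And>e. e \<in> interior_edges \<Omega> \<T> \<Longrightarrow> CR_basis_function \<Omega> \<T> e (\<phi> e)"
    and P1_basis: "length \<psi>s = card (mesh_vertices \<T>) - 1"
      "is_function_basis (closure \<Omega>) (P1_mean_zero_space \<Omega> \<T>) \<psi>s"
    and kappa_measurable: "\<kappa> \<in> borel_measurable (lebesgue_on \<Omega>)"
    and kappa_bounds: "0 < \<kappa>min" "\<kappa>min \<le> \<kappa>max" "\<And>x. x \<in> \<Omega> \<Longrightarrow> \<kappa>min \<le> \<kappa> x \<and> \<kappa> x \<le> \<kappa>max"
    and contrast: "\<eta> = \<kappa>max / \<kappa>min"
    and H: "H = H_mat ts (map \<phi> es) \<psi>s"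
    and D: "D = coeff_mat ts \<kappa>"
    and Ah: "Ah = A_hat ts (map \<phi> es) \<psi>s \<kappa>"
  shows "spectral_cond (inv_mat H * inv_mat D * inv_mat (transpose_mat H) * Ah) \<le> 2 * \<eta> - 1"
proof -
  interpret triangulated_polygon \<Omega> \<T> using domain mesh by unfold_locales
  let ?n = "length ts + length ts" and ?G = "grad_mat ts (map \<phi> es)" and ?C = "curl_mat ts \<psi>s"
  let ?p = "length es" and ?q = "length \<psi>s"
  define d where "d = (\<lambda>i. triangle_average \<kappa> (ts ! (if i < length ts then i else i - length ts)))"
  have area: "area T > 0" if "T \<in> set ts" for T using area_pos that triangles(2) by blast
  have fv_prod: "scalar_prod (field_vec ts v) (field_vec ts w) = (\<Sum>T\<in>\<T>. area T * inner (v T) (w T))" for v w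
    unfolding triangles(2)[symmetric]
    by (rule scalar_prod_field_vec[OF triangles(1)]) (rule less_imp_le, rule area)
  have G: "?G \<in> carrier_mat ?n ?p" using grad_mat_carrier[of ts "map \<phi> es"] by simp
  have C: "?C \<in> carrier_mat ?n ?q" by (rule curl_mat_carrier)
  have \<psi>: "\<psi>s ! j \<in> P1_space \<Omega> \<T>" if "j < ?q" for j
    using P1_basis(2) that nth_mem unfolding is_function_basis_def P1_mean_zero_space_def by blast
  have es: "es ! j \<in> interior_edges \<Omega> \<T>" if "j < ?p" for j using edges(2) that nth_mem by blast
  define gradG where "gradG = (\<lambda>x T. \<Sum>j<?p. vec_index x j *\<^sub>R gradient (\<phi> (es ! j)) (barycenter T))"
  define gradC where "gradC = (\<lambda>y T. \<Sum>j<?q. vec_index y j *\<^sub>R gradient (\<psi>s ! j) (barycenter T))"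
  have Gx: "?G *\<^sub>v x = field_vec ts (gradG x)" if "x \<in> carrier_vec ?p" for x
    using grad_mat_mult_vec[of x "map \<phi> es" ts] that unfolding gradG_def by simp
  have Cy: "?C *\<^sub>v y = field_vec ts (\<lambda>T. - rot90 (gradC y T))" if "y \<in> carrier_vec ?q" for y
    using curl_mat_mult_vec[OF that] unfolding gradC_def .
  have "spectral_cond (inv_mat (append_cols ?G ?C) * inv_mat (mat_diag ?n d) * inv_mat (transpose_mat (append_cols ?G ?C)) *
      diag_block_mat [transpose_mat ?G * mat_diag ?n d * ?G, transpose_mat ?C * mat_diag ?n d * ?C])
      \<le> 2 * (\<kappa>max / \<kappa>min) - 1"
  proof (rule orthogonal_blocks_spectral_cond[OF G C])
    have "\<Union>\<T> \<noteq> {}" using mesh_Union polygonal_domain_nonempty[OF domain] by simp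
    then have "\<T> \<noteq> {}" by blast
    then show "?n > 0" using triangles(2) by auto
  next
    fix x y :: "real vec" assume x: "x \<in> carrier_vec ?p" and y: "y \<in> carrier_vec ?q"
    define F where "F = (\<lambda>z. \<Sum>j<?q. vec_index y j * (\<psi>s ! j) z)"
    have FP1: "F \<in> P1_space \<Omega> \<T>" unfolding F_def by (rule P1_sum) (rule \<psi>)
    have gradF: "gradient F (barycenter T) = gradC y T" if "T \<in> \<T>" for T
      unfolding gradC_def by (rule P1_sum_gradient[OF \<psi> that]) (simp_all add: F_def)
    have "scalar_prod (?G *\<^sub>v x) (?C *\<^sub>v y) = (\<Sum>T\<in>\<T>. area T * inner (gradG x T) (- rot90 (gradC y T)))"
      unfolding Gx[OF x] Cy[OF y] fv_prod ..
    also have "\<dots> = (\<Sum>T\<in>\<T>. \<Sum>j<?p. vec_index x j *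
        (area T * inner (gradient (\<phi> (es ! j)) (barycenter T)) (- rot90 (gradient F (barycenter T)))))"
    proof (rule sum.cong[OF refl])
      fix T assume "T \<in> \<T>"
      then show "area T * inner (gradG x T) (- rot90 (gradC y T)) = (\<Sum>j<?p. vec_index x j *
        (area T * inner (gradient (\<phi> (es ! j)) (barycenter T)) (- rot90 (gradient F (barycenter T)))))"
        unfolding gradF[OF \<open>T \<in> \<T>\<close>] unfolding gradG_def inner_sum_left sum_distrib_left
        by (intro sum.cong) simp_all
    qed
    also have "\<dots> = (\<Sum>j<?p. vec_index x j *
        (\<Sum>T\<in>\<T>. area T * inner (gradient (\<phi> (es ! j)) (barycenter T)) (- rot90 (gradient F (barycenter T)))))"
      by (subst sum.swap) (simp only: sum_distrib_left)
    also have "\<dots> = 0"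
    proof (rule sum.neutral, clarify)
      fix j assume "j < ?p"
      then show "vec_index x j * (\<Sum>T\<in>\<T>. area T * inner (gradient (\<phi> (es ! j)) (barycenter T)) (- rot90 (gradient F (barycenter T)))) = 0"
        using CR_gradient_orthogonal_curl[OF CR_basis[OF es] es FP1] by simp
    qed
    finally show "scalar_prod (?G *\<^sub>v x) (?C *\<^sub>v y) = 0" .
  next
    fix x :: "real vec" assume x: "x \<in> carrier_vec ?p" and zero: "?G *\<^sub>v x = 0\<^sub>v ?n"
    have g0: "gradG x T = 0" if "T \<in> \<T>" for T
      using field_vec_eq_zero[OF triangles(1) area] zero that triangles(2) unfolding Gx[OF x] by blast
    \<comment> \<open>coefficients are indexed by position in the vector and by edge in the mesh lemmas\<close>
    define c where "c = (\<lambda>e. vec_index x (THE j. j < ?p \<and> es ! j = e))"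
    have c: "c (es ! j) = vec_index x j" if "j < ?p" for j
    proof -
      have "(THE i. i < ?p \<and> es ! i = es ! j) = j"
        using edges(1) that by (intro the_equality) (auto simp: nth_eq_iff_index_eq)
      then show ?thesis unfolding c_def by simp
    qed
    have sum_c: "(\<Sum>e\<in>set es. c e *\<^sub>R gradient (\<phi> e) (barycenter T)) = 0" if "T \<in> \<T>" for T
    proof -
      have "(\<Sum>e\<in>set es. c e *\<^sub>R gradient (\<phi> e) (barycenter T)) =
          (\<Sum>j<?p. c (es ! j) *\<^sub>R gradient (\<phi> (es ! j)) (barycenter T))"
        by (rule sum.reindex_bij_betw[OF bij_betw_nth[OF edges(1) refl refl], symmetric])
      also have "\<dots> = gradG x T" unfolding gradG_def by (intro sum.cong) (simp_all add: c)
      finally show ?thesis using g0[OF that] by simp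
    qed
    show "x = 0\<^sub>v ?p"
    proof (rule eq_vecI)
      fix j assume "j < dim_vec (0\<^sub>v ?p :: real vec)"
      then have j: "j < ?p" by simp
      have "c (es ! j) = 0"
        by (rule CR_gradient_injective[OF CR_basis]) (use sum_c edges(2) es[OF j] in simp_all)
      then show "vec_index x j = vec_index (0\<^sub>v ?p) j" using c[OF j] j by simp
    qed (use x in simp)
  next
    fix y :: "real vec" assume y: "y \<in> carrier_vec ?q" and zero: "?C *\<^sub>v y = 0\<^sub>v ?n"
    have g0: "gradC y T = 0" if "T \<in> \<T>" for T
    proof -
      have "- rot90 (gradC y T) = 0"
        using field_vec_eq_zero[OF triangles(1) area] zero that triangles(2) unfolding Cy[OF y] by blast
      then have "inner (gradC y T) (gradC y T) = 0" using inner_rot90_rot90[of "gradC y T" "gradC y T"] by simp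
      then show ?thesis by simp
    qed
    show "y = 0\<^sub>v ?q"
    proof (rule eq_vecI)
      fix j assume "j < dim_vec (0\<^sub>v ?q :: real vec)"
      then have j: "j < ?q" by simp
      have "vec_index y j = 0"
        by (rule P1_gradient_injective[OF P1_basis(2) _ j, of "vec_index y"]) (use g0 in \<open>simp add: gradC_def\<close>)
      then show "vec_index y j = vec_index (0\<^sub>v ?q) j" using j by simp
    qed (use y in simp)
  next
    fix z :: "real vec"
    assume z: "z \<in> carrier_vec ?n" and Gz: "transpose_mat ?G *\<^sub>v z = 0\<^sub>v ?p" and Cz: "transpose_mat ?C *\<^sub>v z = 0\<^sub>v ?q"
    have "\<exists>w. z = field_vec ts w" by (rule field_vec_surj[OF triangles(1) _ z]) (rule area)
    then obtain w where w: "z = field_vec ts w" ..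
    have grad0: "(\<Sum>T\<in>\<T>. area T * inner (gradient (\<phi> e) (barycenter T)) (w T)) = 0"
      if "e \<in> interior_edges \<Omega> \<T>" for e
    proof -
      have "e \<in> set es" using that edges(2) by simp
      then have "\<exists>j. j < ?p \<and> es ! j = e" by (simp only: in_set_conv_nth)
      then obtain j where "j < ?p \<and> es ! j = e" ..
      then have j: "j < ?p" "es ! j = e" by simp_all
      have "scalar_prod (?G *\<^sub>v unit_vec ?p j) z = 0" by (rule transpose_mult_vec_zeroI[OF G z Gz]) simp
      then show ?thesis
        unfolding Gx[OF unit_vec_carrier] w fv_prod gradG_def sum_unit_vec[OF j(1)] j(2) .
    qed
    have curl0: "(\<Sum>T\<in>\<T>. area T * inner (- rot90 (gradient (\<psi>s ! j) (barycenter T))) (w T)) = 0"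
      if j: "j < ?q" for j
    proof -
      have "scalar_prod (?C *\<^sub>v unit_vec ?q j) z = 0" by (rule transpose_mult_vec_zeroI[OF C z Cz]) simp
      then show ?thesis
        unfolding Cy[OF unit_vec_carrier] w fv_prod gradC_def sum_unit_vec[OF j] .
    qed
    have "w T = 0" if "T \<in> \<T>" for T
      by (rule discrete_Helmholtz_complete[OF CR_basis P1_basis(2) grad0 curl0 that])
    then have "scalar_prod z z = 0" unfolding w fv_prod by simp
    then show "z = 0\<^sub>v ?n" using scalar_prod_self_zero[OF z] by blast
  next
    fix i assume "i < ?n"
    then have "ts ! (if i < length ts then i else i - length ts) \<in> \<T>" using triangles(2) by auto
    then show "\<kappa>min \<le> d i \<and> d i \<le> \<kappa>max"
      unfolding d_def by (rule triangle_average_bounds[OF _ kappa_measurable kappa_bounds(3)])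
  qed (rule kappa_bounds)+
  then show ?thesis
    unfolding H D Ah contrast H_mat_def A_hat_def Let_def coeff_mat_eq_diag d_def .
qed

end
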